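(* Let $\mathcal{V}$ be a finite ground set and let $f:2^{\mathcal{V}}\to\mathbb{R}^{+}$ be a normalized ($f(\emptyset)=0$) monotone submodular function, accessible only through a value oracle. Let $\mathcal{S}$ be a sequence of insertions and deletions of elements of $\mathcal{V}$, fixed in advance by an oblivious adversary, and for each time $t$ let $V_t$ denote the set of elements inserted up to time $t$ and not deleted after their latest insertion. Let $0<\epsilon\le 1$. \begin{enumerate} \item Let $\mathcal{M}(\mathcal{V},\mathcal{I})$ be a matroid of rank $k$, accessible through an independence oracle. There is a randomized dynamic algorithm that, at every time $t$, maintains an independent set $S_t\in\mathcal{I}$ with $S_t\subseteq V_t$ that is a $(4+\epsilon)$-approximation of $OPT_t=\max_{I\subseteq V_t,\ I\in\mathcal{I}} f(I)$ (i.e. $(4+\epsilon)f(S_t)\ge OPT_t$), using worst-case expected $O\!\left(k\log(k)\log^{3}(k/\epsilon)\right)$ oracle queries per update. \item Let $k\in\mathbb{N}$ be a cardinality bound. There is a randomized dynamic algorithm that, at every time $t$, maintains a set $S_t\subseteq V_t$ with $|S_t|\le k$ that is a $(2+\epsilon)$-approximation of $OPT_t=\max_{I\subseteq V_t,\ |I|\le k} f(I)$, using worst-case expected $O\!\left(k\epsilon^{-1}\log^{2}(k)\right)$ oracle queries per update. \end{enumerate}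
   Context: A function $f:2^{\mathcal{V}}\to\mathbb{R}^+$ is submodular if $f(A\cup\{e\})-f(A)\ge f(B\cup\{e\})-f(B)$ for all $A\subseteq B\subseteq\mathcal{V}$ and $e\notin B$, and monotone if $f(A)\le f(B)$ whenever $A\subseteq B$. In the oblivious adversarial model the whole update sequence is fixed before the algorithm runs and does not depend on the algorithm's random bits. The query complexity of an update is the number of oracle queries (to the value oracle for $f$ or to the matroid independence oracle) the algorithm makes to process that update, given all computation done up to the previous time step; the bound is worst-case expected, meaning that for every update the expected number of queries to process it is at most the stated quantity. *)

theory Defs
  imports "HOL-Probability.Probability"
begin

section \<open>Submodular functions and matroids\<close>

definition submodular_on :: "'v set \<Rightarrow> ('v set \<Rightarrow> real) \<Rightarrow> bool" where
  "submodular_on V f \<longleftrightarrow>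
     (\<forall>A B e. A \<subseteq> B \<and> B \<subseteq> V \<and> e \<in> V \<and> e \<notin> B \<longrightarrow>
        f (A \<union> {e}) - f A \<ge> f (B \<union> {e}) - f B)"

definition normalized_monotone_submodular :: "'v set \<Rightarrow> ('v set \<Rightarrow> real) \<Rightarrow> bool" where
  "normalized_monotone_submodular V f \<longleftrightarrow>
     (\<forall>A\<subseteq>V. 0 \<le> f A) \<and> f {} = 0 \<and> mono_on (Pow V) f \<and> submodular_on V f"

definition matroid :: "'v set \<Rightarrow> 'v set set \<Rightarrow> bool" where
  "matroid V \<I> \<longleftrightarrow>
     finite V \<and> \<I> \<subseteq> Pow V \<and> {} \<in> \<I> \<and>
     (\<forall>A\<in>\<I>. \<forall>B\<subseteq>A. B \<in> \<I>) \<and>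
     (\<forall>A\<in>\<I>. \<forall>B\<in>\<I>. card A < card B \<longrightarrow> (\<exists>e\<in>B - A. insert e A \<in> \<I>))"

definition matroid_rank :: "'v set set \<Rightarrow> nat" where
  "matroid_rank \<I> = Max (card ` \<I>)"

definition opt :: "'v set set \<Rightarrow> ('v set \<Rightarrow> real) \<Rightarrow> 'v set \<Rightarrow> real" where
  "opt \<F> f W = Max (f ` {X \<in> \<F>. X \<subseteq> W})"

section \<open>Update sequences\<close>

datatype 'v update = Insert (elem: 'v) | Delete (elem: 'v)

text \<open>
  The elements present at time \<open>t\<close>, i.e. after the first \<open>t\<close> updates of the sequence (the update
  with list index \<open>i\<close> takes place at time \<open>i + 1\<close>).  Inserting a present element or deleting an
  absent one is permitted and has no effect.
\<close>

definition live :: "'v update list \<Rightarrow> nat \<Rightarrow> 'v set" where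
  "live us t = {e. \<exists>i<t. us ! i = Insert e \<and> (\<forall>j<t. i < j \<longrightarrow> us ! j \<noteq> Delete e)}"

section \<open>Randomized oracle algorithms\<close>

text \<open>
  A randomized computation that interacts with an oracle mapping queries \<open>'q\<close> to answers \<open>'a\<close> and
  returns a result \<open>'r\<close>.  It is a well-founded tree, so it terminates on every sequence of answers
  and random outcomes; steps other than queries are free.
\<close>

datatype ('q, 'a, 'r) prog =
    Return 'r
  | Query 'q "'a \<Rightarrow> ('q, 'a, 'r) prog"
  | Sample "nat pmf" "nat \<Rightarrow> ('q, 'a, 'r) prog"

text \<open>Joint distribution of the result and the number of queries.\<close>

primrec run :: "('q \<Rightarrow> 'a) \<Rightarrow> ('q, 'a, 'r) prog \<Rightarrow> ('r \<times> nat) pmf" where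
  "run orc (Return r) = return_pmf (r, 0)"
| "run orc (Query q c) = map_pmf (\<lambda>(r, n). (r, Suc n)) (run orc (c (orc q)))"
| "run orc (Sample p c) = bind_pmf p (\<lambda>i. run orc (c i))"

text \<open>
  An online algorithm consists of its current output together with a reaction to each possible next
  update: an oracle computation that produces the algorithm in its next state.  Using a codatatype
  avoids committing to a type of internal states: every state machine, whatever its state type,
  unfolds to an element of this type.  The initial state is deterministic and is obtained without
  queries, so there is no free preprocessing of the oracle; random choices can be made in the
  reactions.
\<close>

codatatype ('u, 'q, 'a, 'o) alg =
  Alg (solution: 'o) (react: "'u \<Rightarrow> ('q, 'a, ('u, 'q, 'a, 'o) alg) prog")

primrec state_after ::
  "('q \<Rightarrow> 'a) \<Rightarrow> ('u, 'q, 'a, 'o) alg \<Rightarrow> 'u list \<Rightarrow> ('u, 'q, 'a, 'o) alg pmf" where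
  "state_after orc A [] = return_pmf A"
| "state_after orc A (u # us) =
     bind_pmf (run orc (react A u)) (\<lambda>(B, n). state_after orc B us)"

text \<open>
  Number of queries made for processing the update with list index \<open>t\<close> only, distributed over all
  random choices of the algorithm, those made for earlier updates included.
\<close>

definition update_queries ::
  "('q \<Rightarrow> 'a) \<Rightarrow> ('u, 'q, 'a, 'o) alg \<Rightarrow> 'u list \<Rightarrow> nat \<Rightarrow> nat pmf" where
  "update_queries orc A us t =
     bind_pmf (state_after orc A (take t us)) (\<lambda>B. map_pmf snd (run orc (react B (us ! t))))"

text \<open>
  The expectation is an extended nonnegative integral, so that the bound includes integrability.
\<close>

definition worst_case_expected_queries_le ::
  "('q \<Rightarrow> 'a) \<Rightarrow> ('u, 'q, 'a, 'o) alg \<Rightarrow> 'u list \<Rightarrow> real \<Rightarrow> bool" where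
  "worst_case_expected_queries_le orc A us b \<longleftrightarrow>
     (\<forall>t<length us. (\<integral>\<^sup>+ n. of_nat n \<partial>measure_pmf (update_queries orc A us t)) \<le> ennreal b)"

text \<open>
  The approximation guarantee holds for every outcome of the random choices; only the number of
  queries is bounded in expectation.
\<close>

definition maintains_approx ::
  "('q \<Rightarrow> 'a) \<Rightarrow> ('v update, 'q, 'a, 'v set) alg \<Rightarrow> 'v update list \<Rightarrow>
     'v set set \<Rightarrow> ('v set \<Rightarrow> real) \<Rightarrow> real \<Rightarrow> bool" where
  "maintains_approx orc A us \<F> f \<alpha> \<longleftrightarrow>
     (\<forall>t\<le>length us. \<forall>B\<in>set_pmf (state_after orc A (take t us)).
        solution B \<in> \<F> \<and> solution B \<subseteq> live us t \<and>
        \<alpha> * f (solution B) \<ge> opt \<F> f (live us t))"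

text \<open>
  Value oracle (left queries) combined with independence oracle (right queries).  Outside the
  subsets of the ground set the answers of the value oracle are arbitrary, so an algorithm that is
  correct for every \<open>f\<close> gains nothing from such queries.
\<close>

fun matroid_oracle :: "('v set \<Rightarrow> real) \<Rightarrow> 'v set set \<Rightarrow> 'v set + 'v set \<Rightarrow> real + bool" where
  "matroid_oracle f \<I> (Inl X) = Inl (f X)"
| "matroid_oracle f \<I> (Inr X) = Inr (X \<in> \<I>)"

text \<open>
  Logarithms in query bounds.  As usual in \<open>O\<close>-notation a logarithmic factor is read as at least 1:
  literally, \<open>k log k\<close> would allow no query at all for \<open>k = 1\<close>.  For \<open>x \<ge> 2\<close>, \<open>lg x\<close> is just the
  binary logarithm.
\<close>

definition lg :: "real \<Rightarrow> real" where
  "lg x = max 1 (log 2 x)"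

end

theory Submission
  imports Defs
begin

text \<open>
  Both algorithms keep a uniformly random order of the live elements and, for each guess \<open>j\<close> of the
  scale of the optimum, the outcome of a one-pass algorithm run along this order.  The pass moves
  through a chain of at most \<open>T + 1\<close> states; an element that is rejected by a state is rejected by
  all later states of the chain, so the first rejecting state can be found by binary search and
  serves as a certificate.  When \<open>e\<close> is inserted or deleted, a certificate can only become invalid
  if \<open>e\<close> is accepted by some state \<open>s\<close> and the element comes after \<open>e\<close> and passes the test of \<open>s\<close>.
  Since the order is uniform, \<open>e\<close> is the first among the \<open>r\<close> elements passing at \<open>s\<close> only with
  probability \<open>1/r\<close>, so the expected number of binary searches per guess is \<open>O(T)\<close>.

  For a matroid, the pass is the swapping algorithm of Chakrabarti and Kale: the weight of an
  element is its marginal gain over everything accepted before, and it replaces the lightest element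
  on its circuit if its weight is at least twice as large.  For a cardinality bound, an element is
  accepted if its marginal gain is at least \<open>1/(2k)\<close> of the guessed optimum.
\<close>

section \<open>Oracle programs\<close>

text \<open>The state after any update sequence is a fixed function of the current random order. A
  fresh uniform insertion position keeps the order uniform, and so does a deletion, because the
  update sequence is independent of the random choices. The cost of each single update is therefore
  an average over one uniform permutation containing the affected element, which bounds every update
  rather than an amortized total. The obstacle is that rejection must persist along the chain even
  for a matroid, where accepted elements are thrown out later. A rejected element either gains too
  little or lies in the span of the elements heavier than half its gain; gains only fall and this
  span never shrinks. The logarithms have separate sources: the number of guesses in which an
  element takes part, the binary search along the chain, the height \<open>T\<close> of the chain
  and, for a matroid, the search for the circuit. For a cardinality bound the height is
  \<open>k\<close>; for a matroid each of at most \<open>k\<close> places is refilled only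
  O(log(k/\<epsilon>)) times, since the weight at least doubles.\<close>

primrec pbind :: "('q, 'a, 'r) prog \<Rightarrow> ('r \<Rightarrow> ('q, 'a, 's) prog) \<Rightarrow> ('q, 'a, 's) prog" where
  "pbind (Return r) g = g r"
| "pbind (Query q c) g = Query q (\<lambda>a. pbind (c a) g)"
| "pbind (Sample p c) g = Sample p (\<lambda>i. pbind (c i) g)"

lemma run_pbind:
  "run orc (pbind p g) =
     bind_pmf (run orc p) (\<lambda>(r, n). map_pmf (\<lambda>(s, m). (s, n + m)) (run orc (g r)))"
proof (induction p)
  case (Return r)
  show ?case by (simp add: bind_return_pmf case_prod_unfold)
next
  case (Query q c)
  then show ?case
    by (simp add: map_bind_pmf bind_map_pmf case_prod_unfold pmf.map_comp o_def)
next
  case (Sample p c)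
  then show ?case
    by (simp add: bind_assoc_pmf)
qed

lemma run_map_prog:
  "run orc (map_prog id g p) = map_pmf (apfst g) (run orc p)"
  by (induction p) (simp_all add: pmf.map_comp o_def case_prod_unfold apfst_def map_prod_def map_bind_pmf)

text \<open>Covers deterministic programs only: the insertion position in \<open>update_step\<close>
  is the sole random choice, so every other piece of the algorithm has a fixed result and needs just
  a bound on its queries.\<close>

definition computes :: "('q \<Rightarrow> 'a) \<Rightarrow> ('q, 'a, 'r) prog \<Rightarrow> 'r \<Rightarrow> nat \<Rightarrow> bool" where
  "computes orc p r n \<longleftrightarrow> (\<exists>m\<le>n. run orc p = return_pmf (r, m))"

lemma computes_Return: "computes orc (Return r) r n"
  by (auto simp: computes_def)

lemma computes_Query: "computes orc (c (orc q)) r n \<Longrightarrow> computes orc (Query q c) r (Suc n)"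
  by (auto simp: computes_def)

lemma computes_pbind:
  assumes "computes orc p r n" and "computes orc (g r) s m"
  shows "computes orc (pbind p g) s (n + m)"
proof -
  obtain n' where n': "n' \<le> n" "run orc p = return_pmf (r, n')"
    using assms(1) by (auto simp: computes_def)
  obtain m' where m': "m' \<le> m" "run orc (g r) = return_pmf (s, m')"
    using assms(2) by (auto simp: computes_def)
  have "run orc (pbind p g) = return_pmf (s, n' + m')"
    by (simp add: run_pbind n' m' bind_return_pmf)
  then show ?thesis
    using n' m' by (auto simp: computes_def intro!: exI[of _ "n' + m'"])
qed

lemma computes_mono: "computes orc p r n \<Longrightarrow> n \<le> m \<Longrightarrow> computes orc p r m"
  by (auto simp: computes_def)

function bsearch :: "(nat \<Rightarrow> ('q, 'a, bool) prog) \<Rightarrow> nat \<Rightarrow> nat \<Rightarrow> ('q, 'a, nat) prog" where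
  "bsearch p lo hi =
     (if lo < hi
      then pbind (p ((lo + hi) div 2))
             (\<lambda>b. if b then bsearch p lo ((lo + hi) div 2) else bsearch p (Suc ((lo + hi) div 2)) hi)
      else Return lo)"
  by pat_completeness auto
termination
  by (relation "Wellfounded.measure (\<lambda>(p, lo, hi). hi - lo)") auto

declare bsearch.simps [simp del]

text \<open>The interval is half-open, and \<open>r = hi\<close> means that no index satisfies
  \<open>P\<close>. Each round tests the midpoint and leaves it out of both remaining intervals, so
  \<open>hi - lo < 2 ^ m\<close> suffices for \<open>m\<close> rounds.\<close>

lemma computes_bsearch:
  assumes "\<And>i. lo \<le> i \<Longrightarrow> i < hi \<Longrightarrow> computes orc (p i) (P i) q"
    and "\<And>i j. lo \<le> i \<Longrightarrow> i \<le> j \<Longrightarrow> j < hi \<Longrightarrow> P i \<Longrightarrow> P j"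
    and "lo \<le> r" "r \<le> hi"
    and "\<And>i. lo \<le> i \<Longrightarrow> i < r \<Longrightarrow> \<not> P i"
    and "r < hi \<Longrightarrow> P r"
    and "hi - lo < 2 ^ m"
  shows "computes orc (bsearch p lo hi) r (m * q)"
  using assms
proof (induction m arbitrary: lo hi)
  case 0
  then have "lo = r" "\<not> lo < hi" by auto
  then show ?case by (subst bsearch.simps) (simp add: computes_Return)
next
  case (Suc m)
  show ?case
  proof (cases "lo < hi")
    case False
    with Suc.prems(3,4) have "lo = r" by auto
    with False show ?thesis by (subst bsearch.simps) (simp add: computes_Return)
  next
    case True
    define mid where "mid = (lo + hi) div 2"
    have mid: "lo \<le> mid" "mid < hi" "mid - lo < 2 ^ m" "hi - Suc mid < 2 ^ m"
      using True Suc.prems(7) by (auto simp: mid_def)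
    have p: "computes orc (p mid) (P mid) q"
      using Suc.prems(1) mid by blast
    have "computes orc (if P mid then bsearch p lo mid else bsearch p (Suc mid) hi) r (m * q)"
    proof (cases "P mid")
      case True
      then have "r \<le> mid" using Suc.prems(5) mid not_less by blast
      then have "computes orc (bsearch p lo mid) r (m * q)"
        
      proof (intro Suc.IH)
        fix i j assume "lo \<le> i" "i \<le> j" "j < mid" "P i"
        then show "P j" using Suc.prems(2)[of i j] mid by simp
      qed (use mid True \<open>r \<le> mid\<close> Suc.prems(1,3,5,6) in auto)
      then show ?thesis using True by simp
    next
      case False
      have "\<not> r \<le> mid"
      proof
        assume "r \<le> mid"
        then have "P r" using mid Suc.prems(6) by simp
        then have "P mid" using Suc.prems(2)[OF Suc.prems(3) \<open>r \<le> mid\<close> mid(2)] by simp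
        with False show False by simp
      qed
      then have "computes orc (bsearch p (Suc mid) hi) r (m * q)"
        
      proof (intro Suc.IH)
        fix i j assume "Suc mid \<le> i" "i \<le> j" "j < hi" "P i"
        then show "P j" using Suc.prems(2)[of i j] mid by simp
      qed (use mid Suc.prems(1,4,5,6) in auto)
      then show ?thesis using False by simp
    qed
    then have "computes orc (pbind (p mid)
        (\<lambda>b. if b then bsearch p lo mid else bsearch p (Suc mid) hi)) r (q + m * q)"
      by (intro computes_pbind[OF p])
    then show ?thesis
      using True unfolding mid_def by (subst bsearch.simps) simp
  qed
qed

section \<open>State machines\<close>

primcorec unfold_alg ::
  "('s \<Rightarrow> 'o) \<Rightarrow> ('s \<Rightarrow> 'u \<Rightarrow> ('q, 'a, 's) prog) \<Rightarrow> 's \<Rightarrow> ('u, 'q, 'a, 'o) alg" where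
  "solution (unfold_alg out step s) = out s"
| "react (unfold_alg out step s) = (\<lambda>u. map_prog id (unfold_alg out step) (step s u))"

primrec machine_after ::
  "('q \<Rightarrow> 'a) \<Rightarrow> ('s \<Rightarrow> 'u \<Rightarrow> ('q, 'a, 's) prog) \<Rightarrow> 's \<Rightarrow> 'u list \<Rightarrow> 's pmf" where
  "machine_after orc step s [] = return_pmf s"
| "machine_after orc step s (u # us) =
     bind_pmf (run orc (step s u)) (\<lambda>(s', n). machine_after orc step s' us)"

lemma state_after_unfold_alg:
  "state_after orc (unfold_alg out step s) us = map_pmf (unfold_alg out step) (machine_after orc step s us)"
proof (induction us arbitrary: s)
  case (Cons u us)
  then show ?case
    by (simp add: run_map_prog map_bind_pmf bind_map_pmf case_prod_unfold apfst_def)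
qed simp

lemma machine_after_snoc:
  "machine_after orc step s (us @ [u]) =
     bind_pmf (machine_after orc step s us) (\<lambda>s'. map_pmf fst (run orc (step s' u)))"
  by (induction us arbitrary: s)
     (simp_all add: bind_assoc_pmf bind_return_pmf case_prod_unfold map_pmf_def)

lemma update_queries_unfold_alg:
  "update_queries orc (unfold_alg out step s) us t =
     bind_pmf (machine_after orc step s (take t us)) (\<lambda>s'. map_pmf snd (run orc (step s' (us ! t))))"
  by (simp add: update_queries_def state_after_unfold_alg bind_map_pmf run_map_prog pmf.map_comp o_def)

section \<open>Random orders\<close>

definition insert_at :: "nat \<Rightarrow> 'v \<Rightarrow> 'v list \<Rightarrow> 'v list" where
  "insert_at i e xs = take i xs @ e # drop i xs"

lemma set_insert_at [simp]: "set (insert_at i e xs) = insert e (set xs)"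
  unfolding insert_at_def by (metis append_take_drop_id list.simps(15) set_append Un_insert_right)

lemma remove1_insert_at: "e \<notin> set xs \<Longrightarrow> remove1 e (insert_at i e xs) = xs"
  by (auto simp: insert_at_def remove1_append dest: in_set_takeD)

lemma distinct_insert_at: "distinct (insert_at i e xs) \<longleftrightarrow> e \<notin> set xs \<and> distinct xs"
proof -
  have "distinct (insert_at i e xs) \<longleftrightarrow> distinct (e # (take i xs @ drop i xs))"
    unfolding insert_at_def distinct_append distinct.simps set_append by auto
  then show ?thesis by simp
qed

text \<open>Deleting \<open>e\<close> recovers \<open>xs\<close>, and the part before
  \<open>e\<close> recovers \<open>i\<close>; hence a uniform order and an independent uniform
  position give a uniform order of the larger set.\<close>

lemma bij_betw_insert_at:
  assumes "finite A" "e \<notin> A"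
  shows "bij_betw (\<lambda>(xs, i). insert_at i e xs) (permutations_of_set A \<times> {..card A})
           (permutations_of_set (insert e A))"
  unfolding bij_betw_def
proof
  show "inj_on (\<lambda>(xs, i). insert_at i e xs) (permutations_of_set A \<times> {..card A})"
  proof (rule inj_onI, clarify)
    fix xs i ys j
    assume *: "xs \<in> permutations_of_set A" "ys \<in> permutations_of_set A" "i \<le> card A" "j \<le> card A"
      "insert_at i e xs = insert_at j e ys"
    from * have e: "e \<notin> set xs" "e \<notin> set ys" "length xs = card A" "length ys = card A"
      using assms by (auto dest: permutations_of_setD length_finite_permutations_of_set)
    have eq: "xs = ys" using remove1_insert_at *(5) e by metis
    have "takeWhile (\<lambda>y. y \<noteq> e) (insert_at i e xs) = take i xs" for i
      unfolding insert_at_def using e by (subst takeWhile_append2) (auto dest: in_set_takeD)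
    with *(5) eq have "take i xs = take j xs" by metis
    then have "length (take i xs) = length (take j xs)" by simp
    then have "i = j" using *(3,4) e by simp
    with eq show "xs = ys \<and> i = j" by simp
  qed
  show "(\<lambda>(xs, i). insert_at i e xs) ` (permutations_of_set A \<times> {..card A}) =
      permutations_of_set (insert e A)"
  proof (rule set_eqI iffI)+
    fix zs assume "zs \<in> (\<lambda>(xs, i). insert_at i e xs) ` (permutations_of_set A \<times> {..card A})"
    then show "zs \<in> permutations_of_set (insert e A)"
      using assms by (auto simp: permutations_of_set_def distinct_insert_at)
  next
    fix zs assume zs: "zs \<in> permutations_of_set (insert e A)"
    then obtain xs ys where xy: "zs = xs @ e # ys"
      by (metis insertI1 permutations_of_setD(1) split_list)
    with zs have "xs @ ys \<in> permutations_of_set A"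
      using assms by (auto simp: permutations_of_set_def)
    moreover from this have "length xs \<le> card A"
      using length_finite_permutations_of_set by fastforce
    moreover have "zs = insert_at (length xs) e (xs @ ys)"
      by (simp add: insert_at_def xy)
    ultimately show "zs \<in> (\<lambda>(xs, i). insert_at i e xs) ` (permutations_of_set A \<times> {..card A})"
      by (intro image_eqI[of _ _ "(xs @ ys, length xs)"]) auto
  qed
qed

lemma pmf_permutations_insert:
  assumes "finite A" "e \<notin> A"
  shows "pmf_of_set (permutations_of_set (insert e A)) =
           bind_pmf (pmf_of_set (permutations_of_set A)) (\<lambda>xs.
             map_pmf (\<lambda>i. insert_at i e xs) (pmf_of_set {..length xs}))"
proof -
  have ne: "permutations_of_set A \<noteq> {}" using assms by simp
  have "pmf_of_set (permutations_of_set (insert e A)) =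
      map_pmf (\<lambda>(xs, i). insert_at i e xs) (pmf_of_set (permutations_of_set A \<times> {..card A}))"
    using assms ne by (intro map_pmf_of_set_bij_betw[symmetric] bij_betw_insert_at) auto
  also have "pmf_of_set (permutations_of_set A \<times> {..card A}) =
      pair_pmf (pmf_of_set (permutations_of_set A)) (pmf_of_set {..card A})"
    using assms ne
    by (intro pmf_eqI) (auto simp: pmf_pair indicator_def card_cartesian_product mem_Times_iff algebra_simps)
  also have "map_pmf (\<lambda>(xs, i). insert_at i e xs) \<dots> =
      bind_pmf (pmf_of_set (permutations_of_set A)) (\<lambda>xs.
             map_pmf (\<lambda>i. insert_at i e xs) (pmf_of_set {..card A}))"
    by (simp add: pair_pmf_def map_bind_pmf map_pmf_def bind_assoc_pmf bind_return_pmf)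
  also have "\<dots> = bind_pmf (pmf_of_set (permutations_of_set A)) (\<lambda>xs.
             map_pmf (\<lambda>i. insert_at i e xs) (pmf_of_set {..length xs}))"
    using assms ne by (intro bind_pmf_cong) (auto simp: length_finite_permutations_of_set)
  finally show ?thesis .
qed

text \<open>A uniform order of \<open>A\<close> arises by inserting \<open>e\<close> into a uniform
  order of the rest, and removing \<open>e\<close> undoes this; deletions need no new
  randomness.\<close>

lemma pmf_permutations_remove:
  assumes "finite A" "e \<in> A"
  shows "pmf_of_set (permutations_of_set (A - {e})) =
           map_pmf (remove1 e) (pmf_of_set (permutations_of_set A))"
proof -
  let ?B = "A - {e}"
  have "pmf_of_set (permutations_of_set A) = pmf_of_set (permutations_of_set (insert e ?B))"
    using assms by (simp add: insert_absorb)
  also have "map_pmf (remove1 e) \<dots> = bind_pmf (pmf_of_set (permutations_of_set ?B)) (\<lambda>xs.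
             map_pmf (\<lambda>i. remove1 e (insert_at i e xs)) (pmf_of_set {..length xs}))"
    using assms by (subst pmf_permutations_insert) (auto simp: map_bind_pmf pmf.map_comp o_def)
  also have "\<dots> = bind_pmf (pmf_of_set (permutations_of_set ?B)) (\<lambda>xs. return_pmf xs)"
  proof (intro bind_pmf_cong refl)
    fix xs assume "xs \<in> set_pmf (pmf_of_set (permutations_of_set ?B))"
    then have "e \<notin> set xs" using assms by (auto dest: permutations_of_setD)
    then show "map_pmf (\<lambda>i. remove1 e (insert_at i e xs)) (pmf_of_set {..length xs}) = return_pmf xs"
      by (simp add: remove1_insert_at)
  qed
  finally show ?thesis by (simp add: bind_return_pmf')
qed

lemma sum_permutations_of_set:
  fixes F :: "'v list \<Rightarrow> nat"
  assumes "finite A" "A \<noteq> {}"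
  shows "(\<Sum>xs\<in>permutations_of_set A. F xs) =
    (\<Sum>x\<in>A. \<Sum>xs\<in>permutations_of_set (A - {x}). F (x # xs))"
proof -
  have "(\<Sum>xs\<in>permutations_of_set A. F xs) =
      (\<Sum>x\<in>A. \<Sum>xs\<in>(#) x ` permutations_of_set (A - {x}). F xs)"
    unfolding permutations_of_set_nonempty[OF assms(2)]
    using assms by (subst sum.UNION_disjoint) auto
  also have "\<dots> = (\<Sum>x\<in>A. \<Sum>xs\<in>permutations_of_set (A - {x}). F (x # xs))"
    by (rule sum.cong[OF refl]) (simp add: sum.reindex o_def)
  finally show ?thesis .
qed

section \<open>Chains of states with certificates\<close>

text \<open>A rejection is certified by the chain up to its first rejecting state, whatever follows.
  An acceptance is certified only by the entire chain at that moment, since every state of it had to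
  let the element pass. Checking either costs no query because the states are stored.\<close>

definition valid_cert :: "'s list \<times> 's option \<Rightarrow> 's list \<Rightarrow> bool" where
  "valid_cert c h \<longleftrightarrow> (case snd c of None \<Rightarrow> \<exists>g. h = fst c @ g | Some s \<Rightarrow> fst c = h)"

definition extend :: "'s list \<Rightarrow> 's option \<Rightarrow> 's list" where
  "extend h r = (case r of None \<Rightarrow> h | Some s \<Rightarrow> h @ [s])"

lemma extend_simps [simp]: "extend h None = h" "extend h (Some s) = h @ [s]"
  by (simp_all add: extend_def)

text \<open>The search keeps only Boolean answers. If no state rejects, the transition at the last
  state is evaluated once more to obtain the new state, hence the \<open>+ 1\<close> in
  \<open>(m + 1) * q\<close>.\<close>

definition search_cert ::
  "('s \<Rightarrow> 'v \<Rightarrow> ('q, 'a, 's option) prog) \<Rightarrow> 's list \<Rightarrow> 'v \<Rightarrow> ('q, 'a, 's list \<times> 's option) prog" where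
  "search_cert p h x =
     pbind (bsearch (\<lambda>i. pbind (p (h ! i) x) (\<lambda>r. Return (r = None))) 0 (length h))
       (\<lambda>i. if i < length h then Return (take (Suc i) h, None)
             else pbind (p (last h) x) (\<lambda>r. Return (h, r)))"

definition find_cert ::
  "('s \<Rightarrow> 'v \<Rightarrow> ('q, 'a, 's option) prog) \<Rightarrow> ('v \<rightharpoonup> 's list \<times> 's option) \<Rightarrow> 's list \<Rightarrow> 'v \<Rightarrow>
     ('q, 'a, 's list \<times> 's option) prog" where
  "find_cert p old h x =
     (case old x of None \<Rightarrow> search_cert p h x
      | Some c \<Rightarrow> if valid_cert c h then Return c else search_cert p h x)"

primrec rebuild ::
  "('s \<Rightarrow> 'v \<Rightarrow> ('q, 'a, 's option) prog) \<Rightarrow> ('v \<rightharpoonup> 's list \<times> 's option) \<Rightarrow> 'v list \<Rightarrow> 's list \<Rightarrow>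
     ('q, 'a, ('v \<rightharpoonup> 's list \<times> 's option) \<times> 's list) prog" where
  "rebuild p old [] h = Return (Map.empty, h)"
| "rebuild p old (x # xs) h =
     pbind (find_cert p old h x) (\<lambda>c.
       pbind (rebuild p old xs (extend h (snd c))) (\<lambda>r. Return ((fst r)(x \<mapsto> c), snd r)))"

text \<open>If no state rejects, \<open>take\<close> runs past the end and yields all of
  \<open>h\<close>; in both cases \<open>last p\<close> is the state whose decision is
  recorded.\<close>

definition cert :: "('s \<Rightarrow> 'v \<Rightarrow> 's option) \<Rightarrow> 's list \<Rightarrow> 'v \<Rightarrow> 's list \<times> 's option" where
  "cert d h x =
     (let p = take (Suc (length (takeWhile (\<lambda>s. d s x \<noteq> None) h))) h in (p, d (last p) x))"

text \<open>The pass without any reuse, hence a function of the order alone; the rebuild lemmas show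
  that repairing old certificates gives the same result.\<close>

primrec canon ::
  "('s \<Rightarrow> 'v \<Rightarrow> 's option) \<Rightarrow> 'v list \<Rightarrow> 's list \<Rightarrow> ('v \<rightharpoonup> 's list \<times> 's option) \<times> 's list" where
  "canon d [] h = (Map.empty, h)"
| "canon d (x # xs) h =
     (let r = canon d xs (extend h (snd (cert d h x))) in ((fst r)(x \<mapsto> cert d h x), snd r))"

text \<open>The elements at risk when \<open>e\<close> enters or leaves: past the state that accepts
  \<open>e\<close> the old and the new chain may differ arbitrarily, so any later element passing
  that state may need a search.\<close>

primrec cost :: "('s \<Rightarrow> 'v \<Rightarrow> 's option) \<Rightarrow> 's \<Rightarrow> 'v list \<Rightarrow> 'v \<Rightarrow> nat" where
  "cost d s [] e = 0"
| "cost d s (y # ys) e =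
     (case d s y of None \<Rightarrow> cost d s ys e
      | Some s' \<Rightarrow> if y = e then length (filter (\<lambda>x. d s x \<noteq> None) ys) else cost d s' ys e)"

text \<open>Allows the expectation to be taken over orders of all live elements although each guess
  sees only its participants.\<close>

lemma cost_filter:
  assumes "\<And>s x. \<not> P x \<Longrightarrow> d s x = None"
  shows "cost d s (filter P xs) e = cost d s xs e"
proof (induction xs arbitrary: s)
  case (Cons y ys)
  have "filter (\<lambda>x. d s x \<noteq> None) (filter P ys) = filter (\<lambda>x. d s x \<noteq> None) ys"
    unfolding filter_filter by (intro filter_cong refl) (metis assms)
  then show ?case
    using Cons assms[of y s] by (auto split: option.splits simp del: filter_filter)
qed simp

section \<open>Chains along which rejection persists\<close>

locale chain =
  fixes d :: "'s \<Rightarrow> 'v \<Rightarrow> 's option" and inv :: "'s \<Rightarrow> bool" and \<mu> :: "'s \<Rightarrow> nat" and T :: nat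
  assumes inv_step: "inv s \<Longrightarrow> d s x = Some s' \<Longrightarrow> inv s'"
    and mu_step: "inv s \<Longrightarrow> d s x = Some s' \<Longrightarrow> \<mu> s < \<mu> s'"
    and mu_le: "inv s \<Longrightarrow> \<mu> s \<le> T"
    and reject_step: "inv s \<Longrightarrow> d s x = Some s' \<Longrightarrow> d s y = None \<Longrightarrow> d s' y = None"
begin

inductive history :: "'s list \<Rightarrow> bool" where
  history_single: "inv s \<Longrightarrow> history [s]"
| history_snoc: "history h \<Longrightarrow> d (last h) x = Some s \<Longrightarrow> history (h @ [s])"

lemma history_inv: "history h \<Longrightarrow> h \<noteq> [] \<and> (\<forall>s\<in>set h. inv s)"
  by (induction rule: history.induct) (auto intro: inv_step)

lemma history_length: "history h \<Longrightarrow> length h \<le> Suc T"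
proof -
  assume h: "history h"
  then have "length h \<le> Suc (\<mu> (last h))"
  proof (induction rule: history.induct)
    case (history_snoc h x s)
    then have "\<mu> (last h) < \<mu> s"
      using history_inv mu_step by (meson last_in_set)
    then show ?case using history_snoc by simp
  qed simp
  moreover have "\<mu> (last h) \<le> T"
    using history_inv[OF h] by (auto intro: mu_le)
  ultimately show ?thesis by simp
qed

text \<open>Persistence along the chain makes the test monotone, hence open to binary
  search.\<close>

lemma history_reject:
  assumes "history h" "i \<le> j" "j < length h" "d (h ! i) y = None"
  shows "d (h ! j) y = None"
  using assms
proof (induction arbitrary: i j rule: history.induct)
  case (history_snoc h x s)
  show ?case
  proof (cases "j < length h")
    case True
    then show ?thesis using history_snoc.IH[of i j] history_snoc.prems by (simp add: nth_append)
  next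
    case False
    then have j: "j = length h" using history_snoc by simp
    show ?thesis
    proof (cases "i = j")
      case False
      then have i: "i \<le> length h - 1" "length h - 1 < length h"
        using j history_snoc.prems history_inv[OF history_snoc(1)] by auto
      then have "d (h ! (length h - 1)) y = None"
        using history_snoc.IH[OF i] history_snoc.prems by (simp add: nth_append)
      then have "d (last h) y = None"
        using history_inv[OF history_snoc(1)] by (simp add: last_conv_nth)
      then show ?thesis
        using reject_step[of "last h" x s y] history_snoc(2) history_inv[OF history_snoc(1)] j
        by simp
    qed (use history_snoc.prems in simp)
  qed
qed auto

lemma history_reject_last:
  assumes "history h" "s \<in> set h" "d s y = None"
  shows "d (last h) y = None"
proof -
  obtain i where "i < length h" "h ! i = s" using assms(2) by (auto simp: in_set_conv_nth)
  then show ?thesis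
    using history_reject[OF assms(1), of i "length h - 1" y] assms(3) history_inv[OF assms(1)]
    by (simp add: last_conv_nth)
qed

lemma cert_accept:
  assumes "\<forall>s\<in>set h. d s x \<noteq> None"
  shows "cert d h x = (h, d (last h) x)"
proof -
  have *: "takeWhile (\<lambda>s. d s x \<noteq> None) h = h"
    unfolding takeWhile_eq_all_conv by (rule assms)
  show ?thesis unfolding cert_def Let_def * by simp
qed

lemma cert_reject:
  assumes "d (h ! i) x = None" "i < length h" "\<forall>k<i. d (h ! k) x \<noteq> None"
  shows "cert d h x = (take (Suc i) h, None)"
proof -
  have "takeWhile (\<lambda>s. d s x \<noteq> None) h = take i h"
    using assms by (intro takeWhile_eq_take_P_nth) auto
  then have *: "length (takeWhile (\<lambda>s. d s x \<noteq> None) h) = i" using assms by simp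
  show ?thesis
    unfolding cert_def Let_def * using assms by (simp add: take_Suc_conv_app_nth)
qed

lemma first_reject:
  assumes "\<exists>s\<in>set h. d s x = None"
  obtains i where "i < length h" "d (h ! i) x = None" "\<forall>k<i. d (h ! k) x \<noteq> None"
proof -
  obtain k where k: "k < length h \<and> d (h ! k) x = None"
    using assms by (auto simp: in_set_conv_nth)
  define i where "i = (LEAST k. k < length h \<and> d (h ! k) x = None)"
  have "i < length h \<and> d (h ! i) x = None" unfolding i_def by (rule LeastI[of _ k]) (rule k)
  moreover have "d (h ! k') x \<noteq> None" if "k' < i" for k'
    using not_less_Least[of k' "\<lambda>k. k < length h \<and> d (h ! k) x = None"] that calculation
    by (auto simp: i_def[symmetric] simp del: not_None_eq)
  ultimately show ?thesis using that by blast
qed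

text \<open>The certificate records the first rejecting state, whereas the pass asks the current
  one; the outcomes agree because rejection persists.\<close>

lemma snd_cert:
  assumes "history h"
  shows "snd (cert d h x) = d (last h) x"
proof (cases "\<exists>s\<in>set h. d s x = None")
  case True
  then obtain i where "i < length h" "d (h ! i) x = None" "\<forall>k<i. d (h ! k) x \<noteq> None"
    by (rule first_reject)
  then show ?thesis
    using cert_reject[of h i x] history_reject_last[OF assms, of "h ! i" x] by simp
next
  case False
  then show ?thesis using cert_accept[of h x] by simp
qed

lemma cert_append:
  assumes "history h" "d (last h) x = None"
  shows "cert d (h @ g) x = cert d h x"
proof -
  have "\<exists>s\<in>set h. d s x = None"
    using assms history_inv by (intro bexI[of _ "last h"]) auto
  then obtain i where i: "i < length h" "d (h ! i) x = None" "\<forall>k<i. d (h ! k) x \<noteq> None"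
    by (rule first_reject)
  then have "cert d (h @ g) x = (take (Suc i) (h @ g), None)"
    by (intro cert_reject) (auto simp: nth_append)
  then show ?thesis using i cert_reject[of h i x] by simp
qed

lemma valid_cert_append:
  assumes "history h" "d (last h) x = None"
  shows "valid_cert (cert d h x) (h @ g)"
  using assms snd_cert[OF assms(1), of x]
  by (auto simp: valid_cert_def cert_def Let_def) (metis append_take_drop_id append.assoc)

lemma valid_cert_self: "history h \<Longrightarrow> valid_cert (cert d h x) h"
proof (cases "d (last h) x")
  case None
  then show "history h \<Longrightarrow> valid_cert (cert d h x) h"
    using valid_cert_append[of h x "[]"] by simp
next
  case (Some s)
  assume h: "history h"
  then have "\<forall>s\<in>set h. d s x \<noteq> None" using history_reject_last[OF h] Some by fastforce
  then show "valid_cert (cert d h x) h" using cert_accept[of h x] Some by (simp add: valid_cert_def)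
qed

lemma history_extend: "history h \<Longrightarrow> history (extend h (snd (cert d h x)))"
  by (auto simp: snd_cert extend_def split: option.split intro: history_snoc)

lemma canon_history:
  "history h \<Longrightarrow> history (snd (canon d xs h)) \<and> (\<exists>g. snd (canon d xs h) = h @ g)"
proof (induction xs arbitrary: h)
  case (Cons x xs)
  then show ?case
    using Cons.IH[OF history_extend[OF Cons.prems, of x]]
    by (auto simp: Let_def extend_def split: option.splits)
qed simp

text \<open>Source of the approximation guarantees, which rest on the final state rejecting all that
  took part. An element rejected in its turn stays rejected; an accepted one is rejected by the
  state it creates, by the last hypothesis, and from then on.\<close>

lemma canon_rejects:
  assumes "history h" "x \<in> set xs" "\<And>s s'. inv s \<Longrightarrow> d s x = Some s' \<Longrightarrow> d s' x = None"
  shows "d (last (snd (canon d xs h))) x = None"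
  using assms
proof (induction xs arbitrary: h)
  case (Cons y ys)
  define h' where "h' = extend h (snd (cert d h y))"
  have h': "history h'" using history_extend[OF Cons.prems(1)] by (simp add: h'_def)
  show ?case
  proof (cases "x = y")
    case True
    have "d (last h') x = None"
    proof (cases "d (last h) y")
      case None
      then show ?thesis by (simp add: h'_def snd_cert[OF Cons.prems(1)] True)
    next
      case (Some s)
      then show ?thesis
        using Cons.prems(3)[of "last h" s] history_inv[OF Cons.prems(1)]
        by (simp add: h'_def snd_cert[OF Cons.prems(1)] True)
    qed
    moreover have "last h' \<in> set (snd (canon d ys h'))"
      using canon_history[OF h', of ys] history_inv[OF h'] by auto
    ultimately have "d (last (snd (canon d ys h'))) x = None"
      using canon_history[OF h', of ys] history_reject_last by blast
    then show ?thesis by (simp add: Let_def h'_def)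
  next
    case False
    then show ?thesis using Cons.IH[OF h'] Cons.prems by (simp add: Let_def h'_def)
  qed
qed simp

lemma canon_invariant:
  assumes "history h" "J (last h) X"
    and "\<And>s x s' X. inv s \<Longrightarrow> J s X \<Longrightarrow> d s x = Some s' \<Longrightarrow> J s' (insert x X)"
    and "\<And>s x X. J s X \<Longrightarrow> J s (insert x X)"
  shows "J (last (snd (canon d xs h))) (X \<union> set xs)"
  using assms(1,2)
proof (induction xs arbitrary: h X)
  case (Cons y ys)
  have "J (last (extend h (snd (cert d h y)))) (insert y X)"
    using Cons.prems history_inv[OF Cons.prems(1)] assms(3)[of "last h" X y] assms(4)[of "last h" X y]
    by (auto simp: snd_cert extend_def split: option.split)
  then show ?case
    using Cons.IH[OF history_extend[OF Cons.prems(1), of y], of "insert y X"]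
    by (simp add: Let_def)
qed simp

lemma cost_reject: "inv s \<Longrightarrow> d s e = None \<Longrightarrow> cost d s xs e = 0"
proof (induction xs arbitrary: s)
  case (Cons y ys)
  show ?case
  proof (cases "d s y")
    case (Some s')
    then have "y \<noteq> e" using Cons.prems by auto
    then show ?thesis
      using Cons.IH[OF inv_step[OF Cons.prems(1) Some] reject_step[OF Cons.prems(1) Some Cons.prems(2)]]
        Some by simp
  qed (use Cons in simp)
qed simp

text \<open>
  Conditioned on the part of the chain before it, the next accepted element is uniform among the
  elements passing at the current state, so a level costs at most 1 in expectation for a fixed \<open>e\<close>.
\<close>

lemma sum_cost_permutations:
  assumes "finite A" "e \<in> A" "inv s"
  shows "(\<Sum>xs\<in>permutations_of_set A. cost d s xs e) \<le> fact (card A) * (T - \<mu> s)"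
  using assms
proof (induction "card A" arbitrary: A s)
  case 0
  then show ?case by simp
next
  case (Suc n)
  show ?case
  proof (cases "d s e")
    case None
    then show ?thesis using cost_reject Suc.prems by simp
  next
    case (Some se)
    define a where "a = T - \<mu> s"
    \<comment> \<open>As \<open>e\<close> is accepted at \<open>s\<close>, a level is left above
      \<open>s\<close>; so \<open>a - 1\<close> is not a truncated subtraction.\<close>
    have a: "a \<ge> 1"
      using mu_step[OF Suc.prems(3) Some] mu_le[OF inv_step[OF Suc.prems(3) Some]]
      by (simp add: a_def)
    define R where "R = {y\<in>A. d s y \<noteq> None}"
    have R: "finite R" "e \<in> R" "R \<subseteq> A" using Suc.prems Some by (auto simp: R_def)
    have cardA: "card (A - {y}) = n" if "y \<in> A" for y
      using Suc.hyps(2) Suc.prems(1) that by simp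
    have bound: "(\<Sum>xs\<in>permutations_of_set (A - {y}). cost d s (y # xs) e) \<le>
        fact n * (if y = e then card R - 1 else if y \<in> R then a - 1 else a)" if y: "y \<in> A" for y
    proof -
      consider "y = e" | "y \<noteq> e" "y \<in> R" | "y \<noteq> e" "y \<notin> R" by blast
      then show ?thesis
      proof cases
        case 1
        have "cost d s (y # xs) e = card R - 1" if xs: "xs \<in> permutations_of_set (A - {y})" for xs
        proof -
          have "distinct xs" "set xs = A - {e}" using xs 1 by (auto dest: permutations_of_setD)
          then have "length (filter (\<lambda>x. d s x \<noteq> None) xs) = card (R - {e})"
            by (subst distinct_card[symmetric]) (auto simp: R_def intro!: arg_cong[where f = card])
          then show ?thesis using R Some 1 by simp
        qed
        then show ?thesis using 1 cardA[OF y] Suc.prems by simp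
      next
        case 2
        then obtain s' where s': "d s y = Some s'" by (auto simp: R_def)
        have "(\<Sum>xs\<in>permutations_of_set (A - {y}). cost d s (y # xs) e) =
            (\<Sum>xs\<in>permutations_of_set (A - {y}). cost d s' xs e)" using s' 2 by simp
        also have "\<dots> \<le> fact n * (T - \<mu> s')"
          using Suc.hyps(1)[of "A - {y}" s'] cardA[OF y] Suc.prems 2 inv_step[OF Suc.prems(3) s']
          by simp
        also have "\<dots> \<le> fact n * (a - 1)"
          using mu_step[OF Suc.prems(3) s'] by (intro mult_left_mono) (auto simp: a_def)
        finally show ?thesis using 2 by simp
      next
        case 3
        then have "d s y = None" using y by (auto simp: R_def)
        then have "(\<Sum>xs\<in>permutations_of_set (A - {y}). cost d s (y # xs) e) =
            (\<Sum>xs\<in>permutations_of_set (A - {y}). cost d s xs e)" by simp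
        also have "\<dots> \<le> fact n * a"
          using Suc.hyps(1)[of "A - {y}" s] cardA[OF y] Suc.prems 3 by (simp add: a_def)
        finally show ?thesis using 3 by simp
      qed
    qed
    have "(\<Sum>xs\<in>permutations_of_set A. cost d s xs e) =
        (\<Sum>y\<in>A. \<Sum>xs\<in>permutations_of_set (A - {y}). cost d s (y # xs) e)"
      using Suc.prems by (intro sum_permutations_of_set) auto
    also have "\<dots> \<le> (\<Sum>y\<in>A. fact n * (if y = e then card R - 1 else if y \<in> R then a - 1 else a))"
      by (intro sum_mono bound)
    also have "\<dots> = fact n * (\<Sum>y\<in>A. if y = e then card R - 1 else if y \<in> R then a - 1 else a)"
      by (simp add: sum_distrib_left)
    also have "(\<Sum>y\<in>A. if y = e then card R - 1 else if y \<in> R then a - 1 else a) =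
        (card R - 1) + (\<Sum>y\<in>A - {e}. if y \<in> R then a - 1 else a)"
      using Suc.prems by (subst sum.remove[of A e]) (auto intro!: sum.cong)
    also have "(\<Sum>y\<in>A - {e}. if y \<in> R then a - 1 else a) = card (R - {e}) * (a - 1) + card (A - R) * a"
    proof -
      have "A - {e} = (R - {e}) \<union> (A - R)" using R by auto
      then have "(\<Sum>y\<in>A - {e}. if y \<in> R then a - 1 else a) =
          (\<Sum>y\<in>R - {e}. if y \<in> R then a - 1 else a) + (\<Sum>y\<in>A - R. if y \<in> R then a - 1 else a)"
        using R Suc.prems by (simp only:) (subst sum.union_disjoint, auto)
      also have "\<dots> = card (R - {e}) * (a - 1) + card (A - R) * a"
        by simp
      finally show ?thesis .
    qed
    \<comment> \<open>With \<open>r = card R\<close>: the cost \<open>r - 1\<close> incurred when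
      \<open>e\<close> comes first is exactly what the other \<open>r - 1\<close> passing elements
      save by raising the potential, since
      \<open>(r - 1) + (r - 1) * (a - 1) = (r - 1) * a\<close>.\<close>
    also have "card R - 1 + (card (R - {e}) * (a - 1) + card (A - R) * a) = n * a"
    proof -
      have "card (A - R) + card (R - {e}) = card ((A - R) \<union> (R - {e}))"
        using R Suc.prems by (intro card_Un_disjoint[symmetric]) auto
      also have "(A - R) \<union> (R - {e}) = A - {e}" using R by auto
      also have "card (A - {e}) = n" by (rule cardA[OF Suc.prems(2)])
      finally have "card (A - R) + card (R - {e}) = n" .
      moreover have "card R - 1 = card (R - {e})" using R by simp
      moreover obtain b where "a = Suc b" using a by (cases a) auto
      ultimately show ?thesis by (auto simp: algebra_simps)
    qed
    also have "fact n * (n * a) \<le> fact (card A) * a"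
      by (simp flip: Suc.hyps(2))
    finally show ?thesis by (simp add: a_def)
  qed
qed

end

section \<open>Query cost of repairing the certificates after one update\<close>

locale chain_prog = chain d inv \<mu> T
  for d :: "'s \<Rightarrow> 'v \<Rightarrow> 's option" and inv \<mu> T +
  fixes orc :: "'q \<Rightarrow> 'a" and p :: "'s \<Rightarrow> 'v \<Rightarrow> ('q, 'a, 's option) prog"
    and W :: "'v set" and q m :: nat
  assumes computes_step: "inv s \<Longrightarrow> x \<in> W \<Longrightarrow> computes orc (p s x) (d s x) q"
    and height: "T + 1 < 2 ^ m"
begin

lemma computes_search:
  assumes h: "history h" and x: "x \<in> W"
  shows "computes orc (search_cert p h x) (cert d h x) ((m + 1) * q)"
proof -
  have p: "computes orc (pbind (p (h ! i) x) (\<lambda>r. Return (r = None))) (d (h ! i) x = None) q"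
    if "i < length h" for i
    using computes_pbind[OF computes_step[of "h ! i" x], of "\<lambda>r. Return (r = None)" _ 0]
      history_inv[OF h] x that by (simp add: computes_Return)
  have len: "length h - 0 < 2 ^ m" using history_length[OF h] height by simp
  have b: "computes orc (bsearch (\<lambda>i. pbind (p (h ! i) x) (\<lambda>r. Return (r = None))) 0 (length h))
      r (m * q)"
    if "r \<le> length h" "\<forall>k<r. d (h ! k) x \<noteq> None" "r < length h \<Longrightarrow> d (h ! r) x = None" for r
    by (rule computes_bsearch[where P = "\<lambda>i. d (h ! i) x = None"])
       (use that p len history_reject[OF h] in auto)
  show ?thesis
  proof (cases "\<exists>s\<in>set h. d s x = None")
    case True
    then obtain i where i: "i < length h" "d (h ! i) x = None" "\<forall>k<i. d (h ! k) x \<noteq> None"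
      by (rule first_reject)
    have "computes orc (search_cert p h x) (take (Suc i) h, None) (m * q + q)"
      unfolding search_cert_def
      by (rule computes_pbind[OF b[of i]]) (use i in \<open>auto intro: computes_Return\<close>)
    then show ?thesis using cert_reject[OF i(2,1,3)] by (simp add: add.commute)
  next
    case False
    then have c: "cert d h x = (h, d (last h) x)" by (intro cert_accept) auto
    have "computes orc (p (last h) x) (d (last h) x) q"
      using history_inv[OF h] x by (intro computes_step) auto
    then have l: "computes orc (pbind (p (last h) x) (\<lambda>r. Return (h, r))) (h, d (last h) x) (q + 0)"
      by (rule computes_pbind) (rule computes_Return)
    have "computes orc (search_cert p h x) (h, d (last h) x) (m * q + q)"
      unfolding search_cert_def
    proof (rule computes_pbind[OF b[of "length h"]])
      show "\<forall>k<length h. d (h ! k) x \<noteq> None" using False by auto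
    qed (use l in auto)
    then show ?thesis using c by (simp add: add.commute)
  qed
qed

lemma computes_find_valid:
  assumes "old x = Some (cert d h x)" "valid_cert (cert d h x) h"
  shows "computes orc (find_cert p old h x) (cert d h x) 0"
  using assms by (simp add: find_cert_def computes_Return)

text \<open>Makes reuse sound. A rejection stores the first rejecting state with all states before
  it, an acceptance stores the whole chain; either determines the certificate on
  \<open>g'\<close>.\<close>

lemma valid_cert_determines:
  assumes "history g" "history g'" "valid_cert (cert d g x) g'"
  shows "cert d g x = cert d g' x"
proof (cases "\<exists>s\<in>set g. d s x = None")
  case True
  then obtain i where i: "i < length g" "d (g ! i) x = None" "\<forall>k<i. d (g ! k) x \<noteq> None"
    by (rule first_reject)
  then have c: "cert d g x = (take (Suc i) g, None)" by (intro cert_reject)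
  then obtain r where r: "g' = take (Suc i) g @ r" using assms(3) by (auto simp: valid_cert_def)
  have "g' ! k = g ! k" if "k \<le> i" for k using that i(1) by (simp add: r nth_append)
  then have "cert d g' x = (take (Suc i) g', None)"
    using i by (intro cert_reject) (auto simp: r)
  then show ?thesis using c i(1) by (simp add: r)
next
  case False
  then have c: "cert d g x = (g, d (last g) x)" by (intro cert_accept) auto
  moreover have "d (last g) x \<noteq> None" using False history_inv[OF assms(1)] by auto
  ultimately have "g = g'" using assms(3) by (auto simp: valid_cert_def)
  then show ?thesis by simp
qed

lemma computes_rebuild_Cons:
  assumes "computes orc (find_cert p old h x) (cert d h x) n"
    and "computes orc (rebuild p old xs (extend h (snd (cert d h x))))
           (canon d xs (extend h (snd (cert d h x)))) k"
  shows "computes orc (rebuild p old (x # xs) h) (canon d (x # xs) h) (n + k)"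
proof -
  have "computes orc (rebuild p old (x # xs) h) (canon d (x # xs) h) (n + (k + 0))"
    unfolding rebuild.simps canon.simps Let_def
    by (rule computes_pbind[OF assms(1)], rule computes_pbind[OF assms(2)], rule computes_Return)
  then show ?thesis by simp
qed

lemma canon_Cons_rest:
  assumes "distinct (x # xs)" "y \<in> set xs"
  shows "fst (canon d (x # xs) h) y = fst (canon d xs (extend h (snd (cert d h x)))) y"
  using assms by (auto simp: Let_def)

lemma computes_rebuild_same:
  assumes "history h" "set xs \<subseteq> W" "distinct xs"
    and "\<And>x. x \<in> set xs \<Longrightarrow> old x = fst (canon d xs h) x"
  shows "computes orc (rebuild p old xs h) (canon d xs h) 0"
  using assms
proof (induction xs arbitrary: h)
  case Nil
  then show ?case by (simp add: computes_Return)
next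
  case (Cons x xs)
  have "computes orc (find_cert p old h x) (cert d h x) 0"
    using Cons.prems(4)[of x] Cons.prems(1)
    by (intro computes_find_valid valid_cert_self) (auto simp: Let_def)
  moreover have "computes orc (rebuild p old xs (extend h (snd (cert d h x))))
      (canon d xs (extend h (snd (cert d h x)))) 0"
    using Cons.prems canon_Cons_rest[OF Cons.prems(3)]
    by (intro Cons.IH history_extend) auto
  ultimately show ?case using computes_rebuild_Cons[of old h x 0 xs 0] by simp
qed

text \<open>The old chain \<open>h @ g\<close> and the new chain \<open>h @ g'\<close> need only
  share \<open>h\<close>. An element rejected by \<open>last h\<close> has its first rejecting state
  inside \<open>h\<close>, so its certificate is common to both and is reused; only the others may
  cost a search. Both tails are arbitrary because they grow independently during the
  induction.\<close>

lemma computes_rebuild_diverged: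
  assumes "history h" "history (h @ g)" "history (h @ g')" "set xs \<subseteq> W" "distinct xs"
    and "\<And>x. x \<in> set xs \<Longrightarrow> old x = fst (canon d xs (h @ g)) x"
  shows "computes orc (rebuild p old xs (h @ g')) (canon d xs (h @ g'))
           ((m + 1) * q * length (filter (\<lambda>x. d (last h) x \<noteq> None) xs))"
  using assms(2-)
proof (induction xs arbitrary: g g')
  case Nil
  then show ?case by (simp add: computes_Return)
next
  case (Cons x xs)
  have ext: "\<exists>f. extend (h @ g) (snd (cert d (h @ g) x)) = h @ f" for g
    by (auto simp: extend_def split: option.split)
  obtain f where f: "extend (h @ g) (snd (cert d (h @ g) x)) = h @ f" using ext by blast
  obtain f' where f': "extend (h @ g') (snd (cert d (h @ g') x)) = h @ f'" using ext by blast
  have hf: "history (h @ f)" "history (h @ f')"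
    using history_extend[OF Cons.prems(1), of x] history_extend[OF Cons.prems(2), of x]
    by (simp_all add: f f')
  have rest: "computes orc (rebuild p old xs (extend (h @ g') (snd (cert d (h @ g') x))))
      (canon d xs (extend (h @ g') (snd (cert d (h @ g') x))))
      ((m + 1) * q * length (filter (\<lambda>x. d (last h) x \<noteq> None) xs))"
    unfolding f'
  proof (rule Cons.IH[OF hf])
    fix y assume y: "y \<in> set xs"
    show "old y = fst (canon d xs (h @ f)) y"
      using Cons.prems(5)[of y] canon_Cons_rest[OF Cons.prems(4) y, of "h @ g"] y by (simp add: f)
  qed (use Cons.prems in auto)
  show ?case
  proof (cases "d (last h) x")
    case None
    have "cert d (h @ g) x = cert d (h @ g') x"
      using cert_append[OF assms(1) None] by simp
    then have "computes orc (find_cert p old (h @ g') x) (cert d (h @ g') x) 0"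
      using Cons.prems(5)[of x] valid_cert_append[OF assms(1) None, of g'] cert_append[OF assms(1) None]
      by (intro computes_find_valid) (auto simp: Let_def)
    from computes_rebuild_Cons[OF this rest] show ?thesis using None by simp
  next
    case (Some s)
    have s: "computes orc (search_cert p (h @ g') x) (cert d (h @ g') x) ((m + 1) * q)"
      using Cons.prems by (intro computes_search) auto
    have "computes orc (find_cert p old (h @ g') x) (cert d (h @ g') x) ((m + 1) * q)"
    proof (cases "valid_cert (cert d (h @ g) x) (h @ g')")
      case True
      have "old x = Some (cert d (h @ g) x)" using Cons.prems(5)[of x] by (simp add: Let_def)
      moreover have "cert d (h @ g) x = cert d (h @ g') x"
        using True valid_cert_determines[OF Cons.prems(1,2)] by blast
      ultimately show ?thesis using True
        by (intro computes_mono[OF computes_find_valid]) auto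
    next
      case False
      then show ?thesis using Cons.prems(5)[of x] s by (simp add: find_cert_def Let_def)
    qed
    from computes_rebuild_Cons[OF this rest] show ?thesis using Some by (simp add: algebra_simps)
  qed
qed

text \<open>Before \<open>e\<close> nothing changes. If \<open>e\<close> is accepted, the old chain
  goes on from \<open>h\<close> and the new one from \<open>h @ [s]\<close>; the extra 1 pays for
  the search of \<open>e\<close>, which has no old certificate.\<close>

lemma computes_rebuild_insert:
  assumes "history h" "set (xs @ e # ys) \<subseteq> W" "distinct (xs @ e # ys)" "old e = None"
    and "\<And>x. x \<in> set (xs @ ys) \<Longrightarrow> old x = fst (canon d (xs @ ys) h) x"
  shows "computes orc (rebuild p old (xs @ e # ys) h) (canon d (xs @ e # ys) h)
           ((m + 1) * q * (1 + cost d (last h) (xs @ e # ys) e))"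
  using assms
proof (induction xs arbitrary: h)
  case Nil
  let ?h = "extend h (snd (cert d h e))"
  have "computes orc (search_cert p h e) (cert d h e) ((m + 1) * q)"
    using Nil by (intro computes_search) auto
  then have c: "computes orc (find_cert p old h e) (cert d h e) ((m + 1) * q)"
    using Nil by (simp add: find_cert_def)
  have "computes orc (rebuild p old ys ?h) (canon d ys ?h) ((m + 1) * q * cost d (last h) (e # ys) e)"
  proof (cases "d (last h) e")
    case None
    then have "?h = h" using snd_cert[OF Nil(1), of e] by simp
    then have "computes orc (rebuild p old ys ?h) (canon d ys ?h) 0"
      using Nil computes_rebuild_same[of h ys old] by auto
    then show ?thesis by (rule computes_mono) simp
  next
    case (Some s)
    then have h: "?h = h @ [s]" using snd_cert[OF Nil(1), of e] by simp
    have hs: "history (h @ [s])" using Nil(1) Some by (rule history_snoc)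
    have "computes orc (rebuild p old ys (h @ [s])) (canon d ys (h @ [s]))
           ((m + 1) * q * length (filter (\<lambda>x. d (last h) x \<noteq> None) ys))"
      using Nil by (intro computes_rebuild_diverged[where g = "[]"] hs) auto
    then show ?thesis unfolding h using Some by simp
  qed
  from computes_rebuild_Cons[OF c this] show ?case by (simp add: algebra_simps)
next
  case (Cons x xs)
  let ?h = "extend h (snd (cert d h x))"
  have c: "computes orc (find_cert p old h x) (cert d h x) 0"
    using Cons.prems(5)[of x] Cons.prems(1)
    by (intro computes_find_valid valid_cert_self) (auto simp: Let_def)
  have *: "distinct (x # (xs @ ys))" using Cons.prems(3) by auto
  have "computes orc (rebuild p old (xs @ e # ys) ?h) (canon d (xs @ e # ys) ?h)
           ((m + 1) * q * (1 + cost d (last ?h) (xs @ e # ys) e))"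
  proof (rule Cons.IH)
    fix y assume y: "y \<in> set (xs @ ys)"
    show "old y = fst (canon d (xs @ ys) ?h) y"
      using Cons.prems(5)[of y] canon_Cons_rest[OF * y, of h] y by simp
  qed (use Cons.prems history_extend in auto)
  moreover have "cost d (last ?h) (xs @ e # ys) e = cost d (last h) ((x # xs) @ e # ys) e"
    using snd_cert[OF Cons.prems(1), of x] Cons.prems(3) by (auto simp: extend_def split: option.split)
  ultimately show ?case using computes_rebuild_Cons[OF c, of "xs @ e # ys"] by simp
qed

text \<open>Insertion with the roles of the chains exchanged: the old one now continues from
  \<open>h @ [s]\<close>. The cost refers to the order still containing \<open>e\<close>, so both
  kinds of update lead to the same average.\<close>

lemma computes_rebuild_delete:
  assumes "history h" "set (xs @ e # ys) \<subseteq> W" "distinct (xs @ e # ys)"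
    and "\<And>x. x \<in> set (xs @ ys) \<Longrightarrow> old x = fst (canon d (xs @ e # ys) h) x"
  shows "computes orc (rebuild p old (xs @ ys) h) (canon d (xs @ ys) h)
           ((m + 1) * q * cost d (last h) (xs @ e # ys) e)"
  using assms
proof (induction xs arbitrary: h)
  case Nil
  have old: "old x = fst (canon d ys (extend h (snd (cert d h e)))) x" if "x \<in> set ys" for x
    using Nil(4)[of x] canon_Cons_rest[of e ys x h] Nil(3) that by simp
  show ?case
  proof (cases "d (last h) e")
    case None
    then have "extend h (snd (cert d h e)) = h" using snd_cert[OF Nil(1), of e] by simp
    then have "computes orc (rebuild p old ys h) (canon d ys h) 0"
      using Nil old by (intro computes_rebuild_same) auto
    then show ?thesis by (auto intro: computes_mono)
  next
    case (Some s)
    then have h: "extend h (snd (cert d h e)) = h @ [s]" using snd_cert[OF Nil(1), of e] by simp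
    have hs: "history (h @ [s])" using Nil(1) Some by (rule history_snoc)
    have "computes orc (rebuild p old ys (h @ [])) (canon d ys (h @ []))
           ((m + 1) * q * length (filter (\<lambda>x. d (last h) x \<noteq> None) ys))"
      using Nil hs old h by (intro computes_rebuild_diverged[where g = "[s]"]) auto
    then show ?thesis using Some by simp
  qed
next
  case (Cons x xs)
  let ?h = "extend h (snd (cert d h x))"
  have c: "computes orc (find_cert p old h x) (cert d h x) 0"
    using Cons.prems(4)[of x] Cons.prems(1)
    by (intro computes_find_valid valid_cert_self) (auto simp: Let_def)
  have *: "distinct (x # (xs @ e # ys))" using Cons.prems(3) by auto
  have "computes orc (rebuild p old (xs @ ys) ?h) (canon d (xs @ ys) ?h)
           ((m + 1) * q * cost d (last ?h) (xs @ e # ys) e)"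
  proof (rule Cons.IH)
    fix y assume y: "y \<in> set (xs @ ys)"
    then show "old y = fst (canon d (xs @ e # ys) ?h) y"
      using Cons.prems(4)[of y] canon_Cons_rest[OF *, of y h] by auto
  qed (use Cons.prems history_extend in auto)
  moreover have "cost d (last ?h) (xs @ e # ys) e = cost d (last h) ((x # xs) @ e # ys) e"
    using snd_cert[OF Cons.prems(1), of x] Cons.prems(3) by (auto simp: extend_def split: option.split)
  ultimately show ?case using computes_rebuild_Cons[OF c, of "xs @ ys"] by simp
qed

end

section \<open>The dynamic algorithm\<close>

text \<open>The order, the cached singleton information, and for each guess the certificates with
  the chain. Guesses range over all integers; one without participants keeps the initial
  chain.\<close>

type_synonym ('v, 's) dyn_state =
  "'v list \<times> ('v \<Rightarrow> real) \<times> (int \<Rightarrow> ('v \<rightharpoonup> 's list \<times> 's option) \<times> 's list)"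

locale dyn_alg =
  fixes sing :: "'v \<Rightarrow> ('q, 'a, real) prog" and part :: "real \<Rightarrow> int list"
    and stp :: "int \<Rightarrow> 's \<Rightarrow> 'v \<Rightarrow> ('q, 'a, 's option) prog" and s0 :: 's
begin

primrec rebuild_all ::
  "int list \<Rightarrow> (int \<Rightarrow> 'v list) \<Rightarrow> (int \<Rightarrow> ('v \<rightharpoonup> 's list \<times> 's option) \<times> 's list) \<Rightarrow>
     ('q, 'a, int \<Rightarrow> ('v \<rightharpoonup> 's list \<times> 's option) \<times> 's list) prog" where
  "rebuild_all [] F D = Return D"
| "rebuild_all (j # js) F D =
     pbind (rebuild (stp j) (fst (D j)) (F j) [s0]) (\<lambda>r. rebuild_all js F (D(j := r)))"

definition refresh ::
  "'v list \<Rightarrow> ('v \<Rightarrow> real) \<Rightarrow> int list \<Rightarrow> (int \<Rightarrow> ('v \<rightharpoonup> 's list \<times> 's option) \<times> 's list) \<Rightarrow>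
     ('q, 'a, ('v, 's) dyn_state) prog" where
  "refresh xs val js D =
     pbind (rebuild_all js (\<lambda>j. filter (\<lambda>x. j \<in> set (part (val x))) xs) D)
       (\<lambda>D'. Return (xs, val, D'))"

text \<open>A deletion reads the guesses of \<open>e\<close> off the cached value without a query.
  Resetting that value to 0 keeps the cache determined by the order, as \<open>canonical\<close>
  requires.\<close>

fun update_step :: "('v, 's) dyn_state \<Rightarrow> 'v update \<Rightarrow> ('q, 'a, ('v, 's) dyn_state) prog" where
  "update_step (xs, val, D) (Insert e) =
     (if e \<in> set xs then Return (xs, val, D)
      else Sample (pmf_of_set {..length xs}) (\<lambda>i. pbind (sing e) (\<lambda>a.
             refresh (insert_at i e xs) (val(e := a)) (part a) D)))"
| "update_step (xs, val, D) (Delete e) =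
     (if e \<in> set xs then refresh (remove1 e xs) (val(e := 0)) (part (val e)) D
      else Return (xs, val, D))"

definition init_state :: "('v, 's) dyn_state" where
  "init_state = ([], \<lambda>_. 0, \<lambda>_. (Map.empty, [s0]))"

end

lemma live_0 [simp]: "live us 0 = {}"
  by (simp add: live_def)

lemma live_Suc:
  "live us (Suc t) = (case us ! t of Insert e \<Rightarrow> insert e (live us t) | Delete e \<Rightarrow> live us t - {e})"
proof (cases "us ! t")
  case (Insert e)
  have "x \<in> live us (Suc t) \<longleftrightarrow> x \<in> insert e (live us t)" for x
  proof
    assume "x \<in> live us (Suc t)"
    then obtain i where i: "i < Suc t" "us ! i = Insert x" "\<forall>j<Suc t. i < j \<longrightarrow> us ! j \<noteq> Delete x"
      by (auto simp: live_def)
    then show "x \<in> insert e (live us t)"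
      using Insert by (cases "i = t") (auto simp: live_def less_Suc_eq)
  next
    assume "x \<in> insert e (live us t)"
    then show "x \<in> live us (Suc t)"
    proof
      assume "x = e"
      then show ?thesis using Insert by (auto simp: live_def intro!: exI[of _ t])
    next
      assume "x \<in> live us t"
      then obtain i where "i < t" "us ! i = Insert x" "\<forall>j<t. i < j \<longrightarrow> us ! j \<noteq> Delete x"
        by (auto simp: live_def)
      then show ?thesis using Insert by (auto simp: live_def less_Suc_eq intro!: exI[of _ i])
    qed
  qed
  then show ?thesis using Insert by auto
next
  case (Delete e)
  have "x \<in> live us (Suc t) \<longleftrightarrow> x \<in> live us t - {e}" for x
  proof
    assume "x \<in> live us (Suc t)"
    then obtain i where i: "i < Suc t" "us ! i = Insert x" "\<forall>j<Suc t. i < j \<longrightarrow> us ! j \<noteq> Delete x"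
      by (auto simp: live_def)
    moreover have "i \<noteq> t" using i Delete by auto
    ultimately have "i < t" "us ! t \<noteq> Delete x" by auto
    then show "x \<in> live us t - {e}"
      using Delete i by (auto simp: live_def)
  next
    assume "x \<in> live us t - {e}"
    then obtain i where "i < t" "us ! i = Insert x" "\<forall>j<t. i < j \<longrightarrow> us ! j \<noteq> Delete x" "x \<noteq> e"
      by (auto simp: live_def)
    then show "x \<in> live us (Suc t)"
      using Delete by (auto simp: live_def less_Suc_eq intro!: exI[of _ i])
  qed
  then show ?thesis using Delete by auto
qed

lemma live_subset:
  assumes "t \<le> length us" "\<forall>u\<in>set us. elem u \<in> V"
  shows "live us t \<subseteq> V"
proof
  fix x assume "x \<in> live us t"
  then obtain i where "i < t" "us ! i = Insert x" by (auto simp: live_def)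
  then show "x \<in> V" using assms by (metis nth_mem order_less_le_trans update.sel(1))
qed

section \<open>Distribution of the state and expected cost of an update\<close>

locale dyn_analysis = dyn_alg sing part stp s0
  for sing :: "'v \<Rightarrow> ('q, 'a, real) prog" and part :: "real \<Rightarrow> int list"
    and stp :: "int \<Rightarrow> 's \<Rightarrow> 'v \<Rightarrow> ('q, 'a, 's option) prog" and s0 :: 's +
  fixes V :: "'v set" and orc :: "'q \<Rightarrow> 'a" and info :: "'v \<Rightarrow> real"
    and \<delta> :: "int \<Rightarrow> 's \<Rightarrow> 'v \<Rightarrow> 's option" and Inv :: "int \<Rightarrow> 's \<Rightarrow> bool"
    and \<mu> :: "int \<Rightarrow> 's \<Rightarrow> nat" and T q1 q m P :: nat
  assumes finite_V: "finite V"
    and sing: "x \<in> V \<Longrightarrow> computes orc (sing x) (info x) q1"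
    and part: "x \<in> V \<Longrightarrow> distinct (part (info x)) \<and> length (part (info x)) \<le> P"
    and stp: "Inv j s \<Longrightarrow> x \<in> V \<Longrightarrow> j \<in> set (part (info x)) \<Longrightarrow> computes orc (stp j s x) (\<delta> j s x) q"
    and Inv_init: "Inv j s0"
    and Inv_step: "Inv j s \<Longrightarrow> x \<in> V \<Longrightarrow> j \<in> set (part (info x)) \<Longrightarrow> \<delta> j s x = Some s' \<Longrightarrow>
      Inv j s' \<and> \<mu> j s < \<mu> j s'"
    and \<mu>_le: "Inv j s \<Longrightarrow> \<mu> j s \<le> T"
    and rejected: "Inv j s \<Longrightarrow> x \<in> V \<Longrightarrow> j \<in> set (part (info x)) \<Longrightarrow> \<delta> j s x = Some s' \<Longrightarrow>
      y \<in> V \<Longrightarrow> \<delta> j s y = None \<Longrightarrow> \<delta> j s' y = None"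
    and height: "T + 1 < 2 ^ m"
begin

text \<open>Rejecting every nonparticipant makes the chain assumptions hold for all elements, and
  leaves the chain unchanged when nonparticipants are added to the order.\<close>

definition step_at :: "int \<Rightarrow> 's \<Rightarrow> 'v \<Rightarrow> 's option" where
  "step_at j s x = (if x \<in> V \<and> j \<in> set (part (info x)) then \<delta> j s x else None)"

sublocale scale: chain_prog "step_at j" "Inv j" "\<mu> j" T orc "stp j" "{x\<in>V. j \<in> set (part (info x))}" q m
  for j :: int
proof
  fix s x s'
  assume a: "Inv j s" "step_at j s x = Some s'"
  then have b: "x \<in> V" "j \<in> set (part (info x))" "\<delta> j s x = Some s'"
    by (auto simp: step_at_def split: if_splits)
  show "Inv j s'" "\<mu> j s < \<mu> j s'" using Inv_step[OF a(1) b] by auto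
  show "step_at j s' y = None" if "step_at j s y = None" for y
    using that rejected[OF a(1) b, of y] by (auto simp: step_at_def)
next
  show "Inv j s \<Longrightarrow> x \<in> {x\<in>V. j \<in> set (part (info x))} \<Longrightarrow> computes orc (stp j s x) (step_at j s x) q"
    for s x
    using stp[of j s x] by (simp add: step_at_def)
qed (use \<mu>_le height in auto)

definition participants :: "'v list \<Rightarrow> int \<Rightarrow> 'v list" where
  "participants xs j = filter (\<lambda>x. j \<in> set (part (info x))) xs"

text \<open>The form of every reachable state: memory of earlier updates survives only in the
  order.\<close>

definition canonical :: "'v list \<Rightarrow> ('v, 's) dyn_state" where
  "canonical xs = (xs, \<lambda>x. if x \<in> set xs then info x else 0,
     \<lambda>j. canon (step_at j) (participants xs j) [s0])"

definition update_cost :: "'v list \<Rightarrow> 'v \<Rightarrow> nat" where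
  "update_cost xs e = q1 + (\<Sum>j\<in>set (part (info e)). (m + 1) * q * (1 + cost (step_at j) s0 xs e))"

lemma computes_rebuild_all:
  assumes "distinct js"
    and "\<And>j. j \<in> set js \<Longrightarrow> computes orc (rebuild (stp j) (fst (D j)) (F j) [s0]) (R j) (n j)"
  shows "computes orc (rebuild_all js F D) (\<lambda>j. if j \<in> set js then R j else D j) (\<Sum>j\<in>set js. n j)"
  using assms
proof (induction js arbitrary: D)
  case Nil
  then show ?case by (simp add: computes_Return)
next
  case (Cons i js)
  have "computes orc (rebuild_all js F (D(i := R i)))
      (\<lambda>j. if j \<in> set js then R j else (D(i := R i)) j) (\<Sum>j\<in>set js. n j)"
    using Cons.prems by (intro Cons.IH) auto
  moreover have "(\<lambda>j. if j \<in> set js then R j else (D(i := R i)) j) =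
      (\<lambda>j. if j \<in> set (i # js) then R j else D j)"
    by auto
  ultimately have "computes orc (rebuild_all (i # js) F D)
      (\<lambda>j. if j \<in> set (i # js) then R j else D j) (n i + (\<Sum>j\<in>set js. n j))"
    using Cons.prems(2)[of i] by (auto intro!: computes_pbind)
  then show ?case using Cons.prems by simp
qed

text \<open>Guesses outside \<open>js\<close> have the same participants in the same order before
  and after the update, so their stored pass is already right.\<close>

lemma computes_refresh:
  assumes js: "distinct js"
    and R: "\<And>j. j \<in> set js \<Longrightarrow> computes orc
        (rebuild (stp j) (fst (snd (snd (canonical xs)) j)) (participants ys j) [s0])
        (canon (step_at j) (participants ys j) [s0]) (n j)"
    and same: "\<And>j. j \<notin> set js \<Longrightarrow> participants ys j = participants xs j"
    and val: "\<And>x. val x = (if x \<in> set ys then info x else 0)"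
  shows "computes orc (refresh ys val js (snd (snd (canonical xs)))) (canonical ys) (\<Sum>j\<in>set js. n j)"
proof -
  let ?D = "snd (snd (canonical xs))"
  have F: "filter (\<lambda>x. j \<in> set (part (val x))) ys = participants ys j" for j
    unfolding participants_def by (rule filter_cong) (auto simp: val)
  have "computes orc (rebuild_all js (participants ys) ?D)
      (\<lambda>j. if j \<in> set js then canon (step_at j) (participants ys j) [s0] else ?D j) (\<Sum>j\<in>set js. n j)"
    by (rule computes_rebuild_all[OF js R])
  moreover have "(\<lambda>j. if j \<in> set js then canon (step_at j) (participants ys j) [s0] else ?D j) =
      (\<lambda>j. canon (step_at j) (participants ys j) [s0])"
    by (auto simp: canonical_def same)
  ultimately have "computes orc (rebuild_all js (participants ys) ?D)
      (\<lambda>j. canon (step_at j) (participants ys j) [s0]) (\<Sum>j\<in>set js. n j)" by simp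
  from computes_pbind[OF this, of "\<lambda>D'. Return (ys, val, D')" "canonical ys" 0]
  show ?thesis
    unfolding refresh_def F
    using val by (simp add: canonical_def computes_Return fun_eq_iff[symmetric] ext[OF val])
qed

lemma history_init: "scale.history j [s0]"
  by (intro scale.history_single Inv_init)

lemma cost_participants: "cost (step_at j) s0 (participants xs j) e = cost (step_at j) s0 xs e"
  unfolding participants_def by (rule cost_filter) (simp add: step_at_def)

lemma canon_None:
  "e \<notin> set xs \<Longrightarrow> fst (canon d xs h) e = None"
  by (induction xs arbitrary: h) (auto simp: Let_def)

lemma split_participants:
  assumes "j \<in> set (part (info e))"
  shows "participants (xs @ e # ys) j = participants xs j @ e # participants ys j"
    and "participants (xs @ ys) j = participants xs j @ participants ys j"
  using assms by (simp_all add: participants_def)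

lemma cost_split_participants:
  assumes "j \<in> set (part (info e))"
  shows "cost (step_at j) s0 (participants xs j @ e # participants ys j) e =
    cost (step_at j) s0 (xs @ e # ys) e"
  using cost_participants[of j "xs @ e # ys" e] split_participants(1)[OF assms, of xs ys] by simp

lemma computes_insert:
  assumes "distinct (xs @ e # ys)" "set (xs @ e # ys) \<subseteq> V"
  shows "computes orc
    (pbind (sing e) (\<lambda>a. refresh (xs @ e # ys) ((fst (snd (canonical (xs @ ys))))(e := a)) (part a)
       (snd (snd (canonical (xs @ ys))))))
    (canonical (xs @ e # ys)) (update_cost (xs @ e # ys) e)"
  unfolding update_cost_def
proof (rule computes_pbind[OF sing])
  show "computes orc (refresh (xs @ e # ys) ((fst (snd (canonical (xs @ ys))))(e := info e))
      (part (info e)) (snd (snd (canonical (xs @ ys))))) (canonical (xs @ e # ys))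
      (\<Sum>j\<in>set (part (info e)). (m + 1) * q * (1 + cost (step_at j) s0 (xs @ e # ys) e))"
  proof (rule computes_refresh)
    fix j assume j: "j \<in> set (part (info e))"
    have "computes orc (rebuild (stp j) (fst (snd (snd (canonical (xs @ ys))) j))
          (participants xs j @ e # participants ys j) [s0])
        (canon (step_at j) (participants xs j @ e # participants ys j) [s0])
        ((m + 1) * q * (1 + cost (step_at j) (last [s0]) (participants xs j @ e # participants ys j) e))"
      using assms j
      by (intro scale.computes_rebuild_insert history_init)
         (auto simp: participants_def canonical_def canon_None)
    then show "computes orc (rebuild (stp j) (fst (snd (snd (canonical (xs @ ys))) j))
          (participants (xs @ e # ys) j) [s0])
        (canon (step_at j) (participants (xs @ e # ys) j) [s0])
        ((m + 1) * q * (1 + cost (step_at j) s0 (xs @ e # ys) e))"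
      by (simp only: cost_split_participants[OF j] split_participants(1)[OF j] last.simps refl if_True)
  qed (use part assms in \<open>auto simp: participants_def canonical_def\<close>)
qed (use assms in auto)

lemma computes_delete:
  assumes "distinct (xs @ e # ys)" "set (xs @ e # ys) \<subseteq> V"
  shows "computes orc
    (refresh (xs @ ys) ((fst (snd (canonical (xs @ e # ys))))(e := 0)) (part (info e))
       (snd (snd (canonical (xs @ e # ys)))))
    (canonical (xs @ ys)) (update_cost (xs @ e # ys) e)"
\<comment> \<open>Deletion needs neither the call of \<open>sing\<close> nor a search for
  \<open>e\<close>; bounding it by the insertion cost lets one expectation serve both.\<close>
proof (rule computes_mono)
  show "computes orc (refresh (xs @ ys) ((fst (snd (canonical (xs @ e # ys))))(e := 0))
      (part (info e)) (snd (snd (canonical (xs @ e # ys))))) (canonical (xs @ ys))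
      (\<Sum>j\<in>set (part (info e)). (m + 1) * q * cost (step_at j) s0 (xs @ e # ys) e)"
  proof (rule computes_refresh)
    fix j assume j: "j \<in> set (part (info e))"
    have "computes orc (rebuild (stp j) (fst (snd (snd (canonical (xs @ e # ys))) j))
          (participants xs j @ participants ys j) [s0])
        (canon (step_at j) (participants xs j @ participants ys j) [s0])
        ((m + 1) * q * cost (step_at j) (last [s0]) (participants xs j @ e # participants ys j) e)"
      using assms j
      by (intro scale.computes_rebuild_delete history_init)
         (auto simp: participants_def canonical_def)
    then show "computes orc (rebuild (stp j) (fst (snd (snd (canonical (xs @ e # ys))) j))
          (participants (xs @ ys) j) [s0])
        (canon (step_at j) (participants (xs @ ys) j) [s0])
        ((m + 1) * q * cost (step_at j) s0 (xs @ e # ys) e)"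
      by (simp only: cost_split_participants[OF j] split_participants(2)[OF j] last.simps refl if_True)
  qed (use part assms in \<open>auto simp: participants_def canonical_def\<close>)
  have "(\<Sum>j\<in>set (part (info e)). (m + 1) * q * cost (step_at j) s0 (xs @ e # ys) e) \<le>
      (\<Sum>j\<in>set (part (info e)). (m + 1) * q * (1 + cost (step_at j) s0 (xs @ e # ys) e))"
    by (intro sum_mono) simp
  then show "(\<Sum>j\<in>set (part (info e)). (m + 1) * q * cost (step_at j) s0 (xs @ e # ys) e) \<le>
      update_cost (xs @ e # ys) e"
    unfolding update_cost_def by simp
qed

lemma run_insert_absent:
  assumes "distinct xs" "set xs \<subseteq> V" "e \<in> V" "e \<notin> set xs"
  shows "\<exists>n. (\<forall>i. n i \<le> update_cost (insert_at i e xs) e) \<and>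
    run orc (update_step (canonical xs) (Insert e)) =
      map_pmf (\<lambda>i. (canonical (insert_at i e xs), n i)) (pmf_of_set {..length xs})"
proof -
  let ?p = "\<lambda>i. pbind (sing e) (\<lambda>a. refresh (insert_at i e xs)
    ((fst (snd (canonical xs)))(e := a)) (part a) (snd (snd (canonical xs))))"
  have "\<exists>n\<le>update_cost (insert_at i e xs) e. run orc (?p i) = return_pmf (canonical (insert_at i e xs), n)"
    for i
  proof -
    have "distinct (take i xs @ e # drop i xs)" "set (take i xs @ e # drop i xs) \<subseteq> V"
      using assms distinct_insert_at[of i e xs] set_insert_at[of i e xs] by (auto simp: insert_at_def)
    from computes_insert[OF this] show ?thesis
      by (simp add: computes_def insert_at_def)
  qed
  then have "\<exists>n. \<forall>i. n i \<le> update_cost (insert_at i e xs) e \<and>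
      run orc (?p i) = return_pmf (canonical (insert_at i e xs), n i)"
    by (intro choice allI)
  then obtain n where n: "\<forall>i. n i \<le> update_cost (insert_at i e xs) e"
    "\<And>i. run orc (?p i) = return_pmf (canonical (insert_at i e xs), n i)" by blast
  have "update_step (canonical xs) (Insert e) = Sample (pmf_of_set {..length xs}) ?p"
    using assms by (simp add: canonical_def)
  then have "run orc (update_step (canonical xs) (Insert e)) =
      map_pmf (\<lambda>i. (canonical (insert_at i e xs), n i)) (pmf_of_set {..length xs})"
    by (simp add: n(2) map_pmf_def)
  with n(1) show ?thesis by blast
qed

lemma run_delete_present:
  assumes "distinct xs" "set xs \<subseteq> V" "e \<in> set xs"
  shows "\<exists>n\<le>update_cost xs e.
    run orc (update_step (canonical xs) (Delete e)) = return_pmf (canonical (remove1 e xs), n)"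
proof -
  obtain ys zs where xs: "xs = ys @ e # zs" using assms(3) by (meson split_list)
  have r: "remove1 e xs = ys @ zs" using assms(1) by (simp add: xs remove1_append)
  have "fst (snd (canonical xs)) e = info e" using assms(3) by (simp add: canonical_def)
  then have "update_step (canonical xs) (Delete e) =
      refresh (ys @ zs) ((fst (snd (canonical xs)))(e := 0)) (part (info e)) (snd (snd (canonical xs)))"
    using assms(3) r by (simp add: canonical_def)
  then have "computes orc (update_step (canonical xs) (Delete e)) (canonical (ys @ zs)) (update_cost xs e)"
    using computes_delete[of ys e zs] assms by (simp add: xs)
  then show ?thesis using r by (auto simp: computes_def)
qed

lemma run_no_effect:
  "e \<in> set xs \<Longrightarrow> run orc (update_step (canonical xs) (Insert e)) = return_pmf (canonical xs, 0)"
  "e \<notin> set xs \<Longrightarrow> run orc (update_step (canonical xs) (Delete e)) = return_pmf (canonical xs, 0)"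
  by (simp_all add: canonical_def)

text \<open>The induction works because \<open>us ! t\<close> is fixed in advance: the order is
  uniform before each update, a random insertion or a removal keeps it so, and the rest of the state
  is a function of the order.\<close>

lemma machine_after_canonical:
  assumes "t \<le> length us" "\<forall>u\<in>set us. elem u \<in> V"
  shows "machine_after orc update_step init_state (take t us) =
    map_pmf canonical (pmf_of_set (permutations_of_set (live us t)))"
  using assms(1)
proof (induction t)
  case 0
  have "canonical [] = init_state" by (simp add: canonical_def init_state_def participants_def)
  then show ?case by (simp add: pmf_of_set_singleton)
next
  case (Suc t)
  let ?L = "live us t"
  have L: "?L \<subseteq> V" "finite ?L"
    using live_subset[of t us V] Suc.prems assms(2) finite_V finite_subset by auto
  have perm: "distinct xs \<and> set xs = ?L" if "xs \<in> set_pmf (pmf_of_set (permutations_of_set ?L))" for xs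
    using that L by (auto dest: permutations_of_setD)
  have e: "elem (us ! t) \<in> V" using assms(2) Suc.prems by simp
  have "machine_after orc update_step init_state (take (Suc t) us) =
      bind_pmf (pmf_of_set (permutations_of_set ?L))
        (\<lambda>xs. map_pmf fst (run orc (update_step (canonical xs) (us ! t))))"
    using Suc by (simp add: take_Suc_conv_app_nth machine_after_snoc bind_map_pmf)
  also have "\<dots> = map_pmf canonical (pmf_of_set (permutations_of_set (live us (Suc t))))"
  proof (cases "us ! t")
    case (Insert e)
    then have eV: "e \<in> V" using e by simp
    show ?thesis
    proof (cases "e \<in> ?L")
      case True
      then have "live us (Suc t) = ?L" using Insert by (auto simp: live_Suc)
      moreover have "bind_pmf (pmf_of_set (permutations_of_set ?L))
          (\<lambda>xs. map_pmf fst (run orc (update_step (canonical xs) (Insert e)))) =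
          bind_pmf (pmf_of_set (permutations_of_set ?L)) (\<lambda>xs. return_pmf (canonical xs))"
        by (intro bind_pmf_cong refl) (use perm True in \<open>simp add: run_no_effect\<close>)
      ultimately show ?thesis using Insert by (simp add: map_pmf_def)
    next
      case False
      then have "live us (Suc t) = insert e ?L" using Insert by (auto simp: live_Suc)
      moreover have "bind_pmf (pmf_of_set (permutations_of_set ?L))
          (\<lambda>xs. map_pmf fst (run orc (update_step (canonical xs) (Insert e)))) =
          bind_pmf (pmf_of_set (permutations_of_set ?L))
            (\<lambda>xs. map_pmf (\<lambda>i. canonical (insert_at i e xs)) (pmf_of_set {..length xs}))"
      proof (intro bind_pmf_cong refl)
        fix xs assume xs: "xs \<in> set_pmf (pmf_of_set (permutations_of_set ?L))"
        obtain n where "run orc (update_step (canonical xs) (Insert e)) =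
            map_pmf (\<lambda>i. (canonical (insert_at i e xs), n i)) (pmf_of_set {..length xs})"
          using run_insert_absent[of xs e] perm[OF xs] L eV False by auto
        then show "map_pmf fst (run orc (update_step (canonical xs) (Insert e))) =
            map_pmf (\<lambda>i. canonical (insert_at i e xs)) (pmf_of_set {..length xs})"
          by (simp add: pmf.map_comp o_def)
      qed
      ultimately show ?thesis using Insert L False
        by (simp add: pmf_permutations_insert map_bind_pmf pmf.map_comp o_def)
    qed
  next
    case (Delete e)
    show ?thesis
    proof (cases "e \<in> ?L")
      case False
      then have "live us (Suc t) = ?L" using Delete by (auto simp: live_Suc)
      moreover have "bind_pmf (pmf_of_set (permutations_of_set ?L))
          (\<lambda>xs. map_pmf fst (run orc (update_step (canonical xs) (Delete e)))) =
          bind_pmf (pmf_of_set (permutations_of_set ?L)) (\<lambda>xs. return_pmf (canonical xs))"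
        by (intro bind_pmf_cong refl) (use perm False in \<open>simp add: run_no_effect\<close>)
      ultimately show ?thesis using Delete by (simp add: map_pmf_def)
    next
      case True
      then have "live us (Suc t) = ?L - {e}" using Delete by (auto simp: live_Suc)
      moreover have "bind_pmf (pmf_of_set (permutations_of_set ?L))
          (\<lambda>xs. map_pmf fst (run orc (update_step (canonical xs) (Delete e)))) =
          bind_pmf (pmf_of_set (permutations_of_set ?L)) (\<lambda>xs. return_pmf (canonical (remove1 e xs)))"
      proof (intro bind_pmf_cong refl)
        fix xs assume xs: "xs \<in> set_pmf (pmf_of_set (permutations_of_set ?L))"
        obtain n where "run orc (update_step (canonical xs) (Delete e)) =
            return_pmf (canonical (remove1 e xs), n)"
          using run_delete_present[of xs e] perm[OF xs] L True by auto
        then show "map_pmf fst (run orc (update_step (canonical xs) (Delete e))) =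
            return_pmf (canonical (remove1 e xs))"
          by simp
      qed
      ultimately show ?thesis using Delete L True
        by (simp add: pmf_permutations_remove pmf.map_comp o_def flip: map_pmf_def)
    qed
  qed
  finally show ?case .
qed

text \<open>Linearity over the guesses of \<open>e\<close>: in each, one search for \<open>e\<close>
  and on average at most \<open>T\<close> searches for other elements.\<close>

lemma expected_update_cost:
  assumes "finite A" "A \<subseteq> V" "e \<in> A"
  shows "(\<integral>\<^sup>+ xs. of_nat (update_cost xs e) \<partial>measure_pmf (pmf_of_set (permutations_of_set A))) \<le>
    of_nat (q1 + P * ((m + 1) * q * (T + 1)))"
proof -
  let ?S = "permutations_of_set A" and ?J = "set (part (info e))" and ?B = "(m + 1) * q"
  have J: "card ?J \<le> P" using part[of e] assms by (auto simp: distinct_card)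
  have "(\<Sum>xs\<in>?S. update_cost xs e) =
      fact (card A) * q1 + (\<Sum>xs\<in>?S. \<Sum>j\<in>?J. ?B * (1 + cost (step_at j) s0 xs e))"
    using assms by (simp add: update_cost_def sum.distrib)
  also have "(\<Sum>xs\<in>?S. \<Sum>j\<in>?J. ?B * (1 + cost (step_at j) s0 xs e)) =
      (\<Sum>j\<in>?J. \<Sum>xs\<in>?S. ?B * (1 + cost (step_at j) s0 xs e))"
    by (rule sum.swap)
  also have "\<dots> \<le> (\<Sum>j\<in>?J. ?B * (fact (card A) * (1 + T)))"
  proof (intro sum_mono)
    fix j
    have "(\<Sum>xs\<in>?S. ?B * (1 + cost (step_at j) s0 xs e)) =
        ?B * (fact (card A) + (\<Sum>xs\<in>?S. cost (step_at j) s0 xs e))"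
      using assms by (subst sum_distrib_left[symmetric], subst sum.distrib) simp
    also have "\<dots> \<le> ?B * (fact (card A) + fact (card A) * (T - \<mu> j s0))"
      using scale.sum_cost_permutations[OF assms(1,3) Inv_init, of j]
      by (intro mult_left_mono add_left_mono) auto
    also have "\<dots> \<le> ?B * (fact (card A) * (1 + T))"
      by (intro mult_left_mono) (auto simp: distrib_left)
    finally show "(\<Sum>xs\<in>?S. ?B * (1 + cost (step_at j) s0 xs e)) \<le> ?B * (fact (card A) * (1 + T))" .
  qed
  also have "\<dots> \<le> P * (?B * (fact (card A) * (1 + T)))"
    using J by (simp del: mult_Suc mult_Suc_right add: mult_right_mono)
  also have "fact (card A) * q1 + P * (?B * (fact (card A) * (1 + T))) =
      (q1 + P * (?B * (T + 1))) * card ?S"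
    using assms by (simp add: algebra_simps)
  finally have "(\<Sum>xs\<in>?S. update_cost xs e) \<le> (q1 + P * (?B * (T + 1))) * card ?S" by simp
  then have le: "real (\<Sum>xs\<in>?S. update_cost xs e) \<le> real (q1 + P * (?B * (T + 1))) * real (card ?S)"
    unfolding of_nat_mult[symmetric] of_nat_le_iff .
  have ne: "card ?S > 0" using assms by simp
  have "(\<integral>\<^sup>+ xs. of_nat (update_cost xs e) \<partial>measure_pmf (pmf_of_set ?S)) =
      (\<Sum>xs\<in>?S. of_nat (update_cost xs e)) / of_nat (card ?S)"
    using assms by (subst nn_integral_pmf_of_set) auto
  also have "\<dots> = ennreal (real (\<Sum>xs\<in>?S. update_cost xs e) / real (card ?S))"
    using ne by (simp add: ennreal_of_nat_eq_real_of_nat divide_ennreal sum_nonneg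
       del: of_nat_sum flip: of_nat_sum)
  also have "\<dots> \<le> ennreal (real (q1 + P * (?B * (T + 1))))"
    using le ne by (intro ennreal_leI) (simp add: pos_divide_le_eq del: of_nat_add of_nat_mult of_nat_sum)
  finally show ?thesis by (simp only: ennreal_of_nat_eq_real_of_nat)
qed

text \<open>The order that matters contains \<open>e\<close> in both cases: after an insertion it is
  uniform on the live set enlarged by \<open>e\<close>, before a deletion on the live set
  itself.\<close>

theorem expected_queries:
  assumes us: "\<forall>u\<in>set us. elem u \<in> V"
    and b: "real (q1 + P * ((m + 1) * q * (T + 1))) \<le> b"
  shows "worst_case_expected_queries_le orc (unfold_alg out update_step init_state) us b"
  unfolding worst_case_expected_queries_le_def
proof (intro allI impI)
  fix t assume t: "t < length us"
  let ?L = "live us t" and ?K = "of_nat (q1 + P * ((m + 1) * q * (T + 1))) :: ennreal"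
  have L: "?L \<subseteq> V" "finite ?L"
    using live_subset[of t us V] t us finite_V finite_subset by auto
  have perm: "distinct xs \<and> set xs = ?L" if "xs \<in> set_pmf (pmf_of_set (permutations_of_set ?L))" for xs
    using that L by (auto dest: permutations_of_setD)
  have e: "elem (us ! t) \<in> V" using us t by simp
  have "(\<integral>\<^sup>+ n. of_nat n \<partial>measure_pmf (update_queries orc (unfold_alg out update_step init_state) us t)) =
      (\<integral>\<^sup>+ xs. \<integral>\<^sup>+ n. of_nat n \<partial>measure_pmf (map_pmf snd (run orc (update_step (canonical xs) (us ! t))))
         \<partial>measure_pmf (pmf_of_set (permutations_of_set ?L)))"
    using t us by (simp add: update_queries_unfold_alg machine_after_canonical bind_map_pmf)
  also have "\<dots> \<le> ?K"
  proof (cases "us ! t")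
    case (Insert e)
    then have eV: "e \<in> V" using e by simp
    show ?thesis
    proof (cases "e \<in> ?L")
      case True
      have "(\<integral>\<^sup>+ xs. \<integral>\<^sup>+ n. of_nat n \<partial>measure_pmf (map_pmf snd (run orc (update_step (canonical xs) (us ! t))))
         \<partial>measure_pmf (pmf_of_set (permutations_of_set ?L))) =
         (\<integral>\<^sup>+ xs. 0 \<partial>measure_pmf (pmf_of_set (permutations_of_set ?L)))"
        using perm True Insert
        by (intro nn_integral_cong_AE) (auto simp: AE_measure_pmf_iff run_no_effect)
      then show ?thesis by simp
    next
      case False
      have "(\<integral>\<^sup>+ xs. \<integral>\<^sup>+ n. of_nat n \<partial>measure_pmf (map_pmf snd (run orc (update_step (canonical xs) (us ! t))))
         \<partial>measure_pmf (pmf_of_set (permutations_of_set ?L))) \<le>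
         (\<integral>\<^sup>+ xs. \<integral>\<^sup>+ i. of_nat (update_cost (insert_at i e xs) e) \<partial>measure_pmf (pmf_of_set {..length xs})
         \<partial>measure_pmf (pmf_of_set (permutations_of_set ?L)))"
      proof (intro nn_integral_mono_AE, unfold AE_measure_pmf_iff, intro ballI)
        fix xs assume xs: "xs \<in> set_pmf (pmf_of_set (permutations_of_set ?L))"
        obtain n where n: "\<forall>i. n i \<le> update_cost (insert_at i e xs) e"
          "run orc (update_step (canonical xs) (Insert e)) =
            map_pmf (\<lambda>i. (canonical (insert_at i e xs), n i)) (pmf_of_set {..length xs})"
          using run_insert_absent[of xs e] perm[OF xs] L eV False by auto
        show "(\<integral>\<^sup>+ n. of_nat n \<partial>measure_pmf (map_pmf snd (run orc (update_step (canonical xs) (us ! t))))) \<le>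
            (\<integral>\<^sup>+ i. of_nat (update_cost (insert_at i e xs) e) \<partial>measure_pmf (pmf_of_set {..length xs}))"
          unfolding Insert n(2) by (simp add: pmf.map_comp o_def) (intro nn_integral_mono, use n(1) in simp)
      qed
      also have "\<dots> = (\<integral>\<^sup>+ xs. of_nat (update_cost xs e)
          \<partial>measure_pmf (pmf_of_set (permutations_of_set (insert e ?L))))"
        using L False by (simp add: pmf_permutations_insert)
      also have "\<dots> \<le> ?K"
        using L e Insert by (intro expected_update_cost) auto
      finally show ?thesis .
    qed
  next
    case (Delete e)
    show ?thesis
    proof (cases "e \<in> ?L")
      case False
      have "(\<integral>\<^sup>+ xs. \<integral>\<^sup>+ n. of_nat n \<partial>measure_pmf (map_pmf snd (run orc (update_step (canonical xs) (us ! t))))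
         \<partial>measure_pmf (pmf_of_set (permutations_of_set ?L))) =
         (\<integral>\<^sup>+ xs. 0 \<partial>measure_pmf (pmf_of_set (permutations_of_set ?L)))"
        using perm False Delete
        by (intro nn_integral_cong_AE) (auto simp: AE_measure_pmf_iff run_no_effect)
      then show ?thesis by simp
    next
      case True
      have "(\<integral>\<^sup>+ xs. \<integral>\<^sup>+ n. of_nat n \<partial>measure_pmf (map_pmf snd (run orc (update_step (canonical xs) (us ! t))))
         \<partial>measure_pmf (pmf_of_set (permutations_of_set ?L))) \<le>
         (\<integral>\<^sup>+ xs. of_nat (update_cost xs e) \<partial>measure_pmf (pmf_of_set (permutations_of_set ?L)))"
      proof (intro nn_integral_mono_AE, unfold AE_measure_pmf_iff, intro ballI)
        fix xs assume xs: "xs \<in> set_pmf (pmf_of_set (permutations_of_set ?L))"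
        obtain n where n: "n \<le> update_cost xs e"
          "run orc (update_step (canonical xs) (Delete e)) = return_pmf (canonical (remove1 e xs), n)"
          using run_delete_present[of xs e] perm[OF xs] L True by auto
        show "(\<integral>\<^sup>+ n. of_nat n \<partial>measure_pmf (map_pmf snd (run orc (update_step (canonical xs) (us ! t))))) \<le>
            of_nat (update_cost xs e)"
          unfolding Delete n(2) using n(1) by (simp add: nn_integral_return)
      qed
      also have "\<dots> \<le> ?K"
        using L True by (intro expected_update_cost) auto
      finally show ?thesis .
    qed
  qed
  also have "?K \<le> ennreal b"
    unfolding ennreal_of_nat_eq_real_of_nat by (rule ennreal_leI[OF b])
  finally show "(\<integral>\<^sup>+ n. of_nat n \<partial>measure_pmf (update_queries orc
      (unfold_alg out update_step init_state) us t)) \<le> ennreal b" .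
qed

theorem maintains_approxI:
  assumes us: "\<forall>u\<in>set us. elem u \<in> V"
    and out: "\<And>xs. distinct xs \<Longrightarrow> set xs \<subseteq> V \<Longrightarrow> out (canonical xs) \<in> \<F> \<and>
      out (canonical xs) \<subseteq> set xs \<and> opt \<F> f (set xs) \<le> \<alpha> * f (out (canonical xs))"
  shows "maintains_approx orc (unfold_alg out update_step init_state) us \<F> f \<alpha>"
  unfolding maintains_approx_def
proof (intro allI impI ballI)
  fix t B
  assume t: "t \<le> length us"
    and B: "B \<in> set_pmf (state_after orc (unfold_alg out update_step init_state) (take t us))"
  have L: "live us t \<subseteq> V" "finite (live us t)"
    using live_subset[OF t us] finite_V finite_subset by auto
  obtain xs where xs: "xs \<in> permutations_of_set (live us t)"
    "B = unfold_alg out update_step (canonical xs)"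
    using B L by (auto simp: state_after_unfold_alg machine_after_canonical[OF t us])
  then have "distinct xs" "set xs = live us t" by (auto dest: permutations_of_setD)
  with out[of xs] L xs(2)
  show "solution B \<in> \<F> \<and> solution B \<subseteq> live us t \<and> opt \<F> f (live us t) \<le> \<alpha> * f (solution B)"
    by simp
qed

end

section \<open>Submodular functions\<close>

locale submodular_fun =
  fixes V :: "'v set" and f :: "'v set \<Rightarrow> real"
  assumes finite_V: "finite V" and nms: "normalized_monotone_submodular V f"
begin

lemma f_empty: "f {} = 0"
  using nms by (simp add: normalized_monotone_submodular_def)

lemma f_nonneg: "A \<subseteq> V \<Longrightarrow> 0 \<le> f A"
  using nms by (simp add: normalized_monotone_submodular_def)

lemma f_mono: "A \<subseteq> B \<Longrightarrow> B \<subseteq> V \<Longrightarrow> f A \<le> f B"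
  using nms by (auto simp: normalized_monotone_submodular_def mono_on_def)

lemma f_marginal:
  assumes "A \<subseteq> B" "B \<subseteq> V" "e \<in> V"
  shows "f (insert e B) - f B \<le> f (insert e A) - f A"
proof (cases "e \<in> B")
  case True
  have "f A \<le> f (insert e A)" using assms by (intro f_mono) auto
  with True show ?thesis by (simp add: insert_absorb)
next
  case False
  then show ?thesis
    using nms assms by (auto simp: normalized_monotone_submodular_def submodular_on_def)
qed

lemma f_union_le:
  assumes "B \<subseteq> V" "A \<subseteq> V"
  shows "f (A \<union> B) \<le> f A + (\<Sum>e\<in>B. f (insert e A) - f A)"
proof -
  have "finite B" using assms(1) finite_V finite_subset by blast
  then show ?thesis
    using assms(1)
  proof (induction B)
    case (insert e B)
    have "f (insert e (A \<union> B)) - f (A \<union> B) \<le> f (insert e A) - f A"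
      using insert.prems assms(2) by (intro f_marginal) auto
    then show ?case using insert by simp
  qed simp
qed

lemma f_insert_le: "A \<subseteq> V \<Longrightarrow> e \<in> V \<Longrightarrow> f (insert e A) - f A \<le> f {e}"
  using f_marginal[of "{}" A e] by (simp add: f_empty)

end

lemma ex_log2_height:
  assumes "1 \<le> N"
  shows "\<exists>m::nat. N < 2 ^ m \<and> real m \<le> log 2 N + 1"
proof (intro exI conjI)
  let ?m = "Suc (nat \<lfloor>log 2 N\<rfloor>)"
  have m: "real ?m = of_int \<lfloor>log 2 N\<rfloor> + 1" using assms by simp
  show "real ?m \<le> log 2 N + 1" unfolding m by linarith
  have "N = 2 powr log 2 N" using assms by simp
  also have "\<dots> < 2 powr real ?m" unfolding m by (intro powr_less_mono) linarith+
  also have "\<dots> = 2 ^ ?m" by (subst powr_realpow) simp_all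
  finally show "N < 2 ^ ?m" .
qed

text \<open>For \<open>k = 0\<close> the query bound is 0, so not even the value of an inserted
  element may be asked; the empty set is then the only feasible one.\<close>

definition idle_alg :: "('u, 'q, 'a, 'v set) alg" where
  "idle_alg = unfold_alg (\<lambda>_. {}) (\<lambda>s _. Return s) ()"

lemma idle_alg:
  assumes "\<And>W. {X \<in> \<F>. X \<subseteq> W} = {{}}" "f {} = 0"
  shows "maintains_approx orc idle_alg us \<F> f \<alpha> \<and> worst_case_expected_queries_le orc idle_alg us b"
proof -
  have m: "machine_after orc (\<lambda>s _. Return s) () us = return_pmf ()" for us :: "'u list"
    by (induction us) (simp_all add: bind_return_pmf)
  have "{} \<in> \<F>" using assms(1) by blast
  then have "maintains_approx orc idle_alg us \<F> f \<alpha>"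
    using assms by (simp add: maintains_approx_def idle_alg_def state_after_unfold_alg opt_def)
  moreover have "worst_case_expected_queries_le orc idle_alg us b"
    by (simp add: worst_case_expected_queries_le_def idle_alg_def update_queries_unfold_alg
        bind_return_pmf nn_integral_return m)
  ultimately show ?thesis by blast
qed

section \<open>Cardinality constraint\<close>

definition card_guess :: "real \<Rightarrow> int \<Rightarrow> real" where
  "card_guess \<epsilon> j = (1 + \<epsilon> / 2) powr of_int j"

text \<open>
  The guess \<open>j\<close> stands for an optimum between \<open>g = card_guess \<epsilon> j\<close> and \<open>(1 + \<epsilon>/2) g\<close>.  An element
  takes part in it only if its value lies between the acceptance threshold \<open>g/(2k)\<close> and that upper
  end.
\<close>

definition card_part :: "nat \<Rightarrow> real \<Rightarrow> real \<Rightarrow> int list" where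
  "card_part k \<epsilon> a =
     (if a > 0 then [\<lceil>log (1 + \<epsilon> / 2) a\<rceil> - 1..\<lfloor>log (1 + \<epsilon> / 2) (2 * real k * a)\<rfloor>] else [])"

text \<open>The state carries the value of its set, so a single query yields the marginal
  gain.\<close>

definition card_stp ::
  "nat \<Rightarrow> real \<Rightarrow> int \<Rightarrow> 'v set \<times> real \<Rightarrow> 'v \<Rightarrow> ('v set, real, ('v set \<times> real) option) prog" where
  "card_stp k \<epsilon> j s x =
     (if card (fst s) < k
      then Query (insert x (fst s)) (\<lambda>a. Return
        (if card_guess \<epsilon> j / (2 * real k) \<le> a - snd s then Some (insert x (fst s), a) else None))
      else Return None)"

text \<open>Compares stored values, hence asks nothing and need not know which guess is right. The
  maximum over all integers exists because all but finitely many guesses keep the empty set.\<close>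

definition card_out :: "('v, 'v set \<times> real) dyn_state \<Rightarrow> 'v set" where
  "card_out S = (let st = (\<lambda>j. last (snd (snd (snd S) j))) in
     fst (st (SOME j. \<forall>i. snd (st i) \<le> snd (st j))))"

definition card_alg :: "nat \<Rightarrow> real \<Rightarrow> ('v update, 'v set, real, 'v set) alg" where
  "card_alg k \<epsilon> = (if k = 0 then idle_alg else
     unfold_alg card_out
       (dyn_alg.update_step (\<lambda>x. Query {x} Return) (card_part k \<epsilon>) (card_stp k \<epsilon>) ({}, 0))
       (dyn_alg.init_state ({}, 0)))"

locale cardinality = submodular_fun V f for V :: "'v set" and f +
  fixes k :: nat and \<epsilon> :: real
  assumes k: "0 < k" and \<epsilon>: "0 < \<epsilon>" "\<epsilon> \<le> 1"
begin

abbreviation "\<beta> \<equiv> 1 + \<epsilon> / 2"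
abbreviation "\<tau> j \<equiv> card_guess \<epsilon> j / (2 * real k)"

definition \<delta> :: "int \<Rightarrow> 'v set \<times> real \<Rightarrow> 'v \<Rightarrow> ('v set \<times> real) option" where
  "\<delta> j s x = (if card (fst s) < k \<and> \<tau> j \<le> f (insert x (fst s)) - snd s
     then Some (insert x (fst s), f (insert x (fst s))) else None)"

text \<open>In the last clause each accepted element contributes at least the threshold, so
  \<open>k\<close> elements yield half of the guess.\<close>

definition Inv :: "int \<Rightarrow> 'v set \<times> real \<Rightarrow> bool" where
  "Inv j s \<longleftrightarrow> fst s \<subseteq> V \<and> snd s = f (fst s) \<and> card (fst s) \<le> k \<and> card (fst s) * \<tau> j \<le> f (fst s)"

lemma guess_pos: "0 < card_guess \<epsilon> j"
  using \<epsilon> by (simp add: card_guess_def)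

lemma \<tau>_pos: "0 < \<tau> j"
  using guess_pos k by simp

lemma part_iff:
  assumes "a > 0"
  shows "j \<in> set (card_part k \<epsilon> a) \<longleftrightarrow> \<tau> j \<le> a \<and> a \<le> \<beta> * card_guess \<epsilon> j"
proof -
  have b: "\<beta> > 1" using \<epsilon> by simp
  have "j \<le> \<lfloor>log \<beta> (2 * real k * a)\<rfloor> \<longleftrightarrow> real_of_int j \<le> log \<beta> (2 * real k * a)"
    by (simp add: le_floor_iff)
  also have "\<dots> \<longleftrightarrow> \<beta> powr j \<le> 2 * real k * a"
    using b k assms by (subst le_log_iff) auto
  also have "\<dots> \<longleftrightarrow> \<tau> j \<le> a"
    using k by (simp add: card_guess_def field_simps)
  finally have 1: "j \<le> \<lfloor>log \<beta> (2 * real k * a)\<rfloor> \<longleftrightarrow> \<tau> j \<le> a" .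
  \<comment> \<open>The \<open>- 1\<close> comes from the upper end being
    \<open>\<beta> * card_guess \<epsilon> j\<close>, that is, exponent
    \<open>j + 1\<close>.\<close>
  have "\<lceil>log \<beta> a\<rceil> - 1 \<le> j \<longleftrightarrow> log \<beta> a \<le> real_of_int (j + 1)"
    by (simp only: ceiling_le_iff[symmetric]) linarith
  also have "\<dots> \<longleftrightarrow> a \<le> \<beta> powr (real_of_int (j + 1))"
    using b assms by (subst log_le_iff) auto
  also have "\<beta> powr (real_of_int (j + 1)) = \<beta> * card_guess \<epsilon> j"
    using b by (simp add: card_guess_def powr_add)
  finally show ?thesis using 1 assms by (auto simp: card_part_def)
qed

text \<open>Both ends of the range are shifts of \<open>log \<beta> a\<close>, so \<open>a\<close>
  cancels from the number of guesses.\<close>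

lemma length_part: "real (length (card_part k \<epsilon> a)) \<le> log \<beta> (2 * real k) + 2"
proof (cases "a > 0")
  case True
  have b: "\<beta> > 1" using \<epsilon> by simp
  have "log \<beta> (2 * real k * a) = log \<beta> (2 * real k) + log \<beta> a"
    using b k True by (simp add: log_mult)
  moreover have "0 \<le> log \<beta> (2 * real k)" using b k by simp
  moreover have "real (nat i) \<le> max 0 (real_of_int i)" for i by simp
  ultimately show ?thesis
    using True unfolding card_part_def
    by (simp add: max_def) linarith
next
  case False
  have "0 \<le> log \<beta> (2 * real k)" using k \<epsilon> by simp
  with False show ?thesis by (simp add: card_part_def)
qed

lemma step_facts:
  assumes "Inv j s" "x \<in> V" "\<delta> j s x = Some s'"
  shows "Inv j s' \<and> card (fst s) < card (fst s')"
proof -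
  have s: "fst s \<subseteq> V" "snd s = f (fst s)" "card (fst s) * \<tau> j \<le> f (fst s)"
    using assms(1) by (auto simp: Inv_def)
  have s': "card (fst s) < k" "\<tau> j \<le> f (insert x (fst s)) - f (fst s)"
    "s' = (insert x (fst s), f (insert x (fst s)))"
    using assms(3) s by (auto simp: \<delta>_def split: if_splits)
  have "x \<notin> fst s" using s'(2) \<tau>_pos[of j] by (auto simp: insert_absorb)
  then have c: "card (insert x (fst s)) = Suc (card (fst s))"
    using s(1) finite_V finite_subset by (metis card_insert_disjoint)
  have "Suc (card (fst s)) * \<tau> j = card (fst s) * \<tau> j + \<tau> j"
    by (simp add: distrib_right add_divide_distrib)
  also have "\<dots> \<le> f (insert x (fst s))" using s(3) s'(2) by linarith
  finally have "Suc (card (fst s)) * \<tau> j \<le> f (insert x (fst s))" .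
  then show ?thesis using s s' c assms(2) by (simp add: Inv_def)
qed

text \<open>Since \<open>s\<close> accepts \<open>x\<close>, it is not full; so \<open>y\<close> was
  rejected for its gain, which can only shrink.\<close>

lemma rejected_later:
  assumes "Inv j s" "x \<in> V" "\<delta> j s x = Some s'" "y \<in> V" "\<delta> j s y = None"
  shows "\<delta> j s' y = None"
proof -
  have s: "fst s \<subseteq> V" "snd s = f (fst s)"
    using assms(1) by (auto simp: Inv_def)
  have s': "card (fst s) < k" "s' = (insert x (fst s), f (insert x (fst s)))"
    using assms(3) s by (auto simp: \<delta>_def split: if_splits)
  have "f (insert y (insert x (fst s))) - f (insert x (fst s)) \<le> f (insert y (fst s)) - f (fst s)"
    using s assms by (intro f_marginal) auto
  moreover have "f (insert y (fst s)) - f (fst s) < \<tau> j"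
    using assms(5) s s' by (auto simp: \<delta>_def split: if_splits)
  ultimately show ?thesis using s' by (simp add: \<delta>_def)
qed

lemma Inv_init: "Inv j ({}, 0)"
  by (simp add: Inv_def f_empty)

lemma computes_stp: "computes f (card_stp k \<epsilon> j s x) (\<delta> j s x) 1"
proof (cases "card (fst s) < k")
  case True
  then have "card_stp k \<epsilon> j s x = Query (insert x (fst s)) (\<lambda>a. Return
      (if \<tau> j \<le> a - snd s then Some (insert x (fst s), a) else None))"
    by (simp add: card_stp_def)
  moreover have "computes f \<dots> (\<delta> j s x) (Suc 0)"
    by (rule computes_Query) (use True in \<open>simp add: \<delta>_def computes_Return\<close>)
  ultimately show ?thesis by simp
qed (simp add: card_stp_def \<delta>_def computes_Return)

lemma analysis:
  assumes "k + 1 < 2 ^ m" "log \<beta> (2 * real k) + 2 < real P + 1"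
  shows "dyn_analysis (\<lambda>x. Query {x} Return) (card_part k \<epsilon>) (card_stp k \<epsilon>) ({}, 0)
    V f (\<lambda>x. f {x}) \<delta> Inv (\<lambda>j s. card (fst s)) k 1 1 m P"
proof
  show "distinct (card_part k \<epsilon> (f {x})) \<and> length (card_part k \<epsilon> (f {x})) \<le> P" for x
    using length_part[of "f {x}"] assms(2) by (auto simp: card_part_def)
  show "computes f (Query {x} Return) (f {x}) 1" for x
    using computes_Query[of f Return "{x}" "f {x}" 0] by (simp add: computes_Return)
  show "Inv j s' \<and> card (fst s) < card (fst s')"
    if "Inv j s" "x \<in> V" "j \<in> set (card_part k \<epsilon> (f {x}))" "\<delta> j s x = Some s'" for j s x s'
    by (rule step_facts[OF that(1,2,4)])
  show "\<delta> j s' y = None"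
    if "Inv j s" "x \<in> V" "j \<in> set (card_part k \<epsilon> (f {x}))" "\<delta> j s x = Some s'"
      "y \<in> V" "\<delta> j s y = None" for j s x s' y
    by (rule rejected_later[OF that(1,2,4,5,6)])
  show "card (fst s) \<le> k" if "Inv j s" for j s
    using that by (simp add: Inv_def)
qed (simp_all only: finite_V computes_stp Inv_init assms(1))

end

section \<open>Approximation ratio for a cardinality bound\<close>

locale cardinality_analysis = cardinality V f k \<epsilon> +
  dyn_analysis "\<lambda>x. Query {x} Return" "card_part k \<epsilon>" "card_stp k \<epsilon>" "({}, 0)"
    V f "\<lambda>x. f {x}" \<delta> Inv "\<lambda>j s. card (fst s)" k 1 1 m P
  for V :: "'v set" and f k \<epsilon> m P
begin

definition final :: "'v list \<Rightarrow> int \<Rightarrow> 'v set \<times> real" where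
  "final xs j = last (snd (canon (step_at j) (participants xs j) [({}, 0)]))"

lemma final_Inv: "Inv j (final xs j)"
  using scale.canon_history[OF history_init, of j "participants xs j"] scale.history_inv[of j]
  by (auto simp: final_def)

lemma final_subset: "fst (final xs j) \<subseteq> set (participants xs j)"
proof -
  have "fst (last (snd (canon (step_at j) (participants xs j) [({}, 0)]))) \<subseteq> {} \<union> set (participants xs j)"
    by (rule scale.canon_invariant[where J = "\<lambda>s X. fst s \<subseteq> X", OF history_init])
       (auto simp: step_at_def \<delta>_def split: if_splits)
  then show ?thesis by (simp add: final_def)
qed

text \<open>Once \<open>x\<close> is accepted its gain is 0, below the positive threshold, so the
  state it creates rejects it.\<close>

lemma final_rejects:
  assumes "x \<in> set (participants xs j)" "set xs \<subseteq> V"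
  shows "\<delta> j (final xs j) x = None"
proof -
  have "step_at j (final xs j) x = None"
    unfolding final_def
  proof (rule scale.canon_rejects[OF history_init assms(1)])
    fix s s' assume "step_at j s x = Some s'"
    then have "s' = (insert x (fst s), f (insert x (fst s)))"
      by (auto simp: step_at_def \<delta>_def split: if_splits)
    then show "step_at j s' x = None"
      using \<tau>_pos[of j] by (simp add: step_at_def \<delta>_def)
  qed
  then show ?thesis using assms by (auto simp: step_at_def participants_def split: if_splits)
qed

text \<open>The threshold \<open>g/(2k)\<close> balances two cases. A full set has collected
  \<open>k\<close> thresholds, that is \<open>g/2\<close>, and \<open>f X \<le> \<beta> * g\<close>
  gives the factor \<open>2 * \<beta> = 2 + \<epsilon>\<close>. Otherwise no element of
  \<open>X\<close> gains more than the threshold, so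
  \<open>f X \<le> f c + g/2 \<le> f c + f X / 2\<close>.\<close>

lemma guess_approx:
  assumes xs: "set xs \<subseteq> V" and X: "X \<subseteq> set xs" "card X \<le> k" "0 < f X"
  shows "\<exists>j. f X \<le> (2 + \<epsilon>) * f (fst (final xs j))"
proof -
  define j where "j = \<lfloor>log \<beta> (f X)\<rfloor>"
  define g where "g = card_guess \<epsilon> j"
  obtain c where c: "final xs j = (c, f c)" "c \<subseteq> V" "card c * \<tau> j \<le> f c" "card c \<le> k"
    using final_Inv[of j xs] by (cases "final xs j") (auto simp: Inv_def)
  have b: "\<beta> > 1" using \<epsilon> by simp
  have g1: "g \<le> f X"
    using b X by (simp add: g_def card_guess_def j_def powr_le_iff)
  have "f X = \<beta> powr log \<beta> (f X)" using b X by simp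
  also have "\<dots> \<le> \<beta> powr (of_int j + 1)" using b unfolding j_def by (intro powr_mono) linarith+
  also have "\<dots> = \<beta> * g" using b by (simp add: g_def card_guess_def powr_add)
  finally have g2: "f X \<le> \<beta> * g" .
  have kt: "real k * \<tau> j = g / 2" using k by (simp add: g_def)
  have "f X \<le> (2 + \<epsilon>) * f c"
  proof (cases "card c = k")
    case True
    then have "g / 2 \<le> f c" using c(3) kt by simp
    then have "2 * \<beta> * (g / 2) \<le> 2 * \<beta> * f c" using b by (intro mult_left_mono) auto
    then show ?thesis using g2 by (simp add: algebra_simps)
  next
    case False
    \<comment> \<open>An element of \<open>X\<close> outside the guess can only be too small, as its
      value is at most \<open>f X \<le> \<beta> * g\<close>. Then its singleton value, which bounds
      the gain, is already below the threshold.\<close>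
    have small: "f (insert x c) - f c \<le> \<tau> j" if x: "x \<in> X" for x
    proof (cases "\<tau> j \<le> f {x}")
      case True
      have "f {x} \<le> f X" using x X xs by (intro f_mono) auto
      then have "j \<in> set (card_part k \<epsilon> (f {x}))"
        using True g2 \<tau>_pos[of j] by (subst part_iff) (auto simp: g_def)
      then have "\<delta> j (final xs j) x = None"
        using x X xs by (intro final_rejects) (auto simp: participants_def)
      then show ?thesis using False c by (auto simp: \<delta>_def split: if_splits)
    next
      case False
      have "f (insert x c) - f c \<le> f {x}" using x X xs c by (intro f_insert_le) auto
      with False show ?thesis by simp
    qed
    have "f X \<le> f (c \<union> X)" using X xs c by (intro f_mono) auto
    also have "\<dots> \<le> f c + (\<Sum>x\<in>X. f (insert x c) - f c)"
      using X xs c by (intro f_union_le) auto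
    also have "(\<Sum>x\<in>X. f (insert x c) - f c) \<le> real (card X) * \<tau> j"
      using small by (rule sum_bounded_above)
    also have "\<dots> \<le> real k * \<tau> j" using X \<tau>_pos[of j] by (intro mult_right_mono) auto
    finally have "f X \<le> f c + g / 2" using kt by simp
    then have "f X \<le> 2 * f c" using g1 by simp
    also have "\<dots> \<le> (2 + \<epsilon>) * f c" using \<epsilon> f_nonneg[OF c(2)] by (intro mult_right_mono) auto
    finally show ?thesis .
  qed
  then show ?thesis using c by (auto intro!: exI[of _ j])
qed

lemma ex_best_guess: "\<exists>j. \<forall>i. snd (final xs i) \<le> snd (final xs j)"
proof -
  let ?J = "\<Union>x\<in>set xs. set (card_part k \<epsilon> (f {x}))"
  have "snd (final xs i) \<in> insert 0 ((\<lambda>i. snd (final xs i)) ` ?J)" for i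
  proof (cases "i \<in> ?J")
    case False
    then have "participants xs i = []" by (auto simp: participants_def filter_empty_conv)
    then show ?thesis by (simp add: final_def)
  qed auto
  then have "range (\<lambda>i. snd (final xs i)) \<subseteq> insert 0 ((\<lambda>i. snd (final xs i)) ` ?J)" by blast
  then have fin: "finite (range (\<lambda>i. snd (final xs i)))" by (rule finite_subset) simp
  then have "Max (range (\<lambda>i. snd (final xs i))) \<in> range (\<lambda>i. snd (final xs i))"
    by (intro Max_in) auto
  then obtain j where "Max (range (\<lambda>i. snd (final xs i))) = snd (final xs j)" by auto
  then show ?thesis using Max_ge[OF fin] by (intro exI[of _ j]) auto
qed

lemma out_approx:
  assumes xs: "set xs \<subseteq> V"
  shows "card_out (canonical xs) \<in> {X. X \<subseteq> V \<and> card X \<le> k} \<and> card_out (canonical xs) \<subseteq> set xs \<and>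
    opt {X. X \<subseteq> V \<and> card X \<le> k} f (set xs) \<le> (2 + \<epsilon>) * f (card_out (canonical xs))"
proof -
  define j where "j = (SOME j. \<forall>i. snd (final xs i) \<le> snd (final xs j))"
  have j: "snd (final xs i) \<le> snd (final xs j)" for i
    using someI_ex[OF ex_best_guess[of xs]] unfolding j_def by blast
  have out: "card_out (canonical xs) = fst (final xs j)"
    by (simp add: card_out_def canonical_def final_def j_def)
  let ?F = "{X \<in> {X. X \<subseteq> V \<and> card X \<le> k}. X \<subseteq> set xs}"
  have "finite ?F" by (rule finite_subset[of _ "Pow (set xs)"]) auto
  moreover have "{} \<in> ?F" by simp
  ultimately have "Max (f ` ?F) \<in> f ` ?F" by (intro Max_in) blast+
  then obtain X where X: "X \<subseteq> set xs" "card X \<le> k" "opt {X. X \<subseteq> V \<and> card X \<le> k} f (set xs) = f X"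
    by (auto simp: opt_def)
  have "f X \<le> (2 + \<epsilon>) * f (fst (final xs j))"
  proof (cases "0 < f X")
    case True
    then obtain i where i: "f X \<le> (2 + \<epsilon>) * f (fst (final xs i))"
      using guess_approx[OF xs X(1,2)] by blast
    also have "\<dots> \<le> (2 + \<epsilon>) * f (fst (final xs j))"
      using j[of i] final_Inv[of i xs] final_Inv[of j xs] \<epsilon> by (intro mult_left_mono) (auto simp: Inv_def)
    finally show ?thesis .
  next
    case False
    moreover have "0 \<le> f (fst (final xs j))"
      using final_Inv[of j xs] by (intro f_nonneg) (simp add: Inv_def)
    ultimately show ?thesis using \<epsilon> by (smt (verit) mult_nonneg_nonneg)
  qed
  then show ?thesis
    using X out final_subset[of xs j] final_Inv[of j xs]
    by (auto simp: participants_def Inv_def)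
qed

end

lemma lg_ge_1: "1 \<le> lg x" and lg_ge_log: "log 2 x \<le> lg x"
  by (simp_all add: lg_def)

context cardinality
begin

text \<open>With \<open>l = lg k\<close>, the guesses contribute \<open>10 * l / \<epsilon>\<close>,
  the search \<open>4 * l\<close> and the chain \<open>2 * k\<close>; the constants multiply to 80,
  and the singleton query makes it 81.\<close>

lemma query_bound:
  assumes "real m \<le> log 2 (real (k + 1)) + 1" "real P \<le> log \<beta> (2 * real k) + 2"
  shows "real (1 + P * ((m + 1) * 1 * (k + 1))) \<le> 81 * (real k * (1 / \<epsilon>) * lg (real k) ^ 2)"
proof -
  let ?l = "lg (real k)"
  have l: "1 \<le> ?l" "log 2 (real k) \<le> ?l" by (rule lg_ge_1 lg_ge_log)+
  have e: "1 \<le> 1 / \<epsilon>" using \<epsilon> by simp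
  have "log 2 (real (k + 1)) \<le> log 2 (2 * real k)" using k by simp
  also have "\<dots> = 1 + log 2 (real k)" using k by (simp add: log_mult)
  finally have m: "real m + 1 \<le> 4 * ?l" using assms(1) l by linarith
  \<comment> \<open>Prepares \<open>ln (1 + x) \<ge> x - x^2\<close> at
    \<open>x = \<epsilon>/2\<close>, which turns the base \<open>\<beta>\<close> of the guesses into
    the factor \<open>1/\<epsilon>\<close>.\<close>
  have "\<epsilon> / 4 \<le> \<epsilon> / 2 - (\<epsilon> / 2)\<^sup>2"
    using \<epsilon> mult_left_mono[of \<epsilon> 1 \<epsilon>] by (simp add: power2_eq_square field_simps)
  also have "\<dots> \<le> ln \<beta>" using \<epsilon> by (intro ln_one_plus_pos_lower_bound) auto
  finally have lnb: "\<epsilon> / 4 \<le> ln \<beta>" .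
  have "ln (2 * real k) = ln 2 * log 2 (2 * real k)" using k by (simp add: log_def)
  also have "\<dots> \<le> 1 * log 2 (2 * real k)"
    using k ln_2_less_1 by (intro mult_right_mono) auto
  also have "\<dots> \<le> 2 * ?l" using l k by (simp add: log_mult)
  finally have ln2k: "ln (2 * real k) \<le> 2 * ?l" .
  have "log \<beta> (2 * real k) = ln (2 * real k) / ln \<beta>" by (simp add: log_def)
  also have "\<dots> \<le> (2 * ?l) / (\<epsilon> / 4)"
    using ln2k lnb k \<epsilon> l by (intro frac_le) auto
  finally have "log \<beta> (2 * real k) \<le> 8 * ?l * (1 / \<epsilon>)" by simp
  moreover have "1 \<le> ?l * (1 / \<epsilon>)" using mult_mono[OF l(1) e] l by simp
  ultimately have P: "real P \<le> 10 * (?l * (1 / \<epsilon>))" using assms(2) by simp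
  have k2: "real k + 1 \<le> 2 * real k" using k by simp
  have "real P * ((real m + 1) * (real k + 1)) \<le> 10 * (?l * (1 / \<epsilon>)) * ((4 * ?l) * (2 * real k))"
    using P m k2 l by (intro mult_mono) auto
  also have "\<dots> = 80 * (real k * (1 / \<epsilon>) * ?l ^ 2)" by (simp add: power2_eq_square)
  finally have "real P * ((real m + 1) * (real k + 1)) \<le> 80 * (real k * (1 / \<epsilon>) * ?l ^ 2)" .
  moreover have "1 \<le> real k * (1 / \<epsilon>) * ?l ^ 2"
  proof -
    have "1 * 1 * 1 \<le> real k * (1 / \<epsilon>) * ?l ^ 2"
      using k e l \<epsilon> by (intro mult_mono) auto
    then show ?thesis by simp
  qed
  moreover have "real (1 + P * ((m + 1) * 1 * (k + 1))) = 1 + real P * ((real m + 1) * (real k + 1))"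
    by (simp add: algebra_simps)
  ultimately show ?thesis by linarith
qed

lemma card_alg_correct:
  assumes us: "\<forall>u\<in>set us. elem u \<in> V"
  shows "maintains_approx f (card_alg k \<epsilon>) us {X. X \<subseteq> V \<and> card X \<le> k} f (2 + \<epsilon>) \<and>
    worst_case_expected_queries_le f (card_alg k \<epsilon>) us (81 * (real k * (1 / \<epsilon>) * lg (real k) ^ 2))"
proof -
  obtain m where m: "real (k + 1) < 2 ^ m" "real m \<le> log 2 (real (k + 1)) + 1"
    using ex_log2_height[of "real (k + 1)"] by auto
  have m': "k + 1 < 2 ^ m" using m(1) by (metis of_nat_less_iff of_nat_numeral of_nat_power)
  define P where "P = nat \<lfloor>log \<beta> (2 * real k) + 2\<rfloor>"
  have "0 \<le> log \<beta> (2 * real k)" using k \<epsilon> by simp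
  then have P: "log \<beta> (2 * real k) + 2 < real P + 1" "real P \<le> log \<beta> (2 * real k) + 2"
    unfolding P_def by linarith+
  interpret cardinality_analysis V f k \<epsilon> m P
    unfolding cardinality_analysis_def by (intro conjI analysis m' P cardinality_axioms)
  have alg: "card_alg k \<epsilon> = unfold_alg card_out update_step init_state"
    using k by (simp add: card_alg_def)
  show ?thesis
    unfolding alg
    by (intro conjI maintains_approxI[OF us] expected_queries[OF us] query_bound m P out_approx)
qed

end

theorem card_alg:
  assumes "finite V" "normalized_monotone_submodular V f" "0 < \<epsilon>" "\<epsilon> \<le> 1" "\<forall>u\<in>set us. elem u \<in> V"
  shows "maintains_approx f (card_alg k \<epsilon>) us {X. X \<subseteq> V \<and> card X \<le> k} f (2 + \<epsilon>) \<and>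
    worst_case_expected_queries_le f (card_alg k \<epsilon>) us (81 * (real k * (1 / \<epsilon>) * lg (real k) ^ 2))"
proof (cases "k = 0")
  case True
  have F: "{X \<in> {X. X \<subseteq> V \<and> card X \<le> 0}. X \<subseteq> W} = {{}}" for W
    using assms(1) by (auto dest: finite_subset)
  have f0: "f {} = 0" using assms(2) by (simp add: normalized_monotone_submodular_def)
  show ?thesis
    unfolding card_alg_def True if_P[OF refl] by (rule idle_alg, rule F, rule f0)
next
  case False
  then interpret cardinality V f k \<epsilon>
    using assms by unfold_locales auto
  show ?thesis by (rule card_alg_correct[OF assms(5)])
qed

section \<open>Matroid constraint\<close>

text \<open>A layer-cake comparison, proved by pairing the largest \<open>a x\<close> with some
  \<open>b y \<ge> a x\<close>. Removing both keeps the hypothesis: up to level \<open>a x\<close>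
  both counts drop by one, and above it the left set is empty.\<close>

lemma sum_le_of_card_superlevel_le:
  fixes a :: "'a \<Rightarrow> real" and b :: "'b \<Rightarrow> real"
  assumes "finite X" "finite Y" "\<And>y. y \<in> Y \<Longrightarrow> 0 \<le> b y"
    and "\<And>\<theta>. 0 < \<theta> \<Longrightarrow> card {x \<in> X. \<theta> \<le> a x} \<le> card {y \<in> Y. \<theta> \<le> b y}"
  shows "sum a X \<le> sum b Y"
  using assms
proof (induction "card X" arbitrary: X Y)
  case 0
  then show ?case by (simp add: sum_nonneg)
next
  case (Suc n)
  then have "a ` X \<noteq> {}" "finite (a ` X)" by auto
  then have "Max (a ` X) \<in> a ` X" by (intro Max_in)
  then obtain x where x: "x \<in> X" "Max (a ` X) = a x" by auto
  have ax: "a z \<le> a x" if "z \<in> X" for z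
    using that Suc.prems(1) unfolding x(2)[symmetric] by (intro Max_ge) auto
  show ?case
  proof (cases "a x \<le> 0")
    case True
    then have "sum a X \<le> 0" using ax by (intro sum_nonpos) (meson order_trans)
    also have "0 \<le> sum b Y" using Suc.prems by (intro sum_nonneg) auto
    finally show ?thesis .
  next
    case False
    then have "card {z \<in> X. a x \<le> a z} \<le> card {y \<in> Y. a x \<le> b y}"
      using Suc.prems(4) by simp
    moreover have "0 < card {z \<in> X. a x \<le> a z}"
      using x Suc.prems(1) by (auto simp: card_gt_0_iff)
    ultimately have "{y \<in> Y. a x \<le> b y} \<noteq> {}" by (metis card.empty less_le_not_le)
    then obtain y where y: "y \<in> Y" "a x \<le> b y" by blast
    have "sum a (X - {x}) \<le> sum b (Y - {y})"
    proof (rule Suc.hyps(1))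
      fix \<theta> :: real assume t: "0 < \<theta>"
      show "card {z \<in> X - {x}. \<theta> \<le> a z} \<le> card {z \<in> Y - {y}. \<theta> \<le> b z}"
      proof (cases "\<theta> \<le> a x")
        case True
        have "{z \<in> X - {x}. \<theta> \<le> a z} = {z \<in> X. \<theta> \<le> a z} - {x}"
          "{z \<in> Y - {y}. \<theta> \<le> b z} = {z \<in> Y. \<theta> \<le> b z} - {y}" by auto
        moreover have "card ({z \<in> X. \<theta> \<le> a z} - {x}) = card {z \<in> X. \<theta> \<le> a z} - 1"
          "card ({z \<in> Y. \<theta> \<le> b z} - {y}) = card {z \<in> Y. \<theta> \<le> b z} - 1"
          using True x y by (auto intro!: card_Diff_singleton)
        ultimately show ?thesis using Suc.prems(4)[OF t] by simp
      next
        case False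
        then have "{z \<in> X - {x}. \<theta> \<le> a z} = {}" using ax by fastforce
        then show ?thesis by (simp only: card.empty le0)
      qed
    qed (use Suc x y in auto)
    moreover have "sum a X = a x + sum a (X - {x})" "sum b Y = b y + sum b (Y - {y})"
      using Suc.prems x y by (auto intro: sum.remove)
    ultimately show ?thesis using y by simp
  qed
qed

definition mat_threshold :: "nat \<Rightarrow> real \<Rightarrow> int \<Rightarrow> real" where
  "mat_threshold k \<epsilon> j = \<epsilon> * 2 powr of_int j / (10 * real k)"

text \<open>
  The guess \<open>j\<close> stands for a maximal singleton value between \<open>2^(j-1)\<close> and \<open>2^j\<close>.  Discarding gains below
  the threshold costs \<open>k\<close> thresholds, that is, at most \<open>\<epsilon>/5\<close> of the optimum.
\<close>

definition mat_part :: "nat \<Rightarrow> real \<Rightarrow> real \<Rightarrow> int list" where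
  "mat_part k \<epsilon> a = (if a > 0 then [\<lceil>log 2 a\<rceil>..\<lfloor>log 2 (10 * real k / \<epsilon> * a)\<rfloor>] else [])"

text \<open>A loop, an element dependent by itself, gets the value 0 and thereby takes part in no
  guess.\<close>

definition mat_sing :: "'v \<Rightarrow> ('v set + 'v set, real + bool, real) prog" where
  "mat_sing x = Query (Inl {x}) (\<lambda>a. Query (Inr {x}) (\<lambda>b. Return (if projr b then projl a else 0)))"

text \<open>
  A state consists of the current independent set as a list of weighted elements in the order of
  decreasing weight, the set of all elements accepted so far, and the value of that set.  If \<open>i\<close> is
  the least length of a prefix that is dependent together with \<open>x\<close> (one more than the length of the
  list if there is none), the last element of this prefix is the lightest one on the circuit.
\<close>

type_synonym 'v mat_state = "('v \<times> real) list \<times> 'v set \<times> real"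

text \<open>Index 0 means that \<open>x\<close> is a loop. The factor 2 in the replacement rule both
  limits the number of replacements and keeps the total value of all accepted elements within twice
  the retained weight.\<close>

definition exchange_at ::
  "'v mat_state \<Rightarrow> 'v \<Rightarrow> real \<Rightarrow> nat \<Rightarrow> 'v mat_state option" where
  "exchange_at s x a i =
     (let L = fst s; A = fst (snd s); w = a - snd (snd s) in
      if length L < i then Some (insort_key (\<lambda>p. - snd p) (x, w) L, insert x A, a)
      else if i \<noteq> 0 \<and> 2 * snd (L ! (i - 1)) \<le> w
        then Some (insort_key (\<lambda>p. - snd p) (x, w) (take (i - 1) L @ drop i L), insert x A, a)
      else None)"

text \<open>Dependence of \<open>x\<close> on a prefix is monotone in the prefix, so binary search
  replaces one independence query per element by logarithmically many. The range ends at the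
  successor of the length so that the full list is tested too.\<close>

definition mat_stp ::
  "nat \<Rightarrow> real \<Rightarrow> int \<Rightarrow> 'v mat_state \<Rightarrow> 'v \<Rightarrow>
     ('v set + 'v set, real + bool, 'v mat_state option) prog" where
  "mat_stp k \<epsilon> j s x =
     Query (Inl (insert x (fst (snd s)))) (\<lambda>a.
       if projl a - snd (snd s) < mat_threshold k \<epsilon> j then Return None
       else pbind (bsearch (\<lambda>i. Query (Inr (insert x (fst ` set (take i (fst s))))) (\<lambda>b. Return (\<not> projr b)))
                     0 (Suc (length (fst s))))
              (\<lambda>i. Return (exchange_at s x (projl a) i)))"

text \<open>The cached singleton values determine the right guess, so solutions need not be
  compared; \<open>insert 0\<close> covers the empty live set.\<close>

definition mat_out :: "('v, 'v mat_state) dyn_state \<Rightarrow> 'v set" where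
  "mat_out S = (let M = Max (insert 0 (fst (snd S) ` set (fst S))) in
     if M > 0 then fst ` set (fst (last (snd (snd (snd S) \<lceil>log 2 M\<rceil>)))) else {})"

definition mat_alg :: "nat \<Rightarrow> real \<Rightarrow> ('v update, 'v set + 'v set, real + bool, 'v set) alg" where
  "mat_alg k \<epsilon> = (if k = 0 then idle_alg else
     unfold_alg mat_out
       (dyn_alg.update_step mat_sing (mat_part k \<epsilon>) (mat_stp k \<epsilon>) ([], {}, 0))
       (dyn_alg.init_state ([], {}, 0)))"

section \<open>Independence and exchange in matroids\<close>

locale matroid_on =
  fixes V :: "'v set" and \<I> :: "'v set set"
  assumes matroid: "matroid V \<I>"
begin

lemma indep_finite: "X \<in> \<I> \<Longrightarrow> finite X"
  using matroid by (auto simp: matroid_def dest: finite_subset)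

lemma indep_subset: "X \<in> \<I> \<Longrightarrow> Y \<subseteq> X \<Longrightarrow> Y \<in> \<I>"
  using matroid by (auto simp: matroid_def)

lemma dep_superset: "X \<notin> \<I> \<Longrightarrow> X \<subseteq> Y \<Longrightarrow> Y \<notin> \<I>"
  using indep_subset by blast

lemma indep_empty: "{} \<in> \<I>"
  using matroid by (simp add: matroid_def)

lemma augment: "X \<in> \<I> \<Longrightarrow> Y \<in> \<I> \<Longrightarrow> card X < card Y \<Longrightarrow> \<exists>z\<in>Y - X. insert z X \<in> \<I>"
  using matroid by (auto simp: matroid_def)

lemma finite_indep: "finite \<I>"
  using matroid by (auto simp: matroid_def intro: finite_subset[of _ "Pow V"])

lemma card_le_rank: "X \<in> \<I> \<Longrightarrow> card X \<le> matroid_rank \<I>"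
  unfolding matroid_rank_def using finite_indep by (intro Max_ge) auto

lemma extend_indep:
  assumes "X \<in> \<I>" "Y \<in> \<I>" "card X \<le> card Y"
  shows "\<exists>Z\<in>\<I>. X \<subseteq> Z \<and> Z \<subseteq> X \<union> Y \<and> card Z = card Y"
  using assms(1,3)
proof (induction "card Y - card X" arbitrary: X)
  case 0
  then show ?case by (intro bexI[of _ X]) auto
next
  case (Suc n)
  then have "card X < card Y" by simp
  then obtain z where z: "z \<in> Y - X" "insert z X \<in> \<I>"
    using augment[OF Suc.prems(1) assms(2)] by blast
  have "card (insert z X) = Suc (card X)" using z indep_finite[OF Suc.prems(1)] by simp
  then have c: "n = card Y - card (insert z X)" "card (insert z X) \<le> card Y"
    using Suc.hyps(2) by simp_all
  obtain Z where "Z \<in> \<I>" "insert z X \<subseteq> Z" "Z \<subseteq> insert z X \<union> Y" "card Z = card Y"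
    using Suc.hyps(1)[OF c(1) z(2) c(2)] by blast
  then show ?case using z by (intro bexI[of _ Z]) auto
qed

text \<open>Extend \<open>insert x P\<close> inside \<open>I\<close> to the size of
  \<open>I\<close>. The result avoids \<open>y\<close>, because \<open>x\<close> and
  \<open>y\<close> together with \<open>P\<close> are dependent, so by counting it is all of
  \<open>insert x (I - {y})\<close>.\<close>

lemma exchange_indep:
  assumes "I \<in> \<I>" "P \<subseteq> I" "y \<in> I" "x \<notin> I" "insert x P \<in> \<I>" "insert x (insert y P) \<notin> \<I>"
  shows "insert x (I - {y}) \<in> \<I>"
proof -
  have fin: "finite I" by (rule indep_finite[OF assms(1)])
  have "y \<notin> P" using assms(5,6) by (auto simp: insert_absorb)
  then have "P \<subset> I" using assms by auto
  then have "card P < card I" by (rule psubset_card_mono[OF fin])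
  then have "card (insert x P) \<le> card I"
    using finite_subset[OF assms(2) fin] by (simp add: card_insert_if)
  then obtain Z where Z: "Z \<in> \<I>" "insert x P \<subseteq> Z" "Z \<subseteq> insert x P \<union> I" "card Z = card I"
    using extend_indep[OF assms(5,1)] by blast
  have "y \<notin> Z"
  proof
    assume "y \<in> Z"
    then have "insert x (insert y P) \<subseteq> Z" using Z by auto
    then show False using assms(6) Z(1) indep_subset by blast
  qed
  then have "Z \<subseteq> insert x (I - {y})" using Z assms(2) by auto
  moreover have "card (insert x (I - {y})) = card Z"
    using fin assms(3,4) Z(4) by (simp add: card_Suc_Diff1 del: card_Diff_insert)
  ultimately have "Z = insert x (I - {y})" using fin by (intro card_subset_eq) auto
  then show ?thesis using Z(1) by simp
qed

text \<open>
  The span of the elements of large weight never shrinks: an element that depends on \<open>H\<close> still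
  depends on it after an exchange along a circuit contained in \<open>H + x\<close>.
\<close>

lemma exchange_dep:
  assumes "H \<in> \<I>" "y \<in> H" "x \<notin> H" "insert x H \<notin> \<I>" "insert z H \<notin> \<I>" "z \<noteq> x"
  shows "insert z (insert x (H - {y})) \<notin> \<I>"
proof
  assume J: "insert z (insert x (H - {y})) \<in> \<I>"
  have fin: "finite H" by (rule indep_finite[OF assms(1)])
  have z: "z \<notin> H" using assms(1,5) by (auto simp: insert_absorb)
  \<comment> \<open>This set has one element more than \<open>H\<close>, so \<open>H\<close> could
    be augmented from it; but only \<open>x\<close> and \<open>z\<close> are available, and both
    depend on \<open>H\<close>.\<close>
  have "card (insert z (insert x (H - {y}))) = Suc (Suc (card (H - {y})))"
    using fin z assms(3,6) by simp
  also have "\<dots> = Suc (card H)" using fin assms(2) by (simp add: card_Suc_Diff1 del: card_Diff_insert)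
  finally obtain u where "u \<in> insert z (insert x (H - {y})) - H" "insert u H \<in> \<I>"
    using augment[OF assms(1) J] by auto
  then show False using assms(4,5) by auto
qed

definition dep_pos :: "('v \<times> real) list \<Rightarrow> 'v \<Rightarrow> nat" where
  "dep_pos L x = (LEAST i. length L < i \<or> insert x (fst ` set (take i L)) \<notin> \<I>)"

lemma dep_pos:
  "dep_pos L x \<le> Suc (length L)"
  "dep_pos L x \<le> length L \<Longrightarrow> insert x (fst ` set (take (dep_pos L x) L)) \<notin> \<I>"
  "i < dep_pos L x \<Longrightarrow> insert x (fst ` set (take i L)) \<in> \<I>"
proof -
  show "dep_pos L x \<le> Suc (length L)" unfolding dep_pos_def by (rule Least_le) simp
  have "length L < dep_pos L x \<or> insert x (fst ` set (take (dep_pos L x) L)) \<notin> \<I>"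
    unfolding dep_pos_def by (rule LeastI[of _ "Suc (length L)"]) simp
  then show "dep_pos L x \<le> length L \<Longrightarrow> insert x (fst ` set (take (dep_pos L x) L)) \<notin> \<I>" by simp
  show "i < dep_pos L x \<Longrightarrow> insert x (fst ` set (take i L)) \<in> \<I>"
    unfolding dep_pos_def using not_less_Least by blast
qed

end

section \<open>The swapping pass for one guess\<close>

locale matroid_submodular = submodular_fun V f + matroid_on V \<I>
  for V :: "'v set" and f and \<I> +
  fixes k :: nat and \<epsilon> :: real
  assumes k: "0 < k" and rank: "matroid_rank \<I> = k" and \<epsilon>: "0 < \<epsilon>" "\<epsilon> \<le> 1"
begin

abbreviation "\<tau> \<equiv> mat_threshold k \<epsilon>"
abbreviation "orc \<equiv> matroid_oracle f \<I>"
abbreviation "gain s x \<equiv> f (insert x (fst (snd s))) - snd (snd s)"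
abbreviation "heavier s c \<equiv> fst ` {p \<in> set (fst s). c < snd p}"

definition info :: "'v \<Rightarrow> real" where
  "info x = (if {x} \<in> \<I> then f {x} else 0)"

definition \<delta> :: "int \<Rightarrow> 'v mat_state \<Rightarrow> 'v \<Rightarrow> 'v mat_state option" where
  "\<delta> j s x = (if gain s x < \<tau> j then None
     else exchange_at s x (f (insert x (fst (snd s)))) (dep_pos (fst s) x))"

text \<open>Weights are gains over all elements accepted before, so a part of the solution is worth
  at least its weights; this is kept for all subsets because swaps remove arbitrary elements. The
  last clause says that discarded elements never outweigh the kept ones.\<close>

definition Inv :: "int \<Rightarrow> 'v mat_state \<Rightarrow> bool" where
  "Inv j s \<longleftrightarrow> fst (snd s) \<subseteq> V \<and> snd (snd s) = f (fst (snd s)) \<and>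
     sorted (map (\<lambda>p. - snd p) (fst s)) \<and> distinct (map fst (fst s)) \<and>
     fst ` set (fst s) \<subseteq> fst (snd s) \<and> fst ` set (fst s) \<in> \<I> \<and>
     (\<forall>p\<in>set (fst s). \<tau> j \<le> snd p \<and> snd p \<le> 2 powr of_int j) \<and>
     (\<forall>N\<subseteq>set (fst s). (\<Sum>p\<in>N. snd p) \<le> f (fst ` N)) \<and>
     f (fst (snd s)) \<le> 2 * (\<Sum>p\<in>set (fst s). snd p)"

text \<open>Weight classes by powers of 2 above the threshold, counted from 1. An addition
  contributes a positive level and a swap at least doubles a weight, so the sum of levels is the
  increasing potential of the chain.\<close>

definition level :: "int \<Rightarrow> real \<Rightarrow> nat" where
  "level j w = Suc (nat \<lfloor>log 2 (w / \<tau> j)\<rfloor>)"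

definition \<mu> :: "int \<Rightarrow> 'v mat_state \<Rightarrow> nat" where
  "\<mu> j s = (\<Sum>p\<in>set (fst s). level j (snd p))"

lemma \<tau>_pos: "0 < \<tau> j"
  using \<epsilon> k by (simp add: mat_threshold_def)

lemma part_iff:
  assumes "a > 0"
  shows "j \<in> set (mat_part k \<epsilon> a) \<longleftrightarrow> \<tau> j \<le> a \<and> a \<le> 2 powr of_int j"
proof -
  have pos: "0 < 10 * real k / \<epsilon> * a" using assms k \<epsilon> by simp
  have "j \<le> \<lfloor>log 2 (10 * real k / \<epsilon> * a)\<rfloor> \<longleftrightarrow> 2 powr j \<le> 10 * real k / \<epsilon> * a"
    using pos by (simp only: le_floor_iff) (subst le_log_iff, auto)
  also have "\<dots> \<longleftrightarrow> \<tau> j \<le> a"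
    using k \<epsilon> by (simp add: mat_threshold_def field_simps)
  finally have 1: "j \<le> \<lfloor>log 2 (10 * real k / \<epsilon> * a)\<rfloor> \<longleftrightarrow> \<tau> j \<le> a" .
  have "\<lceil>log 2 a\<rceil> \<le> j \<longleftrightarrow> a \<le> 2 powr j"
    using assms by (simp only: ceiling_le_iff) (subst log_le_iff, auto)
  then show ?thesis using 1 assms by (auto simp: mat_part_def)
qed

lemma length_part: "real (length (mat_part k \<epsilon> a)) \<le> log 2 (10 * real k / \<epsilon>) + 1"
proof -
  have "1 * 1 \<le> (10 * real k) * (1 / \<epsilon>)" using k \<epsilon> by (intro mult_mono) auto
  then have pos: "1 \<le> 10 * real k / \<epsilon>" by simp
  then have nonneg: "0 \<le> log 2 (10 * real k / \<epsilon>)" by simp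
  show ?thesis
  proof (cases "a > 0")
    case True
    have "log 2 (10 * real k / \<epsilon> * a) = log 2 (10 * real k / \<epsilon>) + log 2 a"
      using pos True by (intro log_mult_pos) auto
    moreover have "real (nat i) \<le> max 0 (real_of_int i)" for i by simp
    ultimately show ?thesis
      using True nonneg unfolding mat_part_def by (simp add: max_def) linarith
  qed (use nonneg in \<open>simp add: mat_part_def\<close>)
qed

lemma prefix_heavier:
  fixes L :: "('v \<times> real) list"
  assumes "sorted (map (\<lambda>p. - snd p) L)"
  shows "\<exists>n\<le>length L. set (take n L) = {p \<in> set L. c < snd p}"
proof -
  let ?n = "length (takeWhile (\<lambda>p. c < snd p) L)"
  have t: "take ?n L = takeWhile (\<lambda>p. c < snd p) L" by (rule takeWhile_eq_take[symmetric])
  have "c < snd p \<Longrightarrow> p \<in> set (takeWhile (\<lambda>p. c < snd p) L)" if "p \<in> set L" for p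
    using assms that
  proof (induction L)
    case (Cons a L)
    then have "p = a \<or> (p \<in> set L \<and> snd p \<le> snd a)" by auto
    then show ?case using Cons by auto
  qed simp
  then have "set (takeWhile (\<lambda>p. c < snd p) L) = {p \<in> set L. c < snd p}"
    by (auto dest: set_takeWhileD)
  then show ?thesis using t by (intro exI[of _ ?n]) (auto simp: length_takeWhile_le)
qed

text \<open>Translates list positions into matroid terms: the prefix before \<open>p\<close> is
  independent with \<open>x\<close> and adding \<open>p\<close> makes it dependent, so
  \<open>p\<close> lies on the circuit of \<open>x\<close> and is a lightest element there apart
  from \<open>x\<close>.\<close>

lemma accept_cases:
  assumes "Inv j s" "\<delta> j s x = Some s'"
  obtains
    (add) "\<tau> j \<le> gain s x" "x \<notin> fst (snd s)" "insert x (fst ` set (fst s)) \<in> \<I>"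
      "set (fst s') = insert (x, gain s x) (set (fst s))"
      "snd s' = (insert x (fst (snd s)), f (insert x (fst (snd s))))"
      "sorted (map (\<lambda>p. - snd p) (fst s'))" "distinct (map fst (fst s'))"
  | (swap) p where "\<tau> j \<le> gain s x" "x \<notin> fst (snd s)" "p \<in> set (fst s)" "2 * snd p \<le> gain s x"
      "insert x (fst ` {q \<in> set (fst s). snd p \<le> snd q}) \<notin> \<I>"
      "insert x (fst ` set (fst s) - {fst p}) \<in> \<I>"
      "set (fst s') = insert (x, gain s x) (set (fst s) - {p})"
      "snd s' = (insert x (fst (snd s)), f (insert x (fst (snd s))))"
      "sorted (map (\<lambda>p. - snd p) (fst s'))" "distinct (map fst (fst s'))"
proof -
  obtain L A v where s: "s = (L, A, v)" by (cases s)
  have inv: "A \<subseteq> V" "v = f A" "sorted (map (\<lambda>p. - snd p) L)" "distinct (map fst L)"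
    "fst ` set L \<subseteq> A" "fst ` set L \<in> \<I>"
    using assms(1) by (simp_all add: Inv_def s)
  define w where "w = f (insert x A) - v"
  define i where "i = dep_pos L x"
  have w: "\<tau> j \<le> w" "exchange_at s x (f (insert x A)) i = Some s'"
    using assms(2) by (auto simp: \<delta>_def s w_def i_def split: if_splits)
  have x: "x \<notin> A" using w(1) \<tau>_pos[of j] inv(2) by (auto simp: w_def insert_absorb)
  have i: "i \<le> Suc (length L)" "i \<le> length L \<Longrightarrow> insert x (fst ` set (take i L)) \<notin> \<I>"
    "\<And>l. l < i \<Longrightarrow> insert x (fst ` set (take l L)) \<in> \<I>"
    using dep_pos[where L = L and x = x] by (auto simp: i_def)
  show thesis
  proof (cases "length L < i")
    case True
    then have s': "s' = (insort_key (\<lambda>p. - snd p) (x, w) L, insert x A, f (insert x A))"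
      using w(2) by (simp add: exchange_at_def s w_def)
    have "mset (map fst (fst s')) = mset (x # map fst L)" by (simp add: s' mset_insort)
    then have "distinct (map fst (fst s'))"
      using inv(4,5) x by (metis distinct.simps(2) image_set mset_eq_imp_distinct_iff subsetD)
    then show thesis
      using add i(3)[of "length L"] True w(1) x inv(3)
      by (simp add: s s' w_def set_insort_key sorted_insort_key)
  next
    case False
    then have i': "i \<noteq> 0" "2 * snd (L ! (i - 1)) \<le> w"
      "s' = (insort_key (\<lambda>p. - snd p) (x, w) (take (i - 1) L @ drop i L), insert x A, f (insert x A))"
      using w(2) by (auto simp: exchange_at_def s w_def Let_def split: if_splits)
    define p where "p = L ! (i - 1)"
    define P where "P = take (i - 1) L"
    define Q where "Q = drop i L"
    have il: "i - 1 < length L" "Suc (i - 1) = i" using False i'(1) by auto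
    have L: "L = P @ p # Q" using id_take_nth_drop[OF il(1)] il(2) by (simp add: P_def Q_def p_def)
    have ti: "take i L = P @ [p]"
      using take_Suc_conv_app_nth[OF il(1)] il(2) by (simp add: P_def p_def)
    have dist: "distinct (map fst (P @ p # Q))" using inv(4) L by simp
    have srt: "sorted (map (\<lambda>p. - snd p) (P @ p # Q))" using inv(3) L by simp
    have setPQ: "set (P @ Q) = set L - {p}" using dist unfolding L by auto
    have "mset (map fst (fst s')) = mset (x # map fst (P @ Q))"
      by (simp add: i'(3) mset_insort P_def Q_def)
    moreover have "distinct (x # map fst (P @ Q))"
      using dist x inv(5) unfolding L by auto
    ultimately have d': "distinct (map fst (fst s'))" by (metis mset_eq_imp_distinct_iff)
    have Pp: "insert x (fst ` set P) \<in> \<I>" using i(3)[of "i - 1"] i'(1) by (simp add: P_def)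
    have Pd: "insert x (insert (fst p) (fst ` set P)) \<notin> \<I>"
      using i(2) False ti by simp
    have "insert x (fst ` set L - {fst p}) \<in> \<I>"
    proof (rule exchange_indep[OF inv(6) _ _ _ Pp Pd])
      show "fst ` set P \<subseteq> fst ` set L" "fst p \<in> fst ` set L" unfolding L by auto
      show "x \<notin> fst ` set L" using x inv(5) by blast
    qed
    moreover have "insert x (fst ` {q \<in> set L. snd p \<le> snd q}) \<notin> \<I>"
    proof (rule dep_superset[OF Pd])
      have "\<forall>q\<in>set P. snd p \<le> snd q" using srt by (auto simp: sorted_append)
      then show "insert x (insert (fst p) (fst ` set P)) \<subseteq> insert x (fst ` {q \<in> set L. snd p \<le> snd q})"
        unfolding L by auto
    qed
    moreover have "sorted (map (\<lambda>p. - snd p) (fst s'))"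
      using srt unfolding i'(3) P_def[symmetric] Q_def[symmetric]
      by (simp add: sorted_insort_key sorted_append)
    moreover have "set (fst s') = insert (x, w) (set L - {p})"
      using setPQ unfolding i'(3) P_def[symmetric] Q_def[symmetric] by (simp add: set_insort_key)
    moreover have "p \<in> set L" unfolding L by simp
    moreover have "2 * snd p \<le> w" using i'(2) by (simp add: p_def)
    moreover have "snd s' = (insert x A, f (insert x A))" by (simp add: i'(3))
    ultimately show thesis
      using swap[of p] w(1) x d' by (simp add: s w_def)
  qed
qed

text \<open>Eliminates the search index from the rejection test. By sortedness the elements heavier
  than half the gain form a prefix, and the lightest element on the circuit belongs to it exactly if
  that prefix together with \<open>x\<close> is dependent. Persistence is provable in this
  form.\<close>

lemma reject_iff:
  assumes "Inv j s"
  shows "\<delta> j s x = None \<longleftrightarrow> gain s x < \<tau> j \<or> insert x (heavier s (gain s x / 2)) \<notin> \<I>"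
proof (cases "gain s x < \<tau> j")
  case True
  then show ?thesis by (simp add: \<delta>_def)
next
  case False
  obtain L A v where s: "s = (L, A, v)" by (cases s)
  have srt: "sorted (map (\<lambda>p. - snd p) L)" using assms by (simp add: Inv_def s)
  define w where "w = f (insert x A) - v"
  define i where "i = dep_pos L x"
  have i: "i \<le> Suc (length L)" "i \<le> length L \<Longrightarrow> insert x (fst ` set (take i L)) \<notin> \<I>"
    "\<And>l. l < i \<Longrightarrow> insert x (fst ` set (take l L)) \<in> \<I>"
    using dep_pos[where L = L and x = x] by (auto simp: i_def)
  have d: "\<delta> j s x = None \<longleftrightarrow> i \<le> length L \<and> (i = 0 \<or> w < 2 * snd (L ! (i - 1)))"
    using False by (auto simp: \<delta>_def exchange_at_def s w_def i_def Let_def)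
  obtain n where n: "n \<le> length L" "set (take n L) = {p \<in> set L. w / 2 < snd p}"
    using prefix_heavier[OF srt] by blast
  have H: "heavier s (gain s x / 2) = fst ` set (take n L)" by (simp add: n(2) s w_def)
  have "i \<le> length L \<and> (i = 0 \<or> w < 2 * snd (L ! (i - 1))) \<longleftrightarrow> insert x (fst ` set (take n L)) \<notin> \<I>"
  proof
    assume a: "i \<le> length L \<and> (i = 0 \<or> w < 2 * snd (L ! (i - 1)))"
    have "set (take i L) \<subseteq> set (take n L)"
    proof (cases "i = 0")
      case False
      then have wi: "w < 2 * snd (L ! (i - 1))" "i - 1 < length L" using a by auto
      have "q \<in> {p \<in> set L. w / 2 < snd p}" if "q \<in> set (take i L)" for q
      proof -
        obtain l where l: "l < i" "q = L ! l" using \<open>q \<in> set (take i L)\<close> by (auto simp: in_set_conv_nth)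
        then have "- snd (L ! l) \<le> - snd (L ! (i - 1))"
          using sorted_nth_mono[OF srt, of l "i - 1"] wi(2) by simp
        then show ?thesis using l wi by auto
      qed
      then show ?thesis using n(2) by blast
    qed simp
    then have "insert x (fst ` set (take i L)) \<subseteq> insert x (fst ` set (take n L))" by blast
    then show "insert x (fst ` set (take n L)) \<notin> \<I>"
      using a i(2) dep_superset by blast
  next
    assume a: "insert x (fst ` set (take n L)) \<notin> \<I>"
    then have "i \<le> n" using i(3) not_less by blast
    moreover have "w < 2 * snd (L ! (i - 1))" if "i \<noteq> 0"
    proof -
      have "L ! (i - 1) \<in> set (take n L)"
        using \<open>i \<le> n\<close> n(1) that by (auto simp: in_set_conv_nth intro!: exI[of _ "i - 1"])
      then show ?thesis using n(2) by auto
    qed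
    ultimately show "i \<le> length L \<and> (i = 0 \<or> w < 2 * snd (L ! (i - 1)))" using n(1) by auto
  qed
  then show ?thesis using d H False by simp
qed

lemma length_le_rank: "Inv j s \<Longrightarrow> length (fst s) \<le> k"
  using card_le_rank[of "fst ` set (fst s)"] rank
  by (auto simp: Inv_def distinct_card simp flip: set_map)

text \<open>Only a swap that removes some \<open>p\<close> heavier than \<open>c\<close> can hurt.
  Then \<open>x\<close> is heavier than \<open>c\<close> as well, and its circuit consists of
  \<open>x\<close> and elements at least as heavy as \<open>p\<close>, so the exchange takes place
  inside the set of heavy elements.\<close>

lemma heavier_dep_later:
  assumes "Inv j s" "\<delta> j s x = Some s'" "insert z (heavier s c) \<notin> \<I>" "z \<noteq> x"
  shows "insert z (heavier s' c) \<notin> \<I>"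
  using assms(1,2)
proof (cases rule: accept_cases)
  case add
  then show ?thesis by (intro dep_superset[OF assms(3)]) auto
next
  case (swap p)
  show ?thesis
  proof (cases "c < snd p")
    case False
    then show ?thesis by (intro dep_superset[OF assms(3)]) (auto simp: swap(7))
  next
    case True
    have inj: "inj_on fst (set (fst s))" and I: "fst ` set (fst s) \<in> \<I>" "fst ` set (fst s) \<subseteq> fst (snd s)"
      and p0: "0 < snd p"
      using assms(1) swap(3) \<tau>_pos[of j] by (auto simp: Inv_def distinct_map intro: less_le_trans)
    have "c < gain s x" using True swap(4) p0 by linarith
    then have "heavier s' c = insert x (fst ` ({q \<in> set (fst s). c < snd q} - {p}))"
      unfolding swap(7) by (auto simp: image_iff)
    also have "fst ` ({q \<in> set (fst s). c < snd q} - {p}) = heavier s c - {fst p}"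
      using inj swap(3) by (subst inj_on_image_set_diff[of fst "set (fst s)"]) auto
    finally have H: "heavier s' c = insert x (heavier s c - {fst p})" .
    show ?thesis
      unfolding H
    proof (rule exchange_dep)
      show "heavier s c \<in> \<I>" by (rule indep_subset[OF I(1)]) auto
      show "fst p \<in> heavier s c" using True swap(3) by auto
      show "x \<notin> heavier s c" using I(2) swap(2) by auto
      show "insert x (heavier s c) \<notin> \<I>"
        by (rule dep_superset[OF swap(5)]) (use True in auto)
    qed (use assms in auto)
  qed
qed

lemma accept_snd:
  assumes "Inv j s" "\<delta> j s x = Some s'"
  shows "snd s' = (insert x (fst (snd s)), f (insert x (fst (snd s))))"
  using assms by (cases rule: accept_cases) auto

lemma gain_later:
  assumes "Inv j s" "x \<in> V" "z \<in> V" "\<delta> j s x = Some s'"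
  shows "gain s' z \<le> gain s z"
  unfolding accept_snd[OF assms(1,4)]
  using assms f_marginal[of "fst (snd s)" "insert x (fst (snd s))" z]
  by (auto simp: Inv_def)

lemma level_double:
  assumes "\<tau> j \<le> w" "2 * w \<le> w'"
  shows "level j w < level j w'"
proof -
  have 1: "1 \<le> w / \<tau> j" using assms(1) \<tau>_pos[of j] by simp
  have "log 2 (w / \<tau> j) + 1 = log 2 (2 * (w / \<tau> j))" using 1 by (subst log_mult) auto
  also have "\<dots> \<le> log 2 (w' / \<tau> j)"
    using 1 assms \<tau>_pos[of j] by (simp add: divide_right_mono)
  finally have "\<lfloor>log 2 (w / \<tau> j)\<rfloor> + 1 \<le> \<lfloor>log 2 (w' / \<tau> j)\<rfloor>" by linarith
  moreover have "0 \<le> \<lfloor>log 2 (w / \<tau> j)\<rfloor>" using 1 by simp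
  ultimately show ?thesis unfolding level_def by linarith
qed

text \<open>Participation caps the weights: the gain of \<open>x\<close> is at most
  \<open>f {x} \<le> 2 powr j\<close>.\<close>

lemma step_Inv:
  assumes "Inv j s" "x \<in> V" "j \<in> set (mat_part k \<epsilon> (info x))" "\<delta> j s x = Some s'"
  shows "Inv j s' \<and> \<mu> j s < \<mu> j s'"
proof -
  define A where "A = fst (snd s)"
  define M where "M = set (fst s)"
  define w where "w = gain s x"
  have inv: "A \<subseteq> V" "snd (snd s) = f A" "fst ` M \<subseteq> A" "fst ` M \<in> \<I>"
    "\<forall>p\<in>M. \<tau> j \<le> snd p \<and> snd p \<le> 2 powr of_int j"
    "\<And>N. N \<subseteq> M \<Longrightarrow> (\<Sum>p\<in>N. snd p) \<le> f (fst ` N)"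
    "f A \<le> 2 * (\<Sum>p\<in>M. snd p)" "finite M"
    using assms(1) by (auto simp: Inv_def A_def M_def)
  have w: "w = f (insert x A) - f A" using inv(2) by (simp add: w_def A_def)
  have "info x > 0" using assms(3) by (auto simp: mat_part_def split: if_splits)
  then have "info x = f {x}" "info x \<le> 2 powr of_int j"
    using assms(3) part_iff by (auto simp: info_def split: if_splits)
  then have w_le: "w \<le> 2 powr of_int j"
    using f_insert_le[OF inv(1) assms(2)] w by simp
  have sub: "(\<Sum>p\<in>N. snd p) \<le> f (fst ` N)" if N: "N \<subseteq> insert (x, w) M" and x: "x \<notin> A" for N
  proof (cases "(x, w) \<in> N")
    case True
    define N' where "N' = N - {(x, w)}"
    have N': "N = insert (x, w) N'" "N' \<subseteq> M" "(x, w) \<notin> N'" using True N by (auto simp: N'_def)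
    have "finite N'" using N'(2) inv(8) finite_subset by blast
    then have "(\<Sum>p\<in>N. snd p) = w + (\<Sum>p\<in>N'. snd p)" using N' by simp
    \<comment> \<open>The weight of \<open>x\<close> is its gain over all of \<open>A\<close>, hence
      at most its gain over any part of the current solution.\<close>
    also have "\<dots> \<le> (f (insert x (fst ` N')) - f (fst ` N')) + f (fst ` N')"
      unfolding w using N'(2) inv(1,3) assms(2) by (intro add_mono f_marginal inv(6)) auto
    finally show ?thesis using N'(1) by simp
  next
    case False
    then show ?thesis using N by (intro inv(6)) auto
  qed
  show ?thesis
    using assms(1,4)
  proof (cases rule: accept_cases)
    case add
    have xM: "(x, w) \<notin> M" using add(2) inv(3) by (force simp: A_def)
    have M': "set (fst s') = insert (x, w) M" using add(4) by (simp add: M_def w_def)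
    have A': "snd s' = (insert x A, f (insert x A))" using add(5) by (simp add: A_def)
    have \<tau>w: "\<tau> j \<le> w" using add(1) by (simp add: w_def)
    have "Inv j s'"
      unfolding Inv_def M' A' fst_conv snd_conv
    proof (intro conjI allI impI)
      show "insert x A \<subseteq> V" using inv(1) assms(2) by simp
      show "fst ` insert (x, w) M \<subseteq> insert x A" using inv(3) by auto
      show "fst ` insert (x, w) M \<in> \<I>" using add(3) by (simp add: M_def)
      show "\<forall>p\<in>insert (x, w) M. \<tau> j \<le> snd p \<and> snd p \<le> 2 powr real_of_int j"
        using inv(5) \<tau>w w_le by auto
      show "(\<Sum>p\<in>N. snd p) \<le> f (fst ` N)" if "N \<subseteq> insert (x, w) M" for N
        using sub[OF that] add(2) by (simp add: A_def)
      show "f (insert x A) \<le> 2 * (\<Sum>p\<in>insert (x, w) M. snd p)"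
        using inv(7,8) xM w \<tau>w \<tau>_pos[of j] by simp
    qed (use add(6,7) in auto)
    moreover have "\<mu> j s' = level j w + \<mu> j s"
      unfolding \<mu>_def M' using xM inv(8) by (simp add: M_def)
    ultimately show ?thesis by (simp add: level_def)
  next
    case (swap p)
    have xM: "(x, w) \<notin> M" using swap(2) inv(3) by (force simp: A_def)
    have M': "set (fst s') = insert (x, w) (M - {p})" using swap(7) by (simp add: M_def w_def)
    have A': "snd s' = (insert x A, f (insert x A))" using swap(8) by (simp add: A_def)
    have \<tau>w: "\<tau> j \<le> w" "2 * snd p \<le> w" using swap(1,4) by (simp_all add: w_def)
    have p: "p \<in> M" "\<tau> j \<le> snd p" using swap(3) inv(5) by (simp_all add: M_def)
    have inj: "inj_on fst M" using assms(1) by (auto simp: Inv_def distinct_map M_def)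
    have "Inv j s'"
      unfolding Inv_def M' A' fst_conv snd_conv
    proof (intro conjI allI impI)
      show "insert x A \<subseteq> V" using inv(1) assms(2) by simp
      show "fst ` insert (x, w) (M - {p}) \<subseteq> insert x A" using inv(3) by auto
      have "fst ` (M - {p}) = fst ` M - {fst p}"
        using inj p(1) by (subst inj_on_image_set_diff[of fst M]) auto
      then show "fst ` insert (x, w) (M - {p}) \<in> \<I>" using swap(6) by (simp add: M_def)
      show "\<forall>p\<in>insert (x, w) (M - {p}). \<tau> j \<le> snd p \<and> snd p \<le> 2 powr real_of_int j"
        using inv(5) \<tau>w w_le by auto
      show "(\<Sum>p\<in>N. snd p) \<le> f (fst ` N)" if "N \<subseteq> insert (x, w) (M - {p})" for N
        using sub[of N] that swap(2) by (auto simp: A_def)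
      \<comment> \<open>\<open>f\<close> grows by \<open>w\<close> while the total weight grows by
        \<open>w - snd p \<ge> w / 2\<close>, which preserves the factor 2.\<close>
      have "(\<Sum>p\<in>M. snd p) = snd p + (\<Sum>p\<in>M - {p}. snd p)"
        using inv(8) p(1) by (rule sum.remove)
      then show "f (insert x A) \<le> 2 * (\<Sum>p\<in>insert (x, w) (M - {p}). snd p)"
        using inv(7,8) xM w \<tau>w by simp
    qed (use swap(9,10) in auto)
    moreover have "\<mu> j s' = level j w + (\<Sum>q\<in>M - {p}. level j (snd q))"
      unfolding \<mu>_def M' using xM inv(8) by simp
    moreover have "\<mu> j s = level j (snd p) + (\<Sum>q\<in>M - {p}. level j (snd q))"
      unfolding \<mu>_def M_def[symmetric] using inv(8) p(1) by (rule sum.remove)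
    ultimately show ?thesis using level_double[OF p(2) \<tau>w(2)] by simp
  qed
qed

text \<open>The gain of \<open>z\<close> can only fall, which enlarges the set of elements heavier
  than half of it; dependence on a set of heavy elements survives the step.\<close>

lemma rejected_later:
  assumes "Inv j s" "x \<in> V" "j \<in> set (mat_part k \<epsilon> (info x))" "\<delta> j s x = Some s'"
    "z \<in> V" "\<delta> j s z = None"
  shows "\<delta> j s' z = None"
proof -
  have inv': "Inv j s'" using step_Inv[OF assms(1-4)] by simp
  have g: "gain s' z \<le> gain s z" by (rule gain_later[OF assms(1,2,5,4)])
  have "z \<noteq> x" using assms(4,6) by auto
  have "gain s z < \<tau> j \<or> insert z (heavier s (gain s z / 2)) \<notin> \<I>"
    using reject_iff[OF assms(1)] assms(6) by blast
  then have "gain s' z < \<tau> j \<or> insert z (heavier s' (gain s' z / 2)) \<notin> \<I>"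
  proof
    assume "insert z (heavier s (gain s z / 2)) \<notin> \<I>"
    then have "insert z (heavier s' (gain s z / 2)) \<notin> \<I>"
      using heavier_dep_later[OF assms(1,4)] \<open>z \<noteq> x\<close> by blast
    then have "insert z (heavier s' (gain s' z / 2)) \<notin> \<I>"
      by (rule dep_superset) (use g in \<open>auto intro!: image_eqI\<close>)
    then show ?thesis ..
  qed (use g in simp)
  then show ?thesis using reject_iff[OF inv'] by blast
qed

text \<open>At most \<open>k\<close> elements, each on a level between \<open>\<tau> j\<close> and
  \<open>2 powr j\<close>, whose ratio is \<open>10 * k / \<epsilon>\<close>.\<close>

definition height_bound :: nat where
  "height_bound = k * Suc (nat \<lfloor>log 2 (10 * real k / \<epsilon>)\<rfloor>)"

lemma \<mu>_le:
  assumes "Inv j s"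
  shows "\<mu> j s \<le> height_bound"
proof -
  have len: "card (set (fst s)) \<le> k"
    using length_le_rank[OF assms] card_length[of "fst s"] by linarith
  have "level j (snd p) \<le> Suc (nat \<lfloor>log 2 (10 * real k / \<epsilon>)\<rfloor>)" if p: "p \<in> set (fst s)" for p
  proof -
    have p: "\<tau> j \<le> snd p" "snd p \<le> 2 powr of_int j" using assms p by (auto simp: Inv_def)
    have "snd p / \<tau> j \<le> 2 powr of_int j / \<tau> j" using p \<tau>_pos[of j] by (intro divide_right_mono) auto
    also have "\<dots> = 10 * real k / \<epsilon>" by (simp add: mat_threshold_def)
    finally have "log 2 (snd p / \<tau> j) \<le> log 2 (10 * real k / \<epsilon>)"
      using p \<tau>_pos[of j] k \<epsilon>
      by (subst log_le_cancel_iff) (auto intro: less_le_trans divide_pos_pos)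
    then show ?thesis unfolding level_def by (intro Suc_le_mono[THEN iffD2] nat_mono floor_mono)
  qed
  then have "\<mu> j s \<le> (\<Sum>p\<in>set (fst s). Suc (nat \<lfloor>log 2 (10 * real k / \<epsilon>)\<rfloor>))"
    unfolding \<mu>_def by (rule sum_mono)
  also have "\<dots> = card (set (fst s)) * Suc (nat \<lfloor>log 2 (10 * real k / \<epsilon>)\<rfloor>)" by simp
  also have "\<dots> \<le> height_bound" unfolding height_bound_def using len by (intro mult_right_mono) auto
  finally show ?thesis .
qed

lemma Inv_init: "Inv j ([], {}, 0)"
  by (simp add: Inv_def f_empty indep_empty)

lemma computes_stp:
  assumes "Inv j s" "k + 1 < 2 ^ n"
  shows "computes orc (mat_stp k \<epsilon> j s x) (\<delta> j s x) (Suc n)"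
  unfolding mat_stp_def
proof (rule computes_Query)
  let ?L = "fst s" and ?a = "f (insert x (fst (snd s)))"
  let ?b = "bsearch (\<lambda>i. Query (Inr (insert x (fst ` set (take i ?L)))) (\<lambda>b. Return (\<not> projr b))) 0 (Suc (length ?L))"
  have b: "computes orc ?b (dep_pos ?L x) (n * 1)"
  proof (rule computes_bsearch[where P = "\<lambda>i. insert x (fst ` set (take i ?L)) \<notin> \<I>"])
    show "computes orc (Query (Inr (insert x (fst ` set (take i ?L)))) (\<lambda>b. Return (\<not> projr b)))
        (insert x (fst ` set (take i ?L)) \<notin> \<I>) 1" for i
      unfolding One_nat_def by (rule computes_Query) (simp add: computes_Return)
    show "insert x (fst ` set (take l ?L)) \<notin> \<I>"
      if "i \<le> l" "insert x (fst ` set (take i ?L)) \<notin> \<I>" for i l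
      by (rule dep_superset[OF that(2)]) (use set_take_subset_set_take[OF that(1), of ?L] in blast)
    show "Suc (length ?L) - 0 < 2 ^ n" using length_le_rank[OF assms(1)] assms(2) by simp
  qed (use dep_pos[where L = ?L and x = x] in auto)
  show "computes orc
     (if projl (orc (Inl (insert x (fst (snd s))))) - snd (snd s) < \<tau> j then Return None
      else pbind ?b (\<lambda>i. Return (exchange_at s x (projl (orc (Inl (insert x (fst (snd s)))))) i)))
     (\<delta> j s x) n"
  proof (cases "gain s x < \<tau> j")
    case False
    have "computes orc (pbind ?b (\<lambda>i. Return (exchange_at s x ?a i)))
        (exchange_at s x ?a (dep_pos ?L x)) (n * 1 + 0)"
      by (rule computes_pbind[OF b computes_Return])
    with False show ?thesis by (simp add: \<delta>_def)
  qed (simp add: \<delta>_def computes_Return)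
qed

lemma computes_sing: "computes orc (mat_sing x) (info x) 2"
proof -
  have "computes orc (mat_sing x) (info x) (Suc (Suc 0))"
    unfolding mat_sing_def by (rule computes_Query, rule computes_Query) (simp add: info_def computes_Return)
  then show ?thesis by (simp add: numeral_2_eq_2)
qed

lemma analysis:
  assumes "k + 1 < 2 ^ n" "height_bound + 1 < 2 ^ m" "log 2 (10 * real k / \<epsilon>) + 1 < real P + 1"
  shows "dyn_analysis mat_sing (mat_part k \<epsilon>) (mat_stp k \<epsilon>) ([], {}, 0)
    V orc info \<delta> Inv \<mu> height_bound 2 (Suc n) m P"
proof
  show "distinct (mat_part k \<epsilon> (info x)) \<and> length (mat_part k \<epsilon> (info x)) \<le> P" for x
    using length_part[of "info x"] assms(3) by (auto simp: mat_part_def)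
  show "Inv j s' \<and> \<mu> j s < \<mu> j s'"
    if "Inv j s" "x \<in> V" "j \<in> set (mat_part k \<epsilon> (info x))" "\<delta> j s x = Some s'" for j s x s'
    by (rule step_Inv[OF that])
  show "\<delta> j s' y = None"
    if "Inv j s" "x \<in> V" "j \<in> set (mat_part k \<epsilon> (info x))" "\<delta> j s x = Some s'"
      "y \<in> V" "\<delta> j s y = None" for j s x s' y
    by (rule rejected_later[OF that])
  show "computes orc (mat_stp k \<epsilon> j s x) (\<delta> j s x) (Suc n)" if "Inv j s" for j s x
    by (rule computes_stp[OF that assms(1)])
qed (simp_all only: finite_V computes_sing Inv_init \<mu>_le assms(2))

end

section \<open>Approximation ratio for a matroid\<close>

locale matroid_analysis = matroid_submodular V f \<I> k \<epsilon> +
  dyn_analysis mat_sing "mat_part k \<epsilon>" "mat_stp k \<epsilon>" "([], {}, 0)"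
    V "matroid_oracle f \<I>" "matroid_submodular.info f \<I>" "matroid_submodular.\<delta> f \<I> k \<epsilon>"
    "matroid_submodular.Inv V f \<I> k \<epsilon>" "matroid_submodular.\<mu> k \<epsilon>"
    "matroid_submodular.height_bound k \<epsilon>" 2 "Suc n" m P
  for V :: "'v set" and f \<I> k \<epsilon> n m P
begin

definition final :: "'v list \<Rightarrow> int \<Rightarrow> 'v mat_state" where
  "final xs j = last (snd (canon (step_at j) (participants xs j) [([], {}, 0)]))"

lemma final_Inv: "Inv j (final xs j)"
  using scale.canon_history[OF history_init, of j "participants xs j"] scale.history_inv[of j]
  by (auto simp: final_def)

lemma final_subset:
  assumes "set xs \<subseteq> V"
  shows "fst ` set (fst (final xs j)) \<subseteq> set xs"
proof -
  have "fst (snd (last (snd (canon (step_at j) (participants xs j) [([], {}, 0)])))) \<subseteq>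
      {} \<union> set (participants xs j)"
  proof (rule scale.canon_invariant[where J = "\<lambda>s X. fst (snd s) \<subseteq> X", OF history_init])
    fix s x s' X
    assume s: "Inv j s" "fst (snd s) \<subseteq> X" "step_at j s x = Some s'"
    then have "\<delta> j s x = Some s'" by (auto simp: step_at_def split: if_splits)
    from accept_snd[OF s(1) this] show "fst (snd s') \<subseteq> insert x X" using s(2) by auto
  qed auto
  then have "fst (snd (final xs j)) \<subseteq> set (participants xs j)" by (simp add: final_def)
  moreover have "fst ` set (fst (final xs j)) \<subseteq> fst (snd (final xs j))"
    using final_Inv[of j xs] by (simp add: Inv_def)
  ultimately show ?thesis by (auto simp: participants_def)
qed

lemma final_rejects:
  assumes "x \<in> set (participants xs j)" "set xs \<subseteq> V"
  shows "\<delta> j (final xs j) x = None"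
proof -
  have "step_at j (final xs j) x = None"
    unfolding final_def
  proof (rule scale.canon_rejects[OF history_init assms(1)])
    fix s s' assume s: "Inv j s" "step_at j s x = Some s'"
    then have "\<delta> j s x = Some s'" by (auto simp: step_at_def split: if_splits)
    from accept_snd[OF s(1) this] show "step_at j s' x = None"
      using \<tau>_pos[of j] by (simp add: step_at_def \<delta>_def)
  qed
  then show ?thesis using assms by (auto simp: step_at_def participants_def split: if_splits)
qed

text \<open>At each level \<theta>, the elements of \<open>X\<close> with gain at least \<theta>
  depend on the kept elements of weight at least \<theta>/2, so by augmentation they are no more
  numerous; the layer-cake lemma bounds their gains by twice the kept weight. Gains below the
  threshold add at most \<open>k * \<tau> j\<close>, and \<open>f A\<close> is another twice the
  kept weight, which gives the 4.\<close>

lemma guess_approx: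
  assumes xs: "set xs \<subseteq> V" and X: "X \<in> \<I>" "X \<subseteq> set xs" "\<And>x. x \<in> X \<Longrightarrow> f {x} \<le> 2 powr of_int j"
  shows "f X \<le> 4 * f (fst ` set (fst (final xs j))) + \<epsilon> * 2 powr of_int j / 10"
proof -
  define s where "s = final xs j"
  define A where "A = fst (snd s)"
  define M where "M = set (fst s)"
  define g where "g x = f (insert x A) - f A" for x
  have inv: "Inv j s" unfolding s_def by (rule final_Inv)
  have M: "A \<subseteq> V" "snd (snd s) = f A" "fst ` M \<in> \<I>" "inj_on fst M" "\<forall>p\<in>M. \<tau> j \<le> snd p"
    "(\<Sum>p\<in>M. snd p) \<le> f (fst ` M)" "f A \<le> 2 * (\<Sum>p\<in>M. snd p)" "finite M"
    using inv by (auto simp: Inv_def A_def M_def distinct_map)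
  have finX: "finite X" by (rule indep_finite[OF X(1)])
  define B where "B = {x \<in> X. \<tau> j \<le> g x}"
  have dep: "insert x (fst ` {p \<in> M. g x / 2 < snd p}) \<notin> \<I>" if x: "x \<in> B" for x
  proof -
    have xX: "x \<in> X" "\<tau> j \<le> g x" using x by (auto simp: B_def)
    have "{x} \<in> \<I>" by (rule indep_subset[OF X(1)]) (use xX in auto)
    then have info: "info x = f {x}" by (simp add: info_def)
    have "g x \<le> f {x}" unfolding g_def using M(1) xX X(2) xs by (intro f_insert_le) auto
    then have "j \<in> set (mat_part k \<epsilon> (info x))"
      using X(3)[OF xX(1)] xX(2) \<tau>_pos[of j] by (subst part_iff) (auto simp: info)
    then have "\<delta> j s x = None"
      unfolding s_def using xX X xs by (intro final_rejects) (auto simp: participants_def)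
    then show ?thesis
      using reject_iff[OF inv, of x] xX(2) M(2) by (simp add: g_def A_def M_def)
  qed
  have "(\<Sum>x\<in>B. g x) \<le> (\<Sum>p\<in>M. 2 * snd p)"
  proof (rule sum_le_of_card_superlevel_le)
    show "finite B" using finX by (simp add: B_def)
    show "0 \<le> 2 * snd p" if "p \<in> M" for p using M(5) that \<tau>_pos[of j] by fastforce
    fix \<theta> :: real
    let ?Y = "{p \<in> M. \<theta> \<le> 2 * snd p}"
    show "card {x \<in> B. \<theta> \<le> g x} \<le> card ?Y"
    proof (rule ccontr)
      assume "\<not> ?thesis"
      moreover have "card (fst ` ?Y) = card ?Y"
        by (rule card_image) (rule inj_on_subset[OF M(4)], auto)
      ultimately have less: "card (fst ` ?Y) < card {x \<in> B. \<theta> \<le> g x}" by simp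
      have "{x \<in> B. \<theta> \<le> g x} \<in> \<I>" "fst ` ?Y \<in> \<I>"
        by (rule indep_subset[OF X(1)], simp add: B_def subset_iff) (rule indep_subset[OF M(3)], auto)
      then obtain x where x: "x \<in> B" "\<theta> \<le> g x" "insert x (fst ` ?Y) \<in> \<I>"
        using augment[OF _ _ less] by blast
      have "insert x (fst ` {p \<in> M. g x / 2 < snd p}) \<subseteq> insert x (fst ` ?Y)"
        using x(2) by auto
      then show False using dep[OF x(1)] x(3) indep_subset by blast
    qed
  qed (rule M(8))
  moreover have "(\<Sum>x\<in>X - B. g x) \<le> real (card (X - B)) * \<tau> j"
    by (rule sum_bounded_above) (auto simp: B_def)
  moreover have "real (card (X - B)) * \<tau> j \<le> real k * \<tau> j"
  proof (intro mult_right_mono)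
    have "card (X - B) \<le> card X" using finX by (intro card_mono) auto
    also have "\<dots> \<le> k" using card_le_rank[OF X(1)] rank by simp
    finally show "real (card (X - B)) \<le> real k" by simp
  qed (use \<tau>_pos[of j] in simp)
  moreover have "(\<Sum>x\<in>X. g x) = (\<Sum>x\<in>X - B. g x) + (\<Sum>x\<in>B. g x)"
    using finX by (intro sum.subset_diff) (auto simp: B_def)
  moreover have "real k * \<tau> j = \<epsilon> * 2 powr of_int j / 10" using k by (simp add: mat_threshold_def)
  moreover have "f X \<le> f (A \<union> X)" using X xs M(1) by (intro f_mono) auto
  moreover have "f (A \<union> X) \<le> f A + (\<Sum>x\<in>X. g x)"
    unfolding g_def using X xs M(1) by (intro f_union_le) auto
  moreover have "(\<Sum>p\<in>M. 2 * snd p) = 2 * (\<Sum>p\<in>M. snd p)" by (simp add: sum_distrib_left)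
  ultimately show ?thesis using M(6,7) unfolding M_def s_def by linarith
qed

lemma out_approx:
  assumes xs: "set xs \<subseteq> V"
  shows "mat_out (canonical xs) \<in> \<I> \<and> mat_out (canonical xs) \<subseteq> set xs \<and>
    opt \<I> f (set xs) \<le> (4 + \<epsilon>) * f (mat_out (canonical xs))"
proof -
  define M where "M = Max (insert 0 (info ` set xs))"
  have out: "mat_out (canonical xs) =
      (if M > 0 then fst ` set (fst (final xs \<lceil>log 2 M\<rceil>)) else {})"
    by (simp add: mat_out_def canonical_def M_def final_def Let_def cong: image_cong)
  let ?F = "{X \<in> \<I>. X \<subseteq> set xs}"
  have F: "finite ?F" "?F \<noteq> {}" using finite_indep indep_empty by auto
  then have "Max (f ` ?F) \<in> f ` ?F" by (intro Max_in) auto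
  then obtain X where X: "X \<in> \<I>" "X \<subseteq> set xs" "opt \<I> f (set xs) = f X"
    by (auto simp: opt_def)
  have le_M: "f {x} \<le> M" if x: "x \<in> X" for x
  proof -
    have "{x} \<in> \<I>" by (rule indep_subset[OF X(1)]) (use x in auto)
    then have "info x = f {x}" by (simp add: info_def)
    moreover have "info x \<le> M" unfolding M_def using x X(2) by (intro Max_ge) auto
    ultimately show ?thesis by simp
  qed
  show ?thesis
  proof (cases "M > 0")
    case True
    define j where "j = \<lceil>log 2 M\<rceil>"
    have "M = 2 powr log 2 M" using True by simp
    also have "\<dots> \<le> 2 powr of_int j" unfolding j_def by (intro powr_mono) auto
    finally have j1: "M \<le> 2 powr of_int j" .
    have "2 powr of_int j \<le> 2 powr (log 2 M + 1)" unfolding j_def by (intro powr_mono) linarith+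
    also have "\<dots> = 2 * M" using True by (simp add: powr_add)
    finally have j2: "2 powr of_int j \<le> 2 * M" .
    have "M \<in> insert 0 (info ` set xs)" unfolding M_def by (rule Max_in) auto
    then obtain y where y: "y \<in> set xs" "info y = M" using True by auto
    then have "{y} \<in> \<I>" "f {y} = M" using True by (auto simp: info_def split: if_splits)
    then have "M \<le> f X"
      unfolding X(3)[symmetric] opt_def using y(1) F(1) by (intro Max_ge) auto
    let ?S = "fst ` set (fst (final xs j))"
    have "f X \<le> 4 * f ?S + \<epsilon> * 2 powr of_int j / 10"
      using j1 le_M order_trans by (intro guess_approx[OF xs X(1,2)]) blast
    also have "\<dots> \<le> 4 * f ?S + \<epsilon> * (2 * f X) / 10"
      using j2 \<open>M \<le> f X\<close> \<epsilon> by (intro add_left_mono divide_right_mono mult_left_mono) auto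
    finally have le: "(1 - \<epsilon> / 5) * f X \<le> 4 * f ?S" by (simp add: algebra_simps)
    \<comment> \<open>The 10 in the threshold is chosen for this: as \<open>2 powr j\<close> is at
      most twice the optimum, the loss is at most \<open>\<epsilon>/5\<close> of it, and
      \<open>(4 + \<epsilon>) * (1 - \<epsilon>/5) \<ge> 4\<close> for
      \<open>\<epsilon> \<le> 1\<close>.\<close>
    have "4 * f X \<le> (4 + \<epsilon>) * ((1 - \<epsilon> / 5) * f X)"
    proof -
      have "(4 + \<epsilon>) * (1 - \<epsilon> / 5) = 4 + \<epsilon> * (1 - \<epsilon>) / 5" by (simp add: field_simps)
      then have "4 \<le> (4 + \<epsilon>) * (1 - \<epsilon> / 5)" using \<epsilon> by simp
      then have "4 * f X \<le> ((4 + \<epsilon>) * (1 - \<epsilon> / 5)) * f X"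
        using True \<open>M \<le> f X\<close> by (intro mult_right_mono) auto
      then show ?thesis by (simp only: mult.assoc)
    qed
    also have "\<dots> \<le> (4 + \<epsilon>) * (4 * f ?S)" using le \<epsilon> by (intro mult_left_mono) auto
    finally have "f X \<le> (4 + \<epsilon>) * f ?S" by simp
    moreover have "?S \<in> \<I>" using final_Inv[of j xs] by (simp add: Inv_def)
    ultimately show ?thesis
      using final_subset[OF xs, of j] True by (simp add: out X(3) j_def)
  next
    case False
    \<comment> \<open>With all independent singletons worthless, subadditivity makes the optimum 0
      and the empty set suffices.\<close>
    have "f {x} \<le> 0" if "x \<in> X" for x using le_M[OF that] False by linarith
    then have "(\<Sum>x\<in>X. f {x} - f {}) \<le> 0" by (simp add: f_empty sum_nonpos)
    moreover have "f ({} \<union> X) \<le> f {} + (\<Sum>x\<in>X. f {x} - f {})" using X(2) xs by (intro f_union_le) auto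
    ultimately have "f X \<le> 0" by (simp add: f_empty)
    then show ?thesis using False indep_empty by (simp add: out X(3) f_empty)
  qed
qed

end

context matroid_submodular
begin

text \<open>With \<open>l = lg k\<close> and \<open>L = lg (k/\<epsilon>)\<close>, the guesses give
  \<open>6 * L\<close>, the chain search \<open>8 * L\<close>, one transition \<open>4 * l\<close>
  and the chain height \<open>7 * k * L\<close>. The constants multiply to 1344; two queries for the
  singleton are added.\<close>

lemma query_bound:
  assumes n: "real n \<le> log 2 (real (k + 1)) + 1"
    and m: "real m \<le> log 2 (real (height_bound + 1)) + 1"
    and P: "real P \<le> log 2 (10 * real k / \<epsilon>) + 1"
  shows "real (2 + P * ((m + 1) * Suc n * (height_bound + 1))) \<le>
    1346 * (real k * lg (real k) * lg (real k / \<epsilon>) ^ 3)"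
proof -
  let ?l = "lg (real k)" and ?L = "lg (real k / \<epsilon>)"
  have l: "1 \<le> ?l" "log 2 (real k) \<le> ?l" and L: "1 \<le> ?L" "log 2 (real k / \<epsilon>) \<le> ?L"
    by (rule lg_ge_1 lg_ge_log)+
  have "log 2 (real k) \<le> log 2 (real k / \<epsilon>)"
    using k \<epsilon> by (subst log_le_cancel_iff) (auto simp: le_divide_eq)
  then have kL: "log 2 (real k) \<le> ?L" using L(2) by linarith
  have "log 2 (10::real) \<le> 4" by (subst log_le_iff) auto
  moreover have "log 2 (10 * (real k / \<epsilon>)) = log 2 10 + log 2 (real k / \<epsilon>)"
    using k \<epsilon> by (intro log_mult_pos) auto
  ultimately have A: "log 2 (10 * real k / \<epsilon>) \<le> 5 * ?L" using L by simp
  have P': "real P \<le> 6 * ?L" using P A L by linarith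
  have "1 * 1 \<le> (10 * real k) * (1 / \<epsilon>)" using k \<epsilon> by (intro mult_mono) auto
  then have "0 \<le> log 2 (10 * real k / \<epsilon>)" by simp
  then have "real (Suc (nat \<lfloor>log 2 (10 * real k / \<epsilon>)\<rfloor>)) \<le> 6 * ?L" using A L by linarith
  then have "real height_bound \<le> real k * (6 * ?L)"
    unfolding height_bound_def of_nat_mult by (intro mult_left_mono) auto
  moreover have kL1: "1 \<le> real k * ?L" using mult_mono[of 1 "real k" 1 ?L] k L by simp
  ultimately have T: "real (height_bound + 1) \<le> 7 * (real k * ?L)" by simp
  \<comment> \<open>The height of the chain itself contains \<open>L\<close>, so its logarithm
    produces \<open>log 2 L\<close>, which is absorbed into \<open>L\<close>.\<close>
  have "log 2 ?L = ln ?L / ln 2" by (simp add: log_def)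
  also have "\<dots> \<le> ?L / (1 / 2)"
    using L ln_le_minus_one[of ?L] ln2_ge_two_thirds by (intro frac_le) auto
  finally have LL: "log 2 ?L \<le> 2 * ?L" by simp
  have "log 2 (real (height_bound + 1)) \<le> log 2 (2 powr 3 * (real k * ?L))"
    using T kL1 by (subst log_le_cancel_iff) auto
  also have "\<dots> = log 2 (2 powr 3) + (log 2 (real k) + log 2 ?L)"
    using k L by (subst log_mult_pos, simp, simp, subst log_mult_pos) auto
  also have "log 2 (2 powr 3) = (3::real)" by (rule log_powr_cancel) auto
  finally have m': "real m + 1 \<le> 8 * ?L" using m kL LL L by linarith
  have "log 2 (real (k + 1)) \<le> log 2 (2 * real k)" using k by simp
  also have "\<dots> = 1 + log 2 (real k)" using k by (simp add: log_mult)
  finally have n': "real (Suc n) \<le> 4 * ?l" using n l by simp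
  have "real P * ((real m + 1) * real (Suc n) * real (height_bound + 1)) \<le>
      (6 * ?L) * ((8 * ?L) * (4 * ?l) * (7 * (real k * ?L)))"
    using P' m' n' T L l kL1 by (intro mult_mono) auto
  also have "\<dots> = 1344 * (real k * ?l * ?L ^ 3)" by (simp add: power3_eq_cube)
  finally have "real P * ((real m + 1) * real (Suc n) * real (height_bound + 1)) \<le>
      1344 * (real k * ?l * ?L ^ 3)" .
  moreover have "1 * 1 * 1 \<le> real k * ?l * ?L ^ 3"
    using k l L by (intro mult_mono one_le_power) auto
  moreover have "real (2 + P * ((m + 1) * Suc n * (height_bound + 1))) =
      2 + real P * ((real m + 1) * real (Suc n) * real (height_bound + 1))"
    by (simp only: of_nat_add of_nat_mult of_nat_1 of_nat_numeral)
  ultimately show ?thesis by linarith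
qed

lemma mat_alg_correct:
  assumes us: "\<forall>u\<in>set us. elem u \<in> V"
  shows "maintains_approx (matroid_oracle f \<I>) (mat_alg k \<epsilon>) us \<I> f (4 + \<epsilon>) \<and>
    worst_case_expected_queries_le (matroid_oracle f \<I>) (mat_alg k \<epsilon>) us
      (1346 * (real k * lg (real k) * lg (real k / \<epsilon>) ^ 3))"
proof -
  obtain n where n: "real (k + 1) < 2 ^ n" "real n \<le> log 2 (real (k + 1)) + 1"
    using ex_log2_height[of "real (k + 1)"] by auto
  obtain m where m: "real (height_bound + 1) < 2 ^ m" "real m \<le> log 2 (real (height_bound + 1)) + 1"
    using ex_log2_height[of "real (height_bound + 1)"] by auto
  have n': "k + 1 < 2 ^ n" and m': "height_bound + 1 < 2 ^ m"
    using n(1) m(1) by (metis of_nat_less_iff of_nat_numeral of_nat_power)+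
  define P where "P = nat \<lfloor>log 2 (10 * real k / \<epsilon>) + 1\<rfloor>"
  have "1 * 1 \<le> (10 * real k) * (1 / \<epsilon>)" using k \<epsilon> by (intro mult_mono) auto
  then have "0 \<le> log 2 (10 * real k / \<epsilon>)" by simp
  then have P: "log 2 (10 * real k / \<epsilon>) + 1 < real P + 1" "real P \<le> log 2 (10 * real k / \<epsilon>) + 1"
    unfolding P_def by linarith+
  interpret matroid_analysis V f \<I> k \<epsilon> n m P
    unfolding matroid_analysis_def by (intro conjI analysis n' m' P matroid_submodular_axioms)
  have alg: "mat_alg k \<epsilon> = unfold_alg mat_out update_step init_state"
    using k by (simp add: mat_alg_def)
  show ?thesis
    unfolding alg
    by (intro conjI maintains_approxI[OF us] expected_queries[OF us] query_bound n m P out_approx)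
qed

end

theorem mat_alg:
  assumes "finite V" "normalized_monotone_submodular V f" "matroid V \<I>" "matroid_rank \<I> = k"
    "0 < \<epsilon>" "\<epsilon> \<le> 1" "\<forall>u\<in>set us. elem u \<in> V"
  shows "maintains_approx (matroid_oracle f \<I>) (mat_alg k \<epsilon>) us \<I> f (4 + \<epsilon>) \<and>
    worst_case_expected_queries_le (matroid_oracle f \<I>) (mat_alg k \<epsilon>) us
      (1346 * (real k * lg (real k) * lg (real k / \<epsilon>) ^ 3))"
proof (cases "k = 0")
  case True
  interpret matroid_on V \<I> by unfold_locales (rule assms)
  have "X = {}" if "X \<in> \<I>" for X
    using card_le_rank[OF that] indep_finite[OF that] assms(4) True by simp
  then have F: "{X \<in> \<I>. X \<subseteq> W} = {{}}" for W using indep_empty by blast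
  have f0: "f {} = 0" using assms(2) by (simp add: normalized_monotone_submodular_def)
  show ?thesis
    unfolding mat_alg_def True if_P[OF refl] by (rule idle_alg, rule F, rule f0)
next
  case False
  then interpret matroid_submodular V f \<I> k \<epsilon>
    using assms by unfold_locales auto
  show ?thesis by (rule mat_alg_correct[OF assms(7)])
qed

theorem theorem1:
  "(\<exists>(C::real) (A :: nat \<Rightarrow> real \<Rightarrow> ('v update, 'v set + 'v set, real + bool, 'v set) alg).
      \<forall>V f \<I> k \<epsilon> us.
        finite V \<and> normalized_monotone_submodular V f \<and>
        matroid V \<I> \<and> matroid_rank \<I> = k \<and>
        0 < \<epsilon> \<and> \<epsilon> \<le> 1 \<and> (\<forall>u\<in>set us. elem u \<in> V) \<longrightarrow>
        maintains_approx (matroid_oracle f \<I>) (A k \<epsilon>) us \<I> f (4 + \<epsilon>) \<and>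
        worst_case_expected_queries_le (matroid_oracle f \<I>) (A k \<epsilon>) us
          (C * (real k * lg (real k) * lg (real k / \<epsilon>) ^ 3))) \<and>
   (\<exists>(C::real) (A :: nat \<Rightarrow> real \<Rightarrow> ('v update, 'v set, real, 'v set) alg).
      \<forall>V f k \<epsilon> us.
        finite V \<and> normalized_monotone_submodular V f \<and>
        0 < \<epsilon> \<and> \<epsilon> \<le> 1 \<and> (\<forall>u\<in>set us. elem u \<in> V) \<longrightarrow>
        maintains_approx f (A k \<epsilon>) us {X. X \<subseteq> V \<and> card X \<le> k} f (2 + \<epsilon>) \<and>
        worst_case_expected_queries_le f (A k \<epsilon>) us
          (C * (real k * (1 / \<epsilon>) * lg (real k) ^ 2)))"
proof (rule conjI)
  show "\<exists>(C::real) (A :: nat \<Rightarrow> real \<Rightarrow> ('v update, 'v set + 'v set, real + bool, 'v set) alg).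
      \<forall>V f \<I> k \<epsilon> us.
        finite V \<and> normalized_monotone_submodular V f \<and>
        matroid V \<I> \<and> matroid_rank \<I> = k \<and>
        0 < \<epsilon> \<and> \<epsilon> \<le> 1 \<and> (\<forall>u\<in>set us. elem u \<in> V) \<longrightarrow>
        maintains_approx (matroid_oracle f \<I>) (A k \<epsilon>) us \<I> f (4 + \<epsilon>) \<and>
        worst_case_expected_queries_le (matroid_oracle f \<I>) (A k \<epsilon>) us
          (C * (real k * lg (real k) * lg (real k / \<epsilon>) ^ 3))"
    by (rule exI[of _ 1346], rule exI[of _ mat_alg], intro allI impI, elim conjE, rule mat_alg)
next
  show "\<exists>(C::real) (A :: nat \<Rightarrow> real \<Rightarrow> ('v update, 'v set, real, 'v set) alg).
      \<forall>V f k \<epsilon> us.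
        finite V \<and> normalized_monotone_submodular V f \<and>
        0 < \<epsilon> \<and> \<epsilon> \<le> 1 \<and> (\<forall>u\<in>set us. elem u \<in> V) \<longrightarrow>
        maintains_approx f (A k \<epsilon>) us {X. X \<subseteq> V \<and> card X \<le> k} f (2 + \<epsilon>) \<and>
        worst_case_expected_queries_le f (A k \<epsilon>) us
          (C * (real k * (1 / \<epsilon>) * lg (real k) ^ 2))"
    by (rule exI[of _ 81], rule exI[of _ card_alg], intro allI impI, elim conjE, rule card_alg)
qed

end
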